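(* Let $\mathcal{D}$ be a finite and skeletal EI-category, and let $I=\bigcup_{a\in\mathcal{D}^0}I_a$ be a set of indices for the primitive idempotents of $\mathbb{C}\mathcal{D}$ up to equivalence, as specified in the context. Let $a,b\in\mathcal{D}^0$, $i\in I_a$ and $j\in I_b$. The number of times that $S(j)$ appears as a Jordan-Hölder factor in $P(i)$ equals the number of times that $S^j\otimes D(S^i)$ appears as an irreducible constituent in the $G_b$-$G_a$-bimodule $\mathbb{C}\mathcal{D}(a,b)$.
   Context: $\mathcal{D}^0$ is the set of objects of $\mathcal{D}$, and $\mathcal{D}(a,b)$ is the set of morphisms with domain $a$ and range $b$; composition is from right to left. A category is an EI-category if every endomorphism is an isomorphism (equivalently, every endomorphism monoid is a group); it is skeletal if no two distinct objects are isomorphic. The category algebra $\mathbb{C}\mathcal{D}$ is the $\mathbb{C}$-vector space with basis the morphisms of $\mathcal{D}$, with multiplication the bilinear extension of: $m'\cdot m=m'm$ if the composition is defined, and $0$ otherwise. Modules are finite dimensional left modules unless stated otherwise. For $a\in\mathcal{D}^0$ let $G_a=\mathcal{D}(a,a)$ be its automorphism group and $E_a$ a complete set of primitive orthogonal idempotents of $\mathbb{C}G_a\subseteq\mathbb{C}\mathcal{D}$. Two primitive idempotents $e,f$ of an algebra $A$ are equivalent if $Ae\simeq Af$. Let $I_a$ be a set of indices of the idempotents of $E_a$ up to equivalence (one representative $e_i\in E_a$, $i\in I_a$, per equivalence class in $\mathbb{C}G_a$), with $I_a\cap I_b=\varnothing$ for $a\ne b$. The set $\bigcup_a E_a$ is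 a complete set of primitive orthogonal idempotents of $\mathbb{C}\mathcal{D}$, and $I=\bigcup_a I_a$ indexes these idempotents up to equivalence in $\mathbb{C}\mathcal{D}$. For $i\in I_a$: $S^i=\mathbb{C}G_ae_i$ is the corresponding simple $\mathbb{C}G_a$-module, $P(i)=\mathbb{C}\mathcal{D}e_i$ is the corresponding indecomposable projective $\mathbb{C}\mathcal{D}$-module, and $S(i)=P(i)/\mathrm{Rad}\,P(i)$ is the corresponding simple $\mathbb{C}\mathcal{D}$-module. For a left module $M$, $D(M)=\mathrm{Hom}_{\mathbb{C}}(M,\mathbb{C})$ is the dual right module with $(\varphi\cdot x)(v)=\varphi(xv)$. $\mathbb{C}\mathcal{D}(a,b)$ is the vector space with basis $\mathcal{D}(a,b)$; it is a $\mathbb{C}G_b$-$\mathbb{C}G_a$-bimodule via $(g_1,g_2)\cdot m=g_1mg_2$. The bimodule $S^j\otimes D(S^i)$ (tensor over $\mathbb{C}$) has $G_b$ acting on the left on $S^j$ and $G_a$ acting on the right on $D(S^i)$. *)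

theory Defs
  imports Complex_Main "HOL-Algebra.AbelCoset" "HOL-Algebra.Module" "HOL-Library.Poly_Mapping"
begin

section \<open>Finite categories\<close>

record ('o, 'm) cat =
  Obj :: "'o set"
  Arr :: "'m set"
  Dom :: "'m \<Rightarrow> 'o"
  Cod :: "'m \<Rightarrow> 'o"
  Id :: "'o \<Rightarrow> 'm"
  Comp :: "'m \<Rightarrow> 'm \<Rightarrow> 'm"

definition hom_set :: "('o, 'm) cat \<Rightarrow> 'o \<Rightarrow> 'o \<Rightarrow> 'm set"
  where "hom_set \<D> a b = {m \<in> Arr \<D>. Dom \<D> m = a \<and> Cod \<D> m = b}"

text \<open>\<open>Comp \<D> g f\<close> is the composite \<open>g f\<close> (first \<open>f\<close>, then \<open>g\<close>); it is meaningful only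
  when \<open>Dom \<D> g = Cod \<D> f\<close>.\<close>

locale category =
  fixes \<D> :: "('o, 'm) cat"
  assumes Dom_Obj: "m \<in> Arr \<D> \<Longrightarrow> Dom \<D> m \<in> Obj \<D>"
    and Cod_Obj: "m \<in> Arr \<D> \<Longrightarrow> Cod \<D> m \<in> Obj \<D>"
    and Id_hom: "a \<in> Obj \<D> \<Longrightarrow> Id \<D> a \<in> hom_set \<D> a a"
    and Comp_hom: "f \<in> hom_set \<D> a b \<Longrightarrow> g \<in> hom_set \<D> b c \<Longrightarrow> Comp \<D> g f \<in> hom_set \<D> a c"
    and Comp_assoc: "f \<in> hom_set \<D> a b \<Longrightarrow> g \<in> hom_set \<D> b c \<Longrightarrow> h \<in> hom_set \<D> c d
      \<Longrightarrow> Comp \<D> h (Comp \<D> g f) = Comp \<D> (Comp \<D> h g) f"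
    and Comp_Id_right: "f \<in> hom_set \<D> a b \<Longrightarrow> Comp \<D> f (Id \<D> a) = f"
    and Comp_Id_left: "f \<in> hom_set \<D> a b \<Longrightarrow> Comp \<D> (Id \<D> b) f = f"

definition finite_cat :: "('o, 'm) cat \<Rightarrow> bool"
  where "finite_cat \<D> \<longleftrightarrow> finite (Obj \<D>) \<and> finite (Arr \<D>)"

definition is_iso :: "('o, 'm) cat \<Rightarrow> 'o \<Rightarrow> 'o \<Rightarrow> 'm \<Rightarrow> bool"
  where "is_iso \<D> a b f \<longleftrightarrow> f \<in> hom_set \<D> a b \<and>
    (\<exists>g \<in> hom_set \<D> b a. Comp \<D> g f = Id \<D> a \<and> Comp \<D> f g = Id \<D> b)"

definition EI_cat :: "('o, 'm) cat \<Rightarrow> bool"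
  where "EI_cat \<D> \<longleftrightarrow> (\<forall>a \<in> Obj \<D>. \<forall>f \<in> hom_set \<D> a a. is_iso \<D> a a f)"

definition skeletal :: "('o, 'm) cat \<Rightarrow> bool"
  where "skeletal \<D> \<longleftrightarrow> (\<forall>a \<in> Obj \<D>. \<forall>b \<in> Obj \<D>. (\<exists>f. is_iso \<D> a b f) \<longrightarrow> a = b)"


section \<open>Formal complex linear combinations\<close>

definition cscale :: "complex \<Rightarrow> ('k \<Rightarrow>\<^sub>0 complex) \<Rightarrow> ('k \<Rightarrow>\<^sub>0 complex)"
  where "cscale c x = Poly_Mapping.map (\<lambda>z. c * z) x"

lemma lookup_cscale [simp]: "Poly_Mapping.lookup (cscale c x) k = c * Poly_Mapping.lookup x k"
  unfolding cscale_def by (simp add: Poly_Mapping.map.rep_eq when_def)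

global_interpretation cvec: vector_space cscale
  by unfold_locales (rule poly_mapping_eqI, simp add: lookup_add algebra_simps)+

definition lin_ext :: "('k \<Rightarrow> ('l \<Rightarrow>\<^sub>0 complex)) \<Rightarrow> ('k \<Rightarrow>\<^sub>0 complex) \<Rightarrow> ('l \<Rightarrow>\<^sub>0 complex)"
  where "lin_ext f x = (\<Sum>k \<in> Poly_Mapping.keys x. cscale (Poly_Mapping.lookup x k) (f k))"

definition basis_elt :: "'k \<Rightarrow> ('k \<Rightarrow>\<^sub>0 complex)"
  where "basis_elt k = Poly_Mapping.single k 1"


section \<open>Category algebras and group algebras\<close>

text \<open>A complex algebra is encoded by the record type \<open>(complex, _) module\<close>, which carries a ring
  structure together with a scalar multiplication by complex numbers.\<close>

definition conv :: "('o, 'm) cat \<Rightarrow> ('m \<Rightarrow>\<^sub>0 complex) \<Rightarrow> ('m \<Rightarrow>\<^sub>0 complex) \<Rightarrow> ('m \<Rightarrow>\<^sub>0 complex)"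
  where "conv \<D> x y =
    lin_ext (\<lambda>m'. lin_ext (\<lambda>m. if Dom \<D> m' = Cod \<D> m then basis_elt (Comp \<D> m' m) else 0) y) x"

definition category_algebra :: "('o, 'm) cat \<Rightarrow> (complex, 'm \<Rightarrow>\<^sub>0 complex) module"
  where "category_algebra \<D> = \<lparr>
    carrier = {x. Poly_Mapping.keys x \<subseteq> Arr \<D>},
    mult = conv \<D>,
    one = (\<Sum>a \<in> Obj \<D>. basis_elt (Id \<D> a)),
    zero = 0,
    add = (+),
    smult = cscale\<rparr>"

text \<open>The group algebra of the automorphism group of \<open>a\<close>, as a subset of the category algebra.
  Its unit is the identity of \<open>a\<close>, not the unit of the category algebra.\<close>

definition group_algebra :: "('o, 'm) cat \<Rightarrow> 'o \<Rightarrow> (complex, 'm \<Rightarrow>\<^sub>0 complex) module"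
  where "group_algebra \<D> a = (category_algebra \<D>)
    \<lparr>carrier := {x. Poly_Mapping.keys x \<subseteq> hom_set \<D> a a}, one := basis_elt (Id \<D> a)\<rparr>"


section \<open>Left modules over a not necessarily commutative ring\<close>

text \<open>The locale \<^locale>\<open>submodule\<close> of the library does not require commutativity and is used as it is.
  The fields \<open>mult\<close> and \<open>one\<close> of a module record play no role and are left undefined below.\<close>

locale left_module = R?: ring R + M?: abelian_group M
  for R :: "('r, 's) ring_scheme" (structure) and M :: "('r, 'v, 't) module_scheme" (structure) +
  assumes act_closed: "r \<in> carrier R \<Longrightarrow> x \<in> carrier M \<Longrightarrow> r \<odot>\<^bsub>M\<^esub> x \<in> carrier M"
    and act_add_left: "r \<in> carrier R \<Longrightarrow> s \<in> carrier R \<Longrightarrow> x \<in> carrier M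
      \<Longrightarrow> (r \<oplus>\<^bsub>R\<^esub> s) \<odot>\<^bsub>M\<^esub> x = r \<odot>\<^bsub>M\<^esub> x \<oplus>\<^bsub>M\<^esub> s \<odot>\<^bsub>M\<^esub> x"
    and act_add_right: "r \<in> carrier R \<Longrightarrow> x \<in> carrier M \<Longrightarrow> y \<in> carrier M
      \<Longrightarrow> r \<odot>\<^bsub>M\<^esub> (x \<oplus>\<^bsub>M\<^esub> y) = r \<odot>\<^bsub>M\<^esub> x \<oplus>\<^bsub>M\<^esub> r \<odot>\<^bsub>M\<^esub> y"
    and act_assoc: "r \<in> carrier R \<Longrightarrow> s \<in> carrier R \<Longrightarrow> x \<in> carrier M
      \<Longrightarrow> (r \<otimes>\<^bsub>R\<^esub> s) \<odot>\<^bsub>M\<^esub> x = r \<odot>\<^bsub>M\<^esub> (s \<odot>\<^bsub>M\<^esub> x)"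
    and act_one: "x \<in> carrier M \<Longrightarrow> \<one>\<^bsub>R\<^esub> \<odot>\<^bsub>M\<^esub> x = x"

definition module_isomorphic ::
  "('r, 's) ring_scheme \<Rightarrow> ('r, 'v, 't) module_scheme \<Rightarrow> ('r, 'w, 'u) module_scheme \<Rightarrow> bool"
  where "module_isomorphic R M N \<longleftrightarrow> (\<exists>f. bij_betw f (carrier M) (carrier N) \<and>
    (\<forall>x \<in> carrier M. \<forall>y \<in> carrier M. f (x \<oplus>\<^bsub>M\<^esub> y) = f x \<oplus>\<^bsub>N\<^esub> f y) \<and>
    (\<forall>r \<in> carrier R. \<forall>x \<in> carrier M. f (r \<odot>\<^bsub>M\<^esub> x) = r \<odot>\<^bsub>N\<^esub> f x))"

definition simple_module :: "('r, 's) ring_scheme \<Rightarrow> ('r, 'v, 't) module_scheme \<Rightarrow> bool"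
  where "simple_module R M \<longleftrightarrow> left_module R M \<and> carrier M \<noteq> {\<zero>\<^bsub>M\<^esub>} \<and>
    (\<forall>N. submodule N R M \<longrightarrow> N = {\<zero>\<^bsub>M\<^esub>} \<or> N = carrier M)"

definition quotient_module :: "('r, 'v, 't) module_scheme \<Rightarrow> 'v set \<Rightarrow> ('r, 'v set) module"
  where "quotient_module M N = \<lparr>
    carrier = a_rcosets\<^bsub>M\<^esub> N,
    mult = undefined,
    one = undefined,
    zero = N,
    add = (\<lambda>X Y. X <+>\<^bsub>M\<^esub> Y),
    smult = (\<lambda>r X. \<Union>x \<in> X. N +>\<^bsub>M\<^esub> (r \<odot>\<^bsub>M\<^esub> x))\<rparr>"

definition maximal_submodule :: "'v set \<Rightarrow> ('r, 's) ring_scheme \<Rightarrow> ('r, 'v, 't) module_scheme \<Rightarrow> bool"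
  where "maximal_submodule N R M \<longleftrightarrow> submodule N R M \<and> N \<noteq> carrier M \<and>
    (\<forall>L. submodule L R M \<and> N \<subseteq> L \<longrightarrow> L = N \<or> L = carrier M)"

definition module_radical :: "('r, 's) ring_scheme \<Rightarrow> ('r, 'v, 't) module_scheme \<Rightarrow> 'v set"
  where "module_radical R M = carrier M \<inter> \<Inter>{N. maximal_submodule N R M}"

definition subquotient :: "('r, 'v, 't) module_scheme \<Rightarrow> 'v set \<Rightarrow> 'v set \<Rightarrow> ('r, 'v set) module"
  where "subquotient M N L = quotient_module (M\<lparr>carrier := N\<rparr>) L"

definition composition_series ::
  "('r, 's) ring_scheme \<Rightarrow> ('r, 'v, 't) module_scheme \<Rightarrow> 'v set list \<Rightarrow> bool"
  where "composition_series R M Ns \<longleftrightarrow> left_module R M \<and> Ns \<noteq> [] \<and>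
    hd Ns = {\<zero>\<^bsub>M\<^esub>} \<and> last Ns = carrier M \<and> (\<forall>N \<in> set Ns. submodule N R M) \<and>
    (\<forall>k. Suc k < length Ns \<longrightarrow>
      Ns ! k \<subseteq> Ns ! Suc k \<and> simple_module R (subquotient M (Ns ! Suc k) (Ns ! k)))"

text \<open>\<open>S\<close> appears \<open>n\<close> times as a Jordan--Hoelder factor of \<open>M\<close>. The number is required to be
  independent of the composition series, and a composition series is required to exist.\<close>

definition jordan_hoelder_multiplicity ::
  "('r, 's) ring_scheme \<Rightarrow> ('r, 'v, 't) module_scheme \<Rightarrow> ('r, 'w, 'u) module_scheme \<Rightarrow> nat \<Rightarrow> bool"
  where "jordan_hoelder_multiplicity R M S n \<longleftrightarrow>
    (\<exists>Ns. composition_series R M Ns) \<and>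
    (\<forall>Ns. composition_series R M Ns \<longrightarrow>
      card {k. Suc k < length Ns \<and>
        module_isomorphic R (subquotient M (Ns ! Suc k) (Ns ! k)) S} = n)"


section \<open>Idempotents\<close>

definition orthogonal :: "('r, 's) ring_scheme \<Rightarrow> 'r \<Rightarrow> 'r \<Rightarrow> bool"
  where "orthogonal R e f \<longleftrightarrow> e \<otimes>\<^bsub>R\<^esub> f = \<zero>\<^bsub>R\<^esub> \<and> f \<otimes>\<^bsub>R\<^esub> e = \<zero>\<^bsub>R\<^esub>"

definition idempotent :: "('r, 's) ring_scheme \<Rightarrow> 'r \<Rightarrow> bool"
  where "idempotent R e \<longleftrightarrow> e \<in> carrier R \<and> e \<otimes>\<^bsub>R\<^esub> e = e"

definition primitive_idempotent :: "('r, 's) ring_scheme \<Rightarrow> 'r \<Rightarrow> bool"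
  where "primitive_idempotent R e \<longleftrightarrow> idempotent R e \<and> e \<noteq> \<zero>\<^bsub>R\<^esub> \<and>
    (\<forall>f g. idempotent R f \<and> idempotent R g \<and> orthogonal R f g \<and> e = f \<oplus>\<^bsub>R\<^esub> g
      \<longrightarrow> f = \<zero>\<^bsub>R\<^esub> \<or> g = \<zero>\<^bsub>R\<^esub>)"

definition complete_primitive_orthogonal_idempotents :: "('r, 's) ring_scheme \<Rightarrow> 'r set \<Rightarrow> bool"
  where "complete_primitive_orthogonal_idempotents R E \<longleftrightarrow>
    finite E \<and> (\<forall>e \<in> E. primitive_idempotent R e) \<and>
    (\<forall>e \<in> E. \<forall>f \<in> E. e \<noteq> f \<longrightarrow> orthogonal R e f) \<and>
    (\<Oplus>\<^bsub>R\<^esub>e \<in> E. e) = \<one>\<^bsub>R\<^esub>"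

definition left_ideal_module :: "('r, 's) ring_scheme \<Rightarrow> 'r \<Rightarrow> ('r, 'r) module"
  where "left_ideal_module R e = \<lparr>
    carrier = {x \<otimes>\<^bsub>R\<^esub> e | x. x \<in> carrier R},
    mult = undefined,
    one = undefined,
    zero = \<zero>\<^bsub>R\<^esub>,
    add = (\<lambda>x y. x \<oplus>\<^bsub>R\<^esub> y),
    smult = (\<lambda>r x. r \<otimes>\<^bsub>R\<^esub> x)\<rparr>"

definition equivalent_idempotents :: "('r, 's) ring_scheme \<Rightarrow> 'r \<Rightarrow> 'r \<Rightarrow> bool"
  where "equivalent_idempotents R e f \<longleftrightarrow>
    module_isomorphic R (left_ideal_module R e) (left_ideal_module R f)"

text \<open>The elements \<open>e i\<close>, for \<open>i\<close> in \<open>J\<close>, form a system of representatives of the equivalence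
  classes of \<open>E\<close>, each class being represented by exactly one index.\<close>

definition indexes_idempotents ::
  "('r, 's) ring_scheme \<Rightarrow> 'r set \<Rightarrow> 'i set \<Rightarrow> ('i \<Rightarrow> 'r) \<Rightarrow> bool"
  where "indexes_idempotents R E J e \<longleftrightarrow>
    (\<forall>i \<in> J. e i \<in> E) \<and> (\<forall>f \<in> E. \<exists>!i. i \<in> J \<and> equivalent_idempotents R (e i) f)"


section \<open>Bimodules over complex algebras\<close>

record ('r, 'v) right_module = "'v ring" +
  rsmult :: "'v \<Rightarrow> 'r \<Rightarrow> 'v"

record ('r, 's, 'v) bimodule = "('r, 'v) module" +
  bi_rsmult :: "'v \<Rightarrow> 's \<Rightarrow> 'v"

abbreviation scalar_elt :: "(complex, 'r, 't) module_scheme \<Rightarrow> complex \<Rightarrow> 'r"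
  where "scalar_elt A c \<equiv> c \<odot>\<^bsub>A\<^esub> \<one>\<^bsub>A\<^esub>"

text \<open>The last axiom says that complex scalars act in the same way from both sides.\<close>

locale bimodule = left_module A M + B?: ring B
  for A :: "(complex, 'r, 'p) module_scheme" and B :: "(complex, 's, 'q) module_scheme"
    and M :: "('r, 's, 'v, 't) bimodule_scheme" +
  assumes ract_closed: "x \<in> carrier M \<Longrightarrow> s \<in> carrier B \<Longrightarrow> bi_rsmult M x s \<in> carrier M"
    and ract_add_right: "x \<in> carrier M \<Longrightarrow> s \<in> carrier B \<Longrightarrow> t \<in> carrier B
      \<Longrightarrow> bi_rsmult M x (s \<oplus>\<^bsub>B\<^esub> t) = bi_rsmult M x s \<oplus>\<^bsub>M\<^esub> bi_rsmult M x t"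
    and ract_add_left: "x \<in> carrier M \<Longrightarrow> y \<in> carrier M \<Longrightarrow> s \<in> carrier B
      \<Longrightarrow> bi_rsmult M (x \<oplus>\<^bsub>M\<^esub> y) s = bi_rsmult M x s \<oplus>\<^bsub>M\<^esub> bi_rsmult M y s"
    and ract_assoc: "x \<in> carrier M \<Longrightarrow> s \<in> carrier B \<Longrightarrow> t \<in> carrier B
      \<Longrightarrow> bi_rsmult M x (s \<otimes>\<^bsub>B\<^esub> t) = bi_rsmult M (bi_rsmult M x s) t"
    and ract_one: "x \<in> carrier M \<Longrightarrow> bi_rsmult M x \<one>\<^bsub>B\<^esub> = x"
    and act_ract: "r \<in> carrier A \<Longrightarrow> x \<in> carrier M \<Longrightarrow> s \<in> carrier B
      \<Longrightarrow> bi_rsmult M (r \<odot>\<^bsub>M\<^esub> x) s = r \<odot>\<^bsub>M\<^esub> bi_rsmult M x s"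
    and scalar_act: "x \<in> carrier M
      \<Longrightarrow> scalar_elt A c \<odot>\<^bsub>M\<^esub> x = bi_rsmult M x (scalar_elt B c)"

definition sub_bimodule ::
  "'v set \<Rightarrow> ('r, 'p) ring_scheme \<Rightarrow> ('s, 'q) ring_scheme \<Rightarrow> ('r, 's, 'v, 't) bimodule_scheme \<Rightarrow> bool"
  where "sub_bimodule N A B M \<longleftrightarrow> submodule N A M \<and>
    (\<forall>x \<in> N. \<forall>s \<in> carrier B. bi_rsmult M x s \<in> N)"

definition bimodule_isomorphic ::
  "('r, 'p) ring_scheme \<Rightarrow> ('s, 'q) ring_scheme \<Rightarrow>
    ('r, 's, 'v, 't) bimodule_scheme \<Rightarrow> ('r, 's, 'w, 'u) bimodule_scheme \<Rightarrow> bool"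
  where "bimodule_isomorphic A B M N \<longleftrightarrow> (\<exists>f. bij_betw f (carrier M) (carrier N) \<and>
    (\<forall>x \<in> carrier M. \<forall>y \<in> carrier M. f (x \<oplus>\<^bsub>M\<^esub> y) = f x \<oplus>\<^bsub>N\<^esub> f y) \<and>
    (\<forall>r \<in> carrier A. \<forall>x \<in> carrier M. f (r \<odot>\<^bsub>M\<^esub> x) = r \<odot>\<^bsub>N\<^esub> f x) \<and>
    (\<forall>s \<in> carrier B. \<forall>x \<in> carrier M. f (bi_rsmult M x s) = bi_rsmult N (f x) s))"

definition irreducible_bimodule ::
  "(complex, 'r, 'p) module_scheme \<Rightarrow> (complex, 's, 'q) module_scheme \<Rightarrow>
    ('r, 's, 'v, 't) bimodule_scheme \<Rightarrow> bool"
  where "irreducible_bimodule A B M \<longleftrightarrow> bimodule A B M \<and> carrier M \<noteq> {\<zero>\<^bsub>M\<^esub>} \<and>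
    (\<forall>N. sub_bimodule N A B M \<longrightarrow> N = {\<zero>\<^bsub>M\<^esub>} \<or> N = carrier M)"

text \<open>\<open>M\<close> is the internal direct sum of the finite set \<open>X\<close> of irreducible sub-bimodules. A set
  suffices here, since the summands of an internal direct sum of nonzero submodules are distinct.\<close>

definition irreducible_decomposition ::
  "(complex, 'r, 'p) module_scheme \<Rightarrow> (complex, 's, 'q) module_scheme \<Rightarrow>
    ('r, 's, 'v, 't) bimodule_scheme \<Rightarrow> 'v set set \<Rightarrow> bool"
  where "irreducible_decomposition A B M X \<longleftrightarrow> bimodule A B M \<and> finite X \<and>
    (\<forall>N \<in> X. sub_bimodule N A B M \<and> irreducible_bimodule A B (M\<lparr>carrier := N\<rparr>)) \<and>
    (\<forall>x \<in> carrier M. \<exists>!f. f \<in> (\<Pi>\<^sub>E N \<in> X. N) \<and> x = (\<Oplus>\<^bsub>M\<^esub>N \<in> X. f N))"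

text \<open>\<open>S\<close> appears \<open>n\<close> times as an irreducible constituent of the (semisimple) bimodule \<open>M\<close>. The
  number is required to be independent of the decomposition, and a decomposition is required to
  exist.\<close>

definition constituent_multiplicity ::
  "(complex, 'r, 'p) module_scheme \<Rightarrow> (complex, 's, 'q) module_scheme \<Rightarrow>
    ('r, 's, 'v, 't) bimodule_scheme \<Rightarrow> ('r, 's, 'w, 'u) bimodule_scheme \<Rightarrow> nat \<Rightarrow> bool"
  where "constituent_multiplicity A B M S n \<longleftrightarrow>
    (\<exists>X. irreducible_decomposition A B M X) \<and>
    (\<forall>X. irreducible_decomposition A B M X \<longrightarrow>
      card {N \<in> X. bimodule_isomorphic A B (M\<lparr>carrier := N\<rparr>) S} = n)"


section \<open>Duals and tensor products\<close>

definition dual_module ::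
  "(complex, 'r, 'p) module_scheme \<Rightarrow> ('r, 'v, 't) module_scheme \<Rightarrow> ('r, 'v \<Rightarrow> complex) right_module"
  where "dual_module A M = \<lparr>
    carrier = {\<phi> \<in> extensional (carrier M).
      (\<forall>u \<in> carrier M. \<forall>v \<in> carrier M. \<phi> (u \<oplus>\<^bsub>M\<^esub> v) = \<phi> u + \<phi> v) \<and>
      (\<forall>c. \<forall>v \<in> carrier M. \<phi> (scalar_elt A c \<odot>\<^bsub>M\<^esub> v) = c * \<phi> v)},
    mult = undefined,
    one = undefined,
    zero = (\<lambda>v \<in> carrier M. 0),
    add = (\<lambda>\<phi> \<psi>. \<lambda>v \<in> carrier M. \<phi> v + \<psi> v),
    rsmult = (\<lambda>\<phi> x. \<lambda>v \<in> carrier M. \<phi> (x \<odot>\<^bsub>M\<^esub> v))\<rparr>"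

text \<open>The tensor product over the complex numbers of a left \<open>A\<close>-module \<open>V\<close> and a right
  \<open>B\<close>-module \<open>W\<close>: the free vector space on the pairs \<open>(v, w)\<close> modulo the span of the
  bilinearity relations.\<close>

definition free_vector_space :: "'k set \<Rightarrow> (complex, 'k \<Rightarrow>\<^sub>0 complex) module"
  where "free_vector_space K = \<lparr>
    carrier = {x. Poly_Mapping.keys x \<subseteq> K},
    mult = undefined,
    one = undefined,
    zero = 0,
    add = (+),
    smult = cscale\<rparr>"

definition tensor_relations ::
  "(complex, 'r, 'p) module_scheme \<Rightarrow> (complex, 's, 'q) module_scheme \<Rightarrow>
    ('r, 'v, 't) module_scheme \<Rightarrow> ('s, 'w, 'u) right_module_scheme \<Rightarrow> ('v \<times> 'w \<Rightarrow>\<^sub>0 complex) set"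
  where "tensor_relations A B V W =
    {basis_elt (v \<oplus>\<^bsub>V\<^esub> v', w) - basis_elt (v, w) - basis_elt (v', w) | v v' w.
      v \<in> carrier V \<and> v' \<in> carrier V \<and> w \<in> carrier W} \<union>
    {basis_elt (v, w \<oplus>\<^bsub>W\<^esub> w') - basis_elt (v, w) - basis_elt (v, w') | v w w'.
      v \<in> carrier V \<and> w \<in> carrier W \<and> w' \<in> carrier W} \<union>
    {basis_elt (scalar_elt A c \<odot>\<^bsub>V\<^esub> v, w) - cscale c (basis_elt (v, w)) | c v w.
      v \<in> carrier V \<and> w \<in> carrier W} \<union>
    {basis_elt (v, rsmult W w (scalar_elt B c)) - cscale c (basis_elt (v, w)) | c v w.
      v \<in> carrier V \<and> w \<in> carrier W}"

definition tensor_bimodule ::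
  "(complex, 'r, 'p) module_scheme \<Rightarrow> (complex, 's, 'q) module_scheme \<Rightarrow>
    ('r, 'v, 't) module_scheme \<Rightarrow> ('s, 'w, 'u) right_module_scheme \<Rightarrow>
    ('r, 's, ('v \<times> 'w \<Rightarrow>\<^sub>0 complex) set) bimodule"
  where "tensor_bimodule A B V W =
    (let F = free_vector_space (carrier V \<times> carrier W);
         K = cvec.span (tensor_relations A B V W)
     in \<lparr>
      carrier = a_rcosets\<^bsub>F\<^esub> K,
      mult = undefined,
      one = undefined,
      zero = K,
      add = (\<lambda>X Y. X <+>\<^bsub>F\<^esub> Y),
      smult = (\<lambda>r X. \<Union>x \<in> X. K +>\<^bsub>F\<^esub> lin_ext (\<lambda>(v, w). basis_elt (r \<odot>\<^bsub>V\<^esub> v, w)) x),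
      bi_rsmult = (\<lambda>X s. \<Union>x \<in> X. K +>\<^bsub>F\<^esub> lin_ext (\<lambda>(v, w). basis_elt (v, rsmult W w s)) x)\<rparr>)"


section \<open>The modules attached to an idempotent of a group algebra\<close>

definition simple_group_module :: "('o, 'm) cat \<Rightarrow> 'o \<Rightarrow> ('m \<Rightarrow>\<^sub>0 complex) \<Rightarrow>
    ('m \<Rightarrow>\<^sub>0 complex, 'm \<Rightarrow>\<^sub>0 complex) module"
  where "simple_group_module \<D> a e = left_ideal_module (group_algebra \<D> a) e"

definition projective_module :: "('o, 'm) cat \<Rightarrow> ('m \<Rightarrow>\<^sub>0 complex) \<Rightarrow>
    ('m \<Rightarrow>\<^sub>0 complex, 'm \<Rightarrow>\<^sub>0 complex) module"
  where "projective_module \<D> e = left_ideal_module (category_algebra \<D>) e"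

definition simple_category_module :: "('o, 'm) cat \<Rightarrow> ('m \<Rightarrow>\<^sub>0 complex) \<Rightarrow>
    ('m \<Rightarrow>\<^sub>0 complex, ('m \<Rightarrow>\<^sub>0 complex) set) module"
  where "simple_category_module \<D> e =
    quotient_module (projective_module \<D> e)
      (module_radical (category_algebra \<D>) (projective_module \<D> e))"

text \<open>The space with basis \<open>\<D>(a, b)\<close>, on which the two group algebras act by the multiplication
  of the category algebra.\<close>

definition hom_bimodule :: "('o, 'm) cat \<Rightarrow> 'o \<Rightarrow> 'o \<Rightarrow>
    ('m \<Rightarrow>\<^sub>0 complex, 'm \<Rightarrow>\<^sub>0 complex, 'm \<Rightarrow>\<^sub>0 complex) bimodule"
  where "hom_bimodule \<D> a b = \<lparr>
    carrier = {x. Poly_Mapping.keys x \<subseteq> hom_set \<D> a b},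
    mult = undefined,
    one = undefined,
    zero = 0,
    add = (+),
    smult = conv \<D>,
    bi_rsmult = conv \<D>\<rparr>"

end

theory Submission
  imports Defs "HOL-Computational_Algebra.Fundamental_Theorem_Algebra"
begin

text \<open>
  Let \<open>A\<close> be the category algebra, \<open>e\<close> the idempotent of \<open>i\<close> and \<open>f\<close> the idempotent of \<open>j\<close>. Both
  multiplicities are the dimension of the corner \<open>f A e\<close>. As \<open>f\<close> and \<open>e\<close> only see the morphisms
  from \<open>a\<close> to \<open>b\<close>, this corner is also \<open>f M e\<close>, where \<open>M\<close> is the bimodule of these morphisms.

  The common source is that a primitive idempotent \<open>f\<close> of the group algebra of an object \<open>c\<close> has a
  one-dimensional corner, spanned by \<open>f\<close> (\<open>corner_scalar\<close>). The EI property enters here: the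
  endomorphisms of \<open>c\<close> form a group, so invariant subspaces have invariant complements by averaging.
  Since multiplying by \<open>f\<close> on both sides kills all morphisms that are not endomorphisms of \<open>c\<close>,
  \<open>f A f\<close> is one-dimensional too.

  For the projective module \<open>P e = A e\<close>, take a simple subquotient \<open>N / L\<close>. If \<open>f x\<close> is outside \<open>L\<close>
  for some \<open>x\<close> in \<open>N\<close>, then right multiplication by \<open>x\<close> maps \<open>A f\<close> onto \<open>N / L\<close>. Its kernel is the
  radical, because a submodule of \<open>A f\<close> is proper exactly if \<open>f\<close> annihilates it; so \<open>N / L\<close> is
  isomorphic to the simple module of \<open>f\<close>, and \<open>f N\<close> is \<open>f L\<close> plus the line through \<open>f x\<close>. If there is
  no such \<open>x\<close>, then \<open>f N = f L\<close> and \<open>N / L\<close> is another simple module. Along any composition series,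
  \<open>dim (f N)\<close> therefore counts the factors isomorphic to the simple module of \<open>f\<close>
  (\<open>jordan_hoelder_multiplicity_projective\<close>).

  The bimodule \<open>M\<close> is a direct sum of irreducible ones, again by averaging. An irreducible bimodule \<open>N\<close>
  is generated by any nonzero \<open>t\<close> in its corner \<open>f N e\<close>, which makes the corner the line through \<open>t\<close>;
  so \<open>dim (f M e)\<close> counts the summands with a nonzero corner (\<open>card_corner_summands\<close>). These
  are the summands isomorphic to the tensor product (\<open>tensor_isomorphic_iff\<close>): every functional \<open>\<phi>\<close> on
  the left ideal of \<open>e\<close> is represented by an element \<open>y\<close> of the right ideal of \<open>e\<close>, through
  \<open>y v = \<phi> (v) e\<close>, and \<open>v \<otimes> \<phi> \<mapsto> v t y\<close> is the isomorphism onto \<open>N\<close>. Both the representation of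
  functionals and the injectivity of this map rest on finite dual generating families of the left
  and right ideals of an idempotent, which come from the unit of the two-sided ideal that it
  generates (\<open>dual_generators\<close>).
\<close>

section \<open>Modules over a ring\<close>

context left_module
begin

lemma act_zero_left:
  assumes "x \<in> carrier M" shows "\<zero>\<^bsub>R\<^esub> \<odot>\<^bsub>M\<^esub> x = \<zero>\<^bsub>M\<^esub>"
proof -
  have "\<zero>\<^bsub>R\<^esub> \<odot>\<^bsub>M\<^esub> x \<oplus>\<^bsub>M\<^esub> \<zero>\<^bsub>R\<^esub> \<odot>\<^bsub>M\<^esub> x = \<zero>\<^bsub>R\<^esub> \<odot>\<^bsub>M\<^esub> x"
    using act_add_left[OF R.zero_closed R.zero_closed assms] by simp
  then show ?thesis
    using act_closed[OF R.zero_closed assms] by (metis M.add.r_cancel_one)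
qed

text \<open>Negatives come from the ring, so a submodule need only be closed under addition and the action.\<close>

lemma act_minus_one:
  assumes x: "x \<in> carrier M" shows "(\<ominus>\<^bsub>R\<^esub> \<one>\<^bsub>R\<^esub>) \<odot>\<^bsub>M\<^esub> x = \<ominus>\<^bsub>M\<^esub> x"
proof -
  have "x \<oplus>\<^bsub>M\<^esub> (\<ominus>\<^bsub>R\<^esub> \<one>\<^bsub>R\<^esub>) \<odot>\<^bsub>M\<^esub> x = (\<one>\<^bsub>R\<^esub> \<oplus>\<^bsub>R\<^esub> \<ominus>\<^bsub>R\<^esub> \<one>\<^bsub>R\<^esub>) \<odot>\<^bsub>M\<^esub> x"
    using x by (simp add: act_add_left act_one)
  also have "\<dots> = \<zero>\<^bsub>M\<^esub>"
    using x by (simp add: R.r_neg act_zero_left)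
  finally show ?thesis
    using x act_closed by (metis M.minus_equality M.a_comm R.a_inv_closed R.one_closed)
qed

lemma submodule_iff:
  "submodule N R M \<longleftrightarrow> N \<subseteq> carrier M \<and> \<zero>\<^bsub>M\<^esub> \<in> N \<and>
    (\<forall>x \<in> N. \<forall>y \<in> N. x \<oplus>\<^bsub>M\<^esub> y \<in> N) \<and> (\<forall>r \<in> carrier R. \<forall>x \<in> N. r \<odot>\<^bsub>M\<^esub> x \<in> N)"
  (is "_ \<longleftrightarrow> ?P")
proof
  assume "submodule N R M"
  then interpret submodule N R M .
  show ?P
    using subset one_closed m_closed by auto
next
  assume P: ?P
  have "\<ominus>\<^bsub>M\<^esub> x \<in> N" if "x \<in> N" for x
    using P that act_minus_one[of x] by (metis R.a_inv_closed R.one_closed subsetD)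
  with P show "submodule N R M"
    by (intro submodule.intro subgroup.intro submodule_axioms.intro) (auto simp: a_inv_def)
qed

lemma left_module_sub:
  assumes "submodule N R M"
  shows "left_module R (M\<lparr>carrier := N\<rparr>)"
proof -
  have N: "N \<subseteq> carrier M" "\<zero>\<^bsub>M\<^esub> \<in> N" "\<And>x y. x \<in> N \<Longrightarrow> y \<in> N \<Longrightarrow> x \<oplus>\<^bsub>M\<^esub> y \<in> N"
    "\<And>r x. r \<in> carrier R \<Longrightarrow> x \<in> N \<Longrightarrow> r \<odot>\<^bsub>M\<^esub> x \<in> N"
    using assms by (auto simp: submodule_iff)
  interpret S: submodule N R M by fact
  have "abelian_group (M\<lparr>carrier := N\<rparr>)"
  proof (rule abelian_groupI)
    fix x assume "x \<in> carrier (M\<lparr>carrier := N\<rparr>)"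
    then show "\<exists>y \<in> carrier (M\<lparr>carrier := N\<rparr>). y \<oplus>\<^bsub>M\<lparr>carrier := N\<rparr>\<^esub> x = \<zero>\<^bsub>M\<lparr>carrier := N\<rparr>\<^esub>"
      using S.m_inv_closed[of x] N(1) M.l_neg[of x]
      by (intro bexI[of _ "\<ominus>\<^bsub>M\<^esub> x"]) (auto simp: a_inv_def)
  qed (use N in \<open>auto intro: M.a_assoc M.a_comm simp: subset_iff\<close>)
  then show ?thesis
    using N by (intro left_module.intro left_module_axioms.intro R.ring_axioms)
      (auto simp: act_add_left act_add_right act_assoc act_one subset_iff)
qed

lemma submodule_of_sub:
  assumes "submodule N R M"
  shows "submodule L R (M\<lparr>carrier := N\<rparr>) \<longleftrightarrow> submodule L R M \<and> L \<subseteq> N"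
  using assms left_module.submodule_iff[OF left_module_sub[OF assms]]
  by (auto simp: submodule_iff)

end

lemma mem_coset_iff: "y \<in> L +>\<^bsub>M\<^esub> x \<longleftrightarrow> (\<exists>l \<in> L. y = l \<oplus>\<^bsub>M\<^esub> x)"
  by (auto simp: a_r_coset_def r_coset_def)

locale submodule_of = left_module R M for L and R (structure) and M (structure) +
  assumes sub: "submodule L R M"
begin

sublocale abelian_subgroup L M
  by (rule abelian_subgroupI3)
    (use sub in \<open>auto simp: additive_subgroup_def submodule_def M.abelian_group_axioms\<close>)

abbreviation Q where "Q \<equiv> quotient_module M L"

lemma carrier_quotient: "carrier Q = (\<lambda>x. L +>\<^bsub>M\<^esub> x) ` carrier M"
  by (auto simp: quotient_module_def A_RCOSETS_def')

lemma zero_quotient: "\<zero>\<^bsub>Q\<^esub> = L"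
  by (simp add: quotient_module_def)

lemma add_quotient:
  "x \<in> carrier M \<Longrightarrow> y \<in> carrier M \<Longrightarrow> (L +>\<^bsub>M\<^esub> x) \<oplus>\<^bsub>Q\<^esub> (L +>\<^bsub>M\<^esub> y) = L +>\<^bsub>M\<^esub> (x \<oplus>\<^bsub>M\<^esub> y)"
  by (simp add: quotient_module_def a_rcos_sum)

lemma coset_eq_iff:
  assumes "x \<in> carrier M" "y \<in> carrier M"
  shows "L +>\<^bsub>M\<^esub> x = L +>\<^bsub>M\<^esub> y \<longleftrightarrow> x \<ominus>\<^bsub>M\<^esub> y \<in> L"
proof -
  have "L +>\<^bsub>M\<^esub> x = L +>\<^bsub>M\<^esub> y \<longleftrightarrow> x \<in> L +>\<^bsub>M\<^esub> y"
    using a_rcos_self[OF assms(1)] a_repr_independence'[OF _ assms(2)] by blast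
  then show ?thesis
    using a_rcos_module[OF assms(2,1)] by (simp add: a_minus_def)
qed

lemma coset_eq_L_iff:
  assumes "x \<in> carrier M"
  shows "L +>\<^bsub>M\<^esub> x = L \<longleftrightarrow> x \<in> L"
proof -
  have "\<ominus>\<^bsub>M\<^esub> \<zero>\<^bsub>M\<^esub> = \<zero>\<^bsub>M\<^esub>"
    using M.minus_equality[of "\<zero>\<^bsub>M\<^esub>" "\<zero>\<^bsub>M\<^esub>"] by simp
  then have "x \<ominus>\<^bsub>M\<^esub> \<zero>\<^bsub>M\<^esub> = x"
    using assms by (simp add: a_minus_def)
  then show ?thesis
    using assms coset_eq_iff[OF assms M.zero_closed] M.a_coset_add_zero[OF a_subset]
    by simp
qed

lemma act_quotient:
  assumes r: "r \<in> carrier R" and x: "x \<in> carrier M"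
  shows "r \<odot>\<^bsub>Q\<^esub> (L +>\<^bsub>M\<^esub> x) = L +>\<^bsub>M\<^esub> (r \<odot>\<^bsub>M\<^esub> x)"
proof -
  have "L +>\<^bsub>M\<^esub> (r \<odot>\<^bsub>M\<^esub> y) = L +>\<^bsub>M\<^esub> (r \<odot>\<^bsub>M\<^esub> x)" if y: "y \<in> L +>\<^bsub>M\<^esub> x" for y
  proof -
    obtain l where l: "l \<in> L" "y = l \<oplus>\<^bsub>M\<^esub> x"
      using y unfolding mem_coset_iff by meson
    then have "r \<odot>\<^bsub>M\<^esub> y = r \<odot>\<^bsub>M\<^esub> l \<oplus>\<^bsub>M\<^esub> r \<odot>\<^bsub>M\<^esub> x" "r \<odot>\<^bsub>M\<^esub> l \<in> L"
      using r x a_subset sub by (auto simp: act_add_right submodule_iff)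
    then have "r \<odot>\<^bsub>M\<^esub> y \<in> L +>\<^bsub>M\<^esub> (r \<odot>\<^bsub>M\<^esub> x)"
      by (auto simp: mem_coset_iff)
    then show ?thesis
      using a_repr_independence'[of "r \<odot>\<^bsub>M\<^esub> y" "r \<odot>\<^bsub>M\<^esub> x"] act_closed[OF r x] by simp
  qed
  moreover have "x \<in> L +>\<^bsub>M\<^esub> x"
    using x by (rule a_rcos_self)
  ultimately have "(\<Union>y \<in> L +>\<^bsub>M\<^esub> x. L +>\<^bsub>M\<^esub> (r \<odot>\<^bsub>M\<^esub> y)) = L +>\<^bsub>M\<^esub> (r \<odot>\<^bsub>M\<^esub> x)"
    by blast
  then show ?thesis
    by (simp add: quotient_module_def)
qed

lemma left_module_quotient: "left_module R Q"
proof -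
  have "abelian_group Q"
  proof (rule abelian_groupI)
    show "\<zero>\<^bsub>Q\<^esub> \<in> carrier Q"
      using coset_eq_L_iff[OF M.zero_closed] by (force simp: carrier_quotient zero_quotient)
    have z: "\<zero>\<^bsub>Q\<^esub> = L +>\<^bsub>M\<^esub> \<zero>\<^bsub>M\<^esub>"
      using coset_eq_L_iff[OF M.zero_closed] by (simp add: zero_quotient)
    fix X assume "X \<in> carrier Q"
    then obtain x where x: "x \<in> carrier M" "X = L +>\<^bsub>M\<^esub> x"
      by (auto simp: carrier_quotient)
    show "\<zero>\<^bsub>Q\<^esub> \<oplus>\<^bsub>Q\<^esub> X = X"
      using x z by (simp add: add_quotient)
    have "(L +>\<^bsub>M\<^esub> (\<ominus>\<^bsub>M\<^esub> x)) \<oplus>\<^bsub>Q\<^esub> X = \<zero>\<^bsub>Q\<^esub>"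
      using x z by (simp add: add_quotient M.l_neg)
    then show "\<exists>Y \<in> carrier Q. Y \<oplus>\<^bsub>Q\<^esub> X = \<zero>\<^bsub>Q\<^esub>"
      using x by (auto simp: carrier_quotient)
  next
    fix X Y assume "X \<in> carrier Q" "Y \<in> carrier Q"
    then show "X \<oplus>\<^bsub>Q\<^esub> Y = Y \<oplus>\<^bsub>Q\<^esub> X"
      by (clarsimp simp: carrier_quotient add_quotient) (simp add: M.a_comm)
  qed (auto simp: carrier_quotient add_quotient M.a_assoc)
  then show ?thesis
    by (intro left_module.intro left_module_axioms.intro R.ring_axioms)
      (auto simp: carrier_quotient add_quotient act_quotient act_closed
        act_add_left act_add_right act_assoc act_one)
qed

text \<open>Submodules of the quotient by \<open>L\<close> are the images of the submodules that contain \<open>L\<close>.\<close>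

lemma simple_quotient_iff: "simple_module R Q \<longleftrightarrow> maximal_submodule L R M"
proof
  assume simple: "simple_module R Q"
  show "maximal_submodule L R M"
    unfolding maximal_submodule_def
  proof (intro conjI allI impI sub)
    show "L \<noteq> carrier M"
    proof
      assume L: "L = carrier M"
      have "L +>\<^bsub>M\<^esub> x = L" if "x \<in> carrier M" for x
        using that coset_eq_L_iff L by simp
      then have "carrier Q = {L}"
        using M.zero_closed by (auto simp: carrier_quotient)
      then show False
        using simple by (simp add: simple_module_def zero_quotient)
    qed
    fix N assume N: "submodule N R M \<and> L \<subseteq> N"
    let ?N = "(\<lambda>x. L +>\<^bsub>M\<^esub> x) ` N"
    have NM: "N \<subseteq> carrier M"
      using N by (simp add: submodule_iff)
    have closed: "\<zero>\<^bsub>M\<^esub> \<in> N" "\<And>x y. x \<in> N \<Longrightarrow> y \<in> N \<Longrightarrow> x \<oplus>\<^bsub>M\<^esub> y \<in> N"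
      "\<And>r x. r \<in> carrier R \<Longrightarrow> x \<in> N \<Longrightarrow> r \<odot>\<^bsub>M\<^esub> x \<in> N"
      using N by (simp_all add: submodule_iff)
    have "L \<in> ?N"
      using closed(1) coset_eq_L_iff[OF M.zero_closed] by (intro image_eqI[of _ _ "\<zero>\<^bsub>M\<^esub>"]) simp_all
    moreover have "(L +>\<^bsub>M\<^esub> x) \<oplus>\<^bsub>Q\<^esub> (L +>\<^bsub>M\<^esub> y) \<in> ?N" if "x \<in> N" "y \<in> N" for x y
      using that NM closed(2) by (subst add_quotient) auto
    moreover have "r \<odot>\<^bsub>Q\<^esub> (L +>\<^bsub>M\<^esub> x) \<in> ?N" if "r \<in> carrier R" "x \<in> N" for r x
      using that NM closed(3) by (subst act_quotient) auto
    moreover have "?N \<subseteq> carrier Q"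
      unfolding carrier_quotient using NM by (rule image_mono)
    ultimately have "submodule ?N R Q"
      unfolding left_module.submodule_iff[OF left_module_quotient] zero_quotient by blast
    then have "?N = {L} \<or> ?N = carrier Q"
      using simple by (auto simp: simple_module_def zero_quotient)
    then show "N = L \<or> N = carrier M"
    proof
      assume eq: "?N = {L}"
      have "x \<in> L" if x: "x \<in> N" for x
      proof -
        have "L +>\<^bsub>M\<^esub> x = L"
          using eq x by auto
        then show ?thesis
          using coset_eq_L_iff x NM by auto
      qed
      then show ?thesis using N by auto
    next
      assume eq: "?N = carrier Q"
      have "x \<in> N" if x: "x \<in> carrier M" for x
      proof -
        have "L +>\<^bsub>M\<^esub> x \<in> ?N"
          unfolding eq carrier_quotient using x by (rule imageI)
        then obtain y where y: "y \<in> N" "L +>\<^bsub>M\<^esub> x = L +>\<^bsub>M\<^esub> y"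
          by (rule imageE)
        then have "x \<in> L +>\<^bsub>M\<^esub> y"
          using a_rcos_self[OF x] by simp
        then obtain l where "l \<in> L" "x = l \<oplus>\<^bsub>M\<^esub> y"
          unfolding mem_coset_iff by (rule bexE)
        then show ?thesis
          using N y by (auto simp: submodule_iff)
      qed
      then show ?thesis using NM by auto
    qed
  qed
next
  assume max: "maximal_submodule L R M"
  show "simple_module R Q"
    unfolding simple_module_def
  proof (intro conjI allI impI left_module_quotient)
    obtain x where x: "x \<in> carrier M" "x \<notin> L"
      using max a_subset by (auto simp: maximal_submodule_def)
    then have "L +>\<^bsub>M\<^esub> x \<in> carrier Q" "L +>\<^bsub>M\<^esub> x \<noteq> L"
      using coset_eq_L_iff by (auto simp: carrier_quotient)
    then show "carrier Q \<noteq> {\<zero>\<^bsub>Q\<^esub>}"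
      by (auto simp: zero_quotient)
    fix Y assume "submodule Y R Q"
    then have Y: "Y \<subseteq> carrier Q" "L \<in> Y" "\<And>U V. U \<in> Y \<Longrightarrow> V \<in> Y \<Longrightarrow> U \<oplus>\<^bsub>Q\<^esub> V \<in> Y"
      "\<And>r U. r \<in> carrier R \<Longrightarrow> U \<in> Y \<Longrightarrow> r \<odot>\<^bsub>Q\<^esub> U \<in> Y"
      by (auto simp: left_module.submodule_iff[OF left_module_quotient] zero_quotient)
    let ?N = "{x \<in> carrier M. L +>\<^bsub>M\<^esub> x \<in> Y}"
    have "L +>\<^bsub>M\<^esub> \<zero>\<^bsub>M\<^esub> \<in> Y"
      using Y(2) coset_eq_L_iff[OF M.zero_closed] by simp
    then have "submodule ?N R M"
      unfolding submodule_iff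
      using Y(3,4) by (auto simp: act_closed add_quotient[symmetric] act_quotient[symmetric])
    moreover have "L \<subseteq> ?N"
    proof
      fix x assume "x \<in> L"
      then show "x \<in> ?N"
        using Y(2) coset_eq_L_iff[of x] subsetD[OF a_subset] by simp
    qed
    ultimately have "?N = L \<or> ?N = carrier M"
      using max by (simp add: maximal_submodule_def)
    then show "Y = {\<zero>\<^bsub>Q\<^esub>} \<or> Y = carrier Q"
    proof
      assume N: "?N = L"
      have "U = L" if U: "U \<in> Y" for U
      proof -
        obtain x where x: "x \<in> carrier M" "U = L +>\<^bsub>M\<^esub> x"
          using U Y(1) by (auto simp: carrier_quotient)
        then have "x \<in> L" using U N by auto
        then show ?thesis
          using x coset_eq_L_iff by simp
      qed
      then have "Y = {L}" using Y(2) by blast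
      then show ?thesis by (simp add: zero_quotient)
    next
      assume N: "?N = carrier M"
      then have "carrier Q \<subseteq> Y" unfolding carrier_quotient by blast
      then show ?thesis using Y(1) by blast
    qed
  qed
qed

text \<open>The first isomorphism theorem for the composite of \<open>h\<close> with the projection modulo \<open>L\<close>; its
  kernel is \<open>K\<close>. The isomorphism is taken from \<open>M / L\<close> to \<open>M' / K\<close>, where it needs no choice of
  representatives: a coset goes to its inverse image under \<open>h\<close>.\<close>

lemma module_isomorphic_quotients:
  assumes M': "submodule_of K R M'"
    and h: "\<And>x. x \<in> carrier M' \<Longrightarrow> h x \<in> carrier M"
      "\<And>x y. x \<in> carrier M' \<Longrightarrow> y \<in> carrier M' \<Longrightarrow> h (x \<oplus>\<^bsub>M'\<^esub> y) = h x \<oplus>\<^bsub>M\<^esub> h y"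
      "\<And>r x. r \<in> carrier R \<Longrightarrow> x \<in> carrier M' \<Longrightarrow> h (r \<odot>\<^bsub>M'\<^esub> x) = r \<odot>\<^bsub>M\<^esub> h x"
    and K: "\<And>x. x \<in> carrier M' \<Longrightarrow> h x \<in> L \<longleftrightarrow> x \<in> K"
    and surj: "\<And>y. y \<in> carrier M \<Longrightarrow> \<exists>x \<in> carrier M'. \<exists>l \<in> L. y = l \<oplus>\<^bsub>M\<^esub> h x"
  shows "module_isomorphic R Q (quotient_module M' K)"
proof -
  interpret M': submodule_of K R M' by fact
  let ?f = "\<lambda>Y. {x \<in> carrier M'. h x \<in> Y}"
  have minus: "h (x \<ominus>\<^bsub>M'\<^esub> y) = h x \<ominus>\<^bsub>M\<^esub> h y" if "x \<in> carrier M'" "y \<in> carrier M'" for x y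
    using that h(2)[of x "\<ominus>\<^bsub>M'\<^esub> y"] h(3)[of "\<ominus>\<^bsub>R\<^esub> \<one>\<^bsub>R\<^esub>" y] h(1)
    by (simp add: a_minus_def act_minus_one M'.act_minus_one)
  have f: "?f (L +>\<^bsub>M\<^esub> h x) = K +>\<^bsub>M'\<^esub> x" if x: "x \<in> carrier M'" for x
  proof -
    have "h y \<in> L +>\<^bsub>M\<^esub> h x \<longleftrightarrow> y \<in> K +>\<^bsub>M'\<^esub> x" if y: "y \<in> carrier M'" for y
    proof -
      have "h y \<in> L +>\<^bsub>M\<^esub> h x \<longleftrightarrow> L +>\<^bsub>M\<^esub> h y = L +>\<^bsub>M\<^esub> h x"
        using x y h(1) a_rcos_self a_repr_independence' by metis
      also have "\<dots> \<longleftrightarrow> K +>\<^bsub>M'\<^esub> y = K +>\<^bsub>M'\<^esub> x"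
        using x y h(1) by (simp add: coset_eq_iff M'.coset_eq_iff K[symmetric] minus)
      also have "\<dots> \<longleftrightarrow> y \<in> K +>\<^bsub>M'\<^esub> x"
        using x y M'.a_rcos_self M'.a_repr_independence' by metis
      finally show ?thesis .
    qed
    moreover have "K +>\<^bsub>M'\<^esub> x \<subseteq> carrier M'"
      using x M'.M.a_r_coset_subset_G[OF M'.a_subset] by simp
    ultimately show ?thesis by auto
  qed
  have cosets: "\<exists>x \<in> carrier M'. Y = L +>\<^bsub>M\<^esub> h x" if Y: "Y \<in> carrier Q" for Y
  proof -
    obtain y where y: "y \<in> carrier M" "Y = L +>\<^bsub>M\<^esub> y"
      using Y by (auto simp: carrier_quotient)
    then obtain x where x: "x \<in> carrier M'" "y \<in> L +>\<^bsub>M\<^esub> h x"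
      using surj[OF y(1)] by (auto simp: mem_coset_iff)
    then show ?thesis
      using y a_repr_independence'[OF x(2) h(1)[OF x(1)]] by auto
  qed
  have "inj_on ?f (carrier Q)"
  proof (rule inj_onI)
    fix Y Z assume "Y \<in> carrier Q" "Z \<in> carrier Q" and eq: "?f Y = ?f Z"
    then obtain y z where yz: "y \<in> carrier M'" "Y = L +>\<^bsub>M\<^esub> h y" "z \<in> carrier M'" "Z = L +>\<^bsub>M\<^esub> h z"
      using cosets by meson
    then show "Y = Z"
      using eq h(1) by (simp add: f coset_eq_iff M'.coset_eq_iff K[symmetric] minus)
  qed
  moreover have "?f ` carrier Q = carrier (quotient_module M' K)"
  proof
    show "?f ` carrier Q \<subseteq> carrier (quotient_module M' K)"
    proof
      fix Z assume "Z \<in> ?f ` carrier Q"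
      then obtain Y where Y: "Y \<in> carrier Q" "Z = ?f Y"
        by blast
      then obtain x where "x \<in> carrier M'" "Y = L +>\<^bsub>M\<^esub> h x"
        using cosets by meson
      then show "Z \<in> carrier (quotient_module M' K)"
        using Y f by (simp add: M'.carrier_quotient)
    qed
    show "carrier (quotient_module M' K) \<subseteq> ?f ` carrier Q"
    proof
      fix Z assume "Z \<in> carrier (quotient_module M' K)"
      then obtain z where z: "z \<in> carrier M'" "Z = K +>\<^bsub>M'\<^esub> z"
        by (auto simp: M'.carrier_quotient)
      then show "Z \<in> ?f ` carrier Q"
        using f[OF z(1)] h(1)[OF z(1)]
        by (intro image_eqI[of _ _ "L +>\<^bsub>M\<^esub> h z"]) (simp_all add: carrier_quotient)
    qed
  qed
  moreover have "?f (Y \<oplus>\<^bsub>Q\<^esub> Z) = ?f Y \<oplus>\<^bsub>quotient_module M' K\<^esub> ?f Z"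
    if YZ: "Y \<in> carrier Q" "Z \<in> carrier Q" for Y Z
  proof -
    obtain y z where yz: "y \<in> carrier M'" "Y = L +>\<^bsub>M\<^esub> h y" "z \<in> carrier M'" "Z = L +>\<^bsub>M\<^esub> h z"
      using YZ cosets by meson
    then have "Y \<oplus>\<^bsub>Q\<^esub> Z = L +>\<^bsub>M\<^esub> h (y \<oplus>\<^bsub>M'\<^esub> z)"
      using h by (simp add: add_quotient)
    then show ?thesis
      using yz by (simp add: f M'.add_quotient)
  qed
  moreover have "?f (r \<odot>\<^bsub>Q\<^esub> Y) = r \<odot>\<^bsub>quotient_module M' K\<^esub> ?f Y"
    if r: "r \<in> carrier R" and Y: "Y \<in> carrier Q" for r Y
  proof -
    obtain y where y: "y \<in> carrier M'" "Y = L +>\<^bsub>M\<^esub> h y"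
      using Y cosets by meson
    then have "r \<odot>\<^bsub>Q\<^esub> Y = L +>\<^bsub>M\<^esub> h (r \<odot>\<^bsub>M'\<^esub> y)"
      using h r by (simp add: act_quotient)
    then show ?thesis
      using y r by (simp add: f M'.act_quotient M'.act_closed)
  qed
  ultimately show ?thesis
    unfolding module_isomorphic_def bij_betw_def by (intro exI[of _ ?f]) simp
qed

end

lemma module_isomorphic_annihilator:
  assumes iso: "module_isomorphic R M N" and "left_module R M" "left_module R N"
    and r: "r \<in> carrier R" and M: "\<And>x. x \<in> carrier M \<Longrightarrow> r \<odot>\<^bsub>M\<^esub> x = \<zero>\<^bsub>M\<^esub>"
    and y: "y \<in> carrier N"
  shows "r \<odot>\<^bsub>N\<^esub> y = \<zero>\<^bsub>N\<^esub>"
proof -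
  interpret M: left_module R M by fact
  interpret N: left_module R N by fact
  obtain f where f: "bij_betw f (carrier M) (carrier N)"
    "\<And>x y. x \<in> carrier M \<Longrightarrow> y \<in> carrier M \<Longrightarrow> f (x \<oplus>\<^bsub>M\<^esub> y) = f x \<oplus>\<^bsub>N\<^esub> f y"
    "\<And>r x. r \<in> carrier R \<Longrightarrow> x \<in> carrier M \<Longrightarrow> f (r \<odot>\<^bsub>M\<^esub> x) = r \<odot>\<^bsub>N\<^esub> f x"
    using iso unfolding module_isomorphic_def by metis
  obtain x where x: "x \<in> carrier M" "y = f x"
    using f(1) y by (auto simp: bij_betw_def)
  have "f \<zero>\<^bsub>M\<^esub> \<in> carrier N"
    using f(1) by (auto simp: bij_betw_def)
  moreover have "f \<zero>\<^bsub>M\<^esub> \<oplus>\<^bsub>N\<^esub> f \<zero>\<^bsub>M\<^esub> = f \<zero>\<^bsub>M\<^esub>"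
    using f(2)[of "\<zero>\<^bsub>M\<^esub>" "\<zero>\<^bsub>M\<^esub>"] by simp
  ultimately have "f \<zero>\<^bsub>M\<^esub> = \<zero>\<^bsub>N\<^esub>"
    by (metis N.M.add.r_cancel_one)
  then show ?thesis
    using f(3)[OF r x(1)] M[OF x(1)] x(2) by simp
qed

section \<open>Linear algebra of formal linear combinations\<close>

abbreviation clinear :: "(('k \<Rightarrow>\<^sub>0 complex) \<Rightarrow> ('l \<Rightarrow>\<^sub>0 complex)) \<Rightarrow> bool"
  where "clinear \<equiv> Vector_Spaces.linear cscale cscale"

abbreviation combinations :: "'k set \<Rightarrow> ('k \<Rightarrow>\<^sub>0 complex) set"
  where "combinations S \<equiv> {x. Poly_Mapping.keys x \<subseteq> S}"

lemma clinear_iff: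
  "clinear f \<longleftrightarrow> (\<forall>x y. f (x + y) = f x + f y) \<and> (\<forall>c x. f (cscale c x) = cscale c (f x))"
  by (auto simp: Vector_Spaces.linear_def module_hom_def module_hom_axioms_def
      cvec.vector_space_axioms module_iff_vector_space)

lemma clinearD:
  assumes "clinear f"
  shows "f (x + y) = f x + f y" "f (cscale c x) = cscale c (f x)" "f 0 = 0"
    "f (sum g A) = (\<Sum>a \<in> A. f (g a))" "f (x - y) = f x - f y"
  using assms module_hom.sum[of cscale cscale f g A] module_hom.zero[of cscale cscale f]
    module_hom.diff[of cscale cscale f x y]
  by (auto simp: clinear_iff module_hom_iff_linear)

lemma combination_expansion:
  assumes "finite S" "Poly_Mapping.keys x \<subseteq> S"
  shows "x = (\<Sum>k \<in> S. cscale (Poly_Mapping.lookup x k) (basis_elt k))"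
proof (rule poly_mapping_eqI)
  fix k
  have "Poly_Mapping.lookup (\<Sum>k \<in> S. cscale (Poly_Mapping.lookup x k) (basis_elt k)) k =
      (\<Sum>l \<in> S. if l = k then Poly_Mapping.lookup x k else 0)"
    by (auto simp: lookup_sum basis_elt_def lookup_single when_def intro!: sum.cong)
  also have "\<dots> = Poly_Mapping.lookup x k"
    using assms by (auto simp: in_keys_iff)
  finally show "Poly_Mapping.lookup x k =
      Poly_Mapping.lookup (\<Sum>k \<in> S. cscale (Poly_Mapping.lookup x k) (basis_elt k)) k"
    by simp
qed

lemma basis_elt_combination: "basis_elt k \<in> combinations S \<longleftrightarrow> k \<in> S"
  by (simp add: basis_elt_def)

lemma subspace_combinations: "cvec.subspace (combinations S)"
  unfolding cvec.subspace_def
proof (intro conjI ballI allI)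
  fix x y :: "'a \<Rightarrow>\<^sub>0 complex" and c
  assume x: "x \<in> combinations S"
  show "cscale c x \<in> combinations S"
    using x by (auto simp: in_keys_iff)
  assume "y \<in> combinations S"
  then show "x + y \<in> combinations S"
    using x Poly_Mapping.keys_add[of x y] by auto
qed simp

lemma span_basis_elts: "cvec.span (basis_elt ` S) = combinations S"
proof
  show "cvec.span (basis_elt ` S) \<subseteq> combinations S"
    by (rule cvec.span_minimal[OF _ subspace_combinations]) (auto simp: basis_elt_def)
  show "combinations S \<subseteq> cvec.span (basis_elt ` S)"
  proof
    fix x assume "x \<in> combinations S"
    then have "(\<Sum>k \<in> Poly_Mapping.keys x. cscale (Poly_Mapping.lookup x k) (basis_elt k))
        \<in> cvec.span (basis_elt ` S)"
      by (intro cvec.span_sum cvec.span_scale cvec.span_base) auto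
    then show "x \<in> cvec.span (basis_elt ` S)"
      using combination_expansion[OF finite_keys, of x x] by simp
  qed
qed

lemma combination_induct [consumes 1, case_names zero basis add scale]:
  assumes "x \<in> combinations S" and "P 0" and "\<And>k. k \<in> S \<Longrightarrow> P (basis_elt k)"
    and "\<And>x y. P x \<Longrightarrow> P y \<Longrightarrow> P (x + y)" and "\<And>c x. P x \<Longrightarrow> P (cscale c x)"
  shows "P x"
proof -
  have "x \<in> cvec.span (basis_elt ` S)"
    using assms(1) by (simp add: span_basis_elts)
  then show ?thesis
    by (rule cvec.span_induct[where P = P])
      (auto simp: cvec.subspace_def assms)
qed

lemma lin_ext_superset:
  assumes "finite S" "Poly_Mapping.keys x \<subseteq> S"
  shows "lin_ext f x = (\<Sum>k \<in> S. cscale (Poly_Mapping.lookup x k) (f k))"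
  unfolding lin_ext_def
  using assms by (intro sum.mono_neutral_left) (auto simp: in_keys_iff)

lemma clinear_lin_ext: "clinear (lin_ext f)"
  unfolding clinear_iff
proof (intro conjI allI)
  fix x y :: "'a \<Rightarrow>\<^sub>0 complex" and c
  let ?S = "Poly_Mapping.keys x \<union> Poly_Mapping.keys y"
  show "lin_ext f (x + y) = lin_ext f x + lin_ext f y"
    using Poly_Mapping.keys_add[of x y]
    by (simp add: lin_ext_superset[of ?S] lookup_add cvec.scale_left_distrib sum.distrib)
  have "Poly_Mapping.keys (cscale c x) \<subseteq> Poly_Mapping.keys x"
    by (auto simp: in_keys_iff)
  then show "lin_ext f (cscale c x) = cscale c (lin_ext f x)"
    by (simp add: lin_ext_superset[of "Poly_Mapping.keys x"] cvec.scale_sum_right)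
qed

lemma lin_ext_basis_elt [simp]: "lin_ext f (basis_elt k) = f k"
  by (simp add: lin_ext_def basis_elt_def)

lemma lin_ext_add: "lin_ext (\<lambda>k. f k + g k) x = lin_ext f x + lin_ext g x"
  by (simp add: lin_ext_def cvec.scale_right_distrib sum.distrib)

lemma lin_ext_cscale: "lin_ext (\<lambda>k. cscale c (f k)) x = cscale c (lin_ext f x)"
  by (simp add: lin_ext_def cvec.scale_sum_right mult.commute)

lemma subspace_projection:
  assumes "cvec.subspace N"
  shows "\<exists>p. clinear p \<and> (\<forall>x. p x \<in> N) \<and> (\<forall>x \<in> N. p x = x)"
proof -
  interpret vector_space_pair cscale cscale by unfold_locales
  obtain B where B: "B \<subseteq> N" "cvec.independent B" "N \<subseteq> cvec.span B"
    using cvec.maximal_independent_subset .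
  have span: "cvec.span B = N"
    using B(3) cvec.span_minimal[OF B(1) assms] by auto
  obtain p where p: "clinear p" "\<And>x. x \<in> B \<Longrightarrow> p x = x" "range p = cvec.span B"
    using linear_independent_extend_subspace[OF B(2), of "\<lambda>x. x"] by auto
  have "p x = x" if "x \<in> N" for x
    using linear_eq_on_span[OF p(1) cvec.linear_ident, of B] p(2) that span by auto
  then show ?thesis
    using p span by auto
qed

lemma finite_basis:
  assumes "W \<subseteq> cvec.span T" "finite T"
  obtains B where "B \<subseteq> W" "finite B" "cvec.independent B" "W \<subseteq> cvec.span B" "card B = cvec.dim W"
  by (metis cvec.basis_exists[of W] cvec.independent_span_bound assms dual_order.trans)

text \<open>The space of all formal combinations may be infinite-dimensional, so the finite spanning set \<open>T\<close>
  supplies the finiteness that makes dimensions strictly monotone.\<close>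

lemma dim_insert_new:
  assumes "W \<subseteq> cvec.span T" "finite T" "x \<notin> cvec.span W"
  shows "cvec.dim (insert x W) = Suc (cvec.dim W)"
proof -
  obtain B where B: "B \<subseteq> W" "finite B" "cvec.independent B" "W \<subseteq> cvec.span B"
    "card B = cvec.dim W"
    using finite_basis[OF assms(1,2)] .
  have x: "x \<notin> cvec.span B"
    using assms(3) cvec.span_mono[OF B(1)] by auto
  have "cvec.independent (insert x B)"
    using B(3) x by (rule cvec.independent_insertI[rotated])
  moreover have "insert x W \<subseteq> cvec.span (insert x B)"
    using B(4) cvec.span_mono[of B "insert x B"] cvec.span_base[of x "insert x B"] by auto
  moreover have "insert x B \<subseteq> insert x W"
    using B(1) by auto
  ultimately have "cvec.dim (insert x W) = card (insert x B)"
    using cvec.basis_card_eq_dim by metis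
  also have "\<dots> = Suc (card B)"
    using B(2) x cvec.span_base by (intro card_insert_disjoint) auto
  finally show ?thesis
    using B(5) by simp
qed

lemma dim_strict_mono:
  assumes "cvec.subspace V" "V \<subset> W" "W \<subseteq> cvec.span T" "finite T"
  shows "cvec.dim V < cvec.dim W"
proof -
  obtain x where x: "x \<in> W" "x \<notin> V"
    using assms(2) by auto
  obtain B where B: "B \<subseteq> W" "finite B" "cvec.independent B" "W \<subseteq> cvec.span B"
    "card B = cvec.dim W"
    using finite_basis[OF assms(3,4)] .
  have "Suc (cvec.dim V) = cvec.dim (insert x V)"
    using assms x by (intro dim_insert_new[symmetric, of _ T]) (auto simp: cvec.span_eq_iff[THEN iffD2])
  also have "\<dots> \<le> card B"
    using x assms(2) B by (intro cvec.dim_le_card) auto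
  finally show ?thesis
    using B(5) by simp
qed

text \<open>If the vectors \<open>v, T v, T (T v), \<dots>\<close> span a finite-dimensional space, then some nonzero
  polynomial in \<open>T\<close> kills \<open>v\<close>; for one of least degree, splitting off a linear factor \<open>T - c\<close>
  leaves an eigenvector. It lies in every \<open>T\<close>-invariant subspace that contains \<open>v\<close>.\<close>

lemma eigenvector_exists:
  assumes T: "clinear T" and v: "v \<noteq> 0"
    and fin: "finite S" "\<And>n. (T ^^ n) v \<in> cvec.span S"
  shows "\<exists>c w. w \<noteq> 0 \<and> T w = cscale c w \<and> w \<in> cvec.span (range (\<lambda>n. (T ^^ n) v))"
proof -
  define pw where "pw n = (T ^^ n) v" for n
  \<comment> \<open>\<open>ev p\<close> is \<open>p (T) v\<close>.\<close>
  define ev where "ev p = (\<Sum>k \<le> degree p. cscale (coeff p k) (pw k))" for p :: "complex poly"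
  have ev_bound: "ev p = (\<Sum>k \<le> n. cscale (coeff p k) (pw k))" if "degree p \<le> n" for p n
    unfolding ev_def using that by (intro sum.mono_neutral_left) (auto simp: coeff_eq_0)
  have ev_factor: "ev ([:- a, 1:] * p) = T (ev p) - cscale a (ev p)" for a p
  proof -
    let ?n = "degree p"
    have "degree ([:- a, 1:] * p) \<le> Suc ?n"
      using degree_mult_le[of "[:- a, 1:]" p] by simp
    then have "ev ([:- a, 1:] * p) = (\<Sum>k \<le> Suc ?n. cscale (coeff ([:- a, 1:] * p) k) (pw k))"
      by (rule ev_bound)
    also have "\<dots> = (\<Sum>k \<le> Suc ?n. cscale (coeff (pCons 0 p) k) (pw k)) -
        (\<Sum>k \<le> Suc ?n. cscale (a * coeff p k) (pw k))"
      by (simp add: sum_subtractf[symmetric] cvec.scale_left_diff_distrib)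
    also have "(\<Sum>k \<le> Suc ?n. cscale (coeff (pCons 0 p) k) (pw k)) =
        (\<Sum>k \<le> ?n. cscale (coeff p k) (pw (Suc k)))"
      by (simp add: sum.atMost_Suc_shift del: sum.atMost_Suc)
    also have "\<dots> = T (ev p)"
      by (simp add: ev_def clinearD[OF T] pw_def)
    also have "(\<Sum>k \<le> Suc ?n. cscale (a * coeff p k) (pw k)) = cscale a (ev p)"
      using ev_bound[of p "Suc ?n"] by (simp add: cvec.scale_sum_right cvec.scale_right_distrib)
    finally show ?thesis .
  qed
  \<comment> \<open>The first \<open>card S + 1\<close> vectors of the orbit either repeat or are linearly dependent.\<close>
  have "\<exists>p. p \<noteq> 0 \<and> ev p = 0"
  proof (cases "inj_on pw {..card S}")
    case False
    then obtain i j where ij: "i < j" "pw i = pw j"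
      by (auto simp: inj_on_def) (metis linorder_neqE_nat)
    let ?p = "monom 1 j - monom 1 i :: complex poly"
    have "coeff ?p j \<noteq> 0"
      using ij by simp
    then have "?p \<noteq> 0"
      by (metis coeff_0)
    moreover have "ev ?p = (\<Sum>k \<le> j. cscale (coeff ?p k) (pw k))"
      using ij by (intro ev_bound degree_diff_le) (auto simp: degree_monom_eq)
    then have "ev ?p = (\<Sum>k \<le> j. (if k = j then pw k else 0) - (if k = i then pw k else 0))"
      by (auto simp: intro!: sum.cong)
    then have "ev ?p = 0"
      using ij by (simp add: sum_subtractf)
    ultimately show ?thesis by blast
  next
    case True
    let ?B = "pw ` {..card S}"
    have "\<not> card ?B \<le> card S"
      using True by (simp add: card_image)
    then have "cvec.dependent ?B"
      using cvec.independent_span_bound[OF fin(1), of ?B] fin(2) by (auto simp: pw_def)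
    then obtain u where u: "\<exists>x \<in> ?B. u x \<noteq> 0" "(\<Sum>x \<in> ?B. cscale (u x) x) = 0"
      by (auto simp: cvec.dependent_finite)
    let ?p = "\<Sum>k \<le> card S. monom (u (pw k)) k"
    have c: "coeff ?p k = (if k \<le> card S then u (pw k) else 0)" for k
      by (simp add: coeff_sum)
    have "?p \<noteq> 0"
      using u(1) c by (metis (no_types, lifting) atMost_iff coeff_0 imageE)
    moreover have "degree ?p \<le> card S"
      by (rule degree_le) (simp add: c)
    then have "ev ?p = (\<Sum>k \<le> card S. cscale (u (pw k)) (pw k))"
      by (simp add: ev_bound c)
    then have "ev ?p = 0"
      using u(2) by (simp add: sum.reindex[OF True])
    ultimately show ?thesis by blast
  qed
  then obtain p where p: "p \<noteq> 0" "ev p = 0" and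
    least: "\<And>q. q \<noteq> 0 \<Longrightarrow> ev q = 0 \<Longrightarrow> degree p \<le> degree q"
    using ex_has_least_nat[of "\<lambda>p. p \<noteq> 0 \<and> ev p = 0" _ degree] by metis
  have "degree p \<noteq> 0"
  proof
    assume 0: "degree p = 0"
    then have "coeff p 0 \<noteq> 0"
      using p(1) leading_coeff_0_iff[of p] by simp
    then show False
      using p(2) v 0 by (simp add: ev_def pw_def)
  qed
  then obtain a where "poly p a = 0"
    using fundamental_theorem_of_algebra constant_degree by metis
  then obtain q where q: "p = [:- a, 1:] * q"
    by (auto simp: poly_eq_0_iff_dvd)
  then have q0: "q \<noteq> 0"
    using p(1) by auto
  then have "degree p = Suc (degree q)"
    unfolding q by (subst degree_mult_eq) auto
  then have "ev q \<noteq> 0"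
    using least[OF q0] by auto
  moreover have "T (ev q) = cscale a (ev q)"
    using ev_factor[of a q] p(2) q by simp
  moreover have "ev q \<in> cvec.span (range pw)"
    unfolding ev_def by (intro cvec.span_sum cvec.span_scale cvec.span_base) auto
  ultimately show ?thesis
    unfolding pw_def by blast
qed

text \<open>Maschke's argument: conjugating a linear projection onto \<open>N\<close> by every group element and taking
  the mean gives a projection onto \<open>N\<close> that commutes with the group. The maps \<open>\<rho> g\<close> need to be an
  action on \<open>M\<close> only: multiplication by an automorphism of one object kills the
  morphisms that do not compose with it, so it need not be invertible on the whole space.\<close>

lemma averaging:
  fixes G (structure)
  assumes "group G" and fin: "finite (carrier G)"
    and lin: "\<And>g. g \<in> carrier G \<Longrightarrow> clinear (\<rho> g)"
    and M: "\<And>g x. g \<in> carrier G \<Longrightarrow> x \<in> M \<Longrightarrow> \<rho> g x \<in> M"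
    and act: "\<And>g h x. g \<in> carrier G \<Longrightarrow> h \<in> carrier G \<Longrightarrow> x \<in> M \<Longrightarrow> \<rho> g (\<rho> h x) = \<rho> (g \<otimes> h) x"
    and one: "\<And>x. x \<in> M \<Longrightarrow> \<rho> \<one> x = x"
    and N: "cvec.subspace N" "N \<subseteq> M" "\<And>g x. g \<in> carrier G \<Longrightarrow> x \<in> N \<Longrightarrow> \<rho> g x \<in> N"
  shows "\<exists>\<pi>. clinear \<pi> \<and> (\<forall>x. \<pi> x \<in> N) \<and> (\<forall>x \<in> N. \<pi> x = x) \<and>
    (\<forall>g \<in> carrier G. \<forall>x \<in> M. \<pi> (\<rho> g x) = \<rho> g (\<pi> x))"
proof -
  interpret group G by fact
  obtain p where p: "clinear p" "\<And>x. p x \<in> N" "\<And>x. x \<in> N \<Longrightarrow> p x = x"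
    using subspace_projection[OF N(1)] by blast
  let ?c = "of_nat (card (carrier G)) :: complex"
  have c: "?c \<noteq> 0"
    using fin by auto
  define \<pi> where "\<pi> x = cscale (1 / ?c) (\<Sum>g \<in> carrier G. \<rho> g (p (\<rho> (inv g) x)))" for x
  have "clinear \<pi>"
    unfolding clinear_iff \<pi>_def
    by (auto simp: clinearD[OF lin] clinearD[OF p(1)] sum.distrib cvec.scale_right_distrib
        cvec.scale_sum_right mult.commute)
  moreover have "\<pi> x \<in> N" for x
    unfolding \<pi>_def by (intro cvec.subspace_scale[OF N(1)] cvec.subspace_sum[OF N(1)] N(3) p(2))
  moreover have "\<pi> x = x" if x: "x \<in> N" for x
  proof -
    have "\<rho> g (p (\<rho> (inv g) x)) = x" if "g \<in> carrier G" for g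
      using that x N(2,3) by (simp add: p(3) act one subset_iff)
    then have "\<pi> x = cscale (1 / ?c) (\<Sum>g \<in> carrier G. x)"
      by (simp add: \<pi>_def)
    also have "(\<Sum>g \<in> carrier G. x) = cscale ?c x"
      by (simp add: cvec.sum_constant_scale)
    finally show ?thesis
      using c by simp
  qed
  moreover have "\<pi> (\<rho> h x) = \<rho> h (\<pi> x)" if h: "h \<in> carrier G" and x: "x \<in> M" for h x
  proof -
    have "\<pi> (\<rho> h x) = cscale (1 / ?c) (\<Sum>g \<in> carrier G. \<rho> g (p (\<rho> (inv g) (\<rho> h x))))"
      by (simp add: \<pi>_def)
    also have "(\<Sum>g \<in> carrier G. \<rho> g (p (\<rho> (inv g) (\<rho> h x)))) =
        (\<Sum>g \<in> carrier G. \<rho> (h \<otimes> g) (p (\<rho> (inv (h \<otimes> g)) (\<rho> h x))))"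
      by (rule sum.reindex_bij_witness[of _ "\<lambda>g. h \<otimes> g" "\<lambda>g. inv h \<otimes> g"])
        (use h in \<open>auto simp: m_assoc[symmetric]\<close>)
    also have "\<dots> = (\<Sum>g \<in> carrier G. \<rho> h (\<rho> g (p (\<rho> (inv g) x))))"
    proof (rule sum.cong[OF refl])
      fix g assume g: "g \<in> carrier G"
      have "p (\<rho> (inv g) x) \<in> M"
        using p(2) N(2) by auto
      moreover have "inv (h \<otimes> g) \<otimes> h = inv g"
        using g h by (simp add: inv_mult_group m_assoc)
      ultimately show "\<rho> (h \<otimes> g) (p (\<rho> (inv (h \<otimes> g)) (\<rho> h x))) = \<rho> h (\<rho> g (p (\<rho> (inv g) x)))"
        using g h x by (simp add: act)
    qed
    finally show ?thesis
      by (simp add: \<pi>_def clinearD[OF lin[OF h]])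
  qed
  ultimately show ?thesis by blast
qed

section \<open>The category algebra\<close>

lemma clinear_conv_left: "clinear (\<lambda>x. conv \<D> x y)"
  unfolding conv_def by (rule clinear_lin_ext)

lemma clinear_conv_right: "clinear (\<lambda>y. conv \<D> x y)"
  unfolding clinear_iff conv_def
  by (simp add: clinearD[OF clinear_lin_ext] lin_ext_add lin_ext_cscale)

lemmas conv_add = clinearD(1)[OF clinear_conv_left] clinearD(1)[OF clinear_conv_right]
  and conv_cscale = clinearD(2)[OF clinear_conv_left] clinearD(2)[OF clinear_conv_right]
  and conv_zero = clinearD(3)[OF clinear_conv_left] clinearD(3)[OF clinear_conv_right]
  and conv_sum_left = clinearD(4)[OF clinear_conv_left]
  and conv_sum_right = clinearD(4)[OF clinear_conv_right]
  and conv_diff = clinearD(5)[OF clinear_conv_left] clinearD(5)[OF clinear_conv_right]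

lemma conv_basis_elt:
  "conv \<D> (basis_elt g) (basis_elt f) =
    (if Dom \<D> g = Cod \<D> f then basis_elt (Comp \<D> g f) else 0)"
  by (simp add: conv_def)

definition hom_space :: "('o, 'm) cat \<Rightarrow> 'o \<Rightarrow> 'o \<Rightarrow> ('m \<Rightarrow>\<^sub>0 complex) set"
  where "hom_space \<D> a b = combinations (hom_set \<D> a b)"

definition arr_space :: "('o, 'm) cat \<Rightarrow> ('m \<Rightarrow>\<^sub>0 complex) set"
  where "arr_space \<D> = combinations (Arr \<D>)"

lemma subspace_hom_space: "cvec.subspace (hom_space \<D> a b)"
  by (simp add: hom_space_def subspace_combinations)

lemma subspace_arr_space: "cvec.subspace (arr_space \<D>)"
  by (simp add: arr_space_def subspace_combinations)

lemmas hom_space_closed =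
    cvec.subspace_add[OF subspace_hom_space] cvec.subspace_scale[OF subspace_hom_space]
    cvec.subspace_0[OF subspace_hom_space] cvec.subspace_diff[OF subspace_hom_space]
    cvec.subspace_sum[OF subspace_hom_space]
  and arr_space_closed =
    cvec.subspace_add[OF subspace_arr_space] cvec.subspace_scale[OF subspace_arr_space]
    cvec.subspace_0[OF subspace_arr_space] cvec.subspace_diff[OF subspace_arr_space]
    cvec.subspace_sum[OF subspace_arr_space]

lemma basis_elt_hom_space [simp]: "basis_elt m \<in> hom_space \<D> a b \<longleftrightarrow> m \<in> hom_set \<D> a b"
  by (simp add: hom_space_def basis_elt_def)

lemma hom_space_arr_space: "x \<in> hom_space \<D> a b \<Longrightarrow> x \<in> arr_space \<D>"
  by (auto simp: hom_space_def arr_space_def hom_set_def)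

lemma category_algebra_simps [simp]:
  "carrier (category_algebra \<D>) = arr_space \<D>"
  "x \<otimes>\<^bsub>category_algebra \<D>\<^esub> y = conv \<D> x y"
  "\<zero>\<^bsub>category_algebra \<D>\<^esub> = 0"
  "x \<oplus>\<^bsub>category_algebra \<D>\<^esub> y = x + y"
  "c \<odot>\<^bsub>category_algebra \<D>\<^esub> x = cscale c x"
  by (simp_all add: category_algebra_def arr_space_def)

lemma group_algebra_simps [simp]:
  "carrier (group_algebra \<D> a) = hom_space \<D> a a"
  "x \<otimes>\<^bsub>group_algebra \<D> a\<^esub> y = conv \<D> x y"
  "\<one>\<^bsub>group_algebra \<D> a\<^esub> = basis_elt (Id \<D> a)"
  "\<zero>\<^bsub>group_algebra \<D> a\<^esub> = 0"
  "x \<oplus>\<^bsub>group_algebra \<D> a\<^esub> y = x + y"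
  "c \<odot>\<^bsub>group_algebra \<D> a\<^esub> x = cscale c x"
  by (simp_all add: group_algebra_def hom_space_def)

locale finite_EI_category = category \<D> for \<D> :: "('o, 'm) cat" +
  assumes finite: "finite_cat \<D>" and EI: "EI_cat \<D>"
begin

abbreviation star (infixl "\<star>" 70) where "x \<star> y \<equiv> conv \<D> x y"
abbreviation H where "H \<equiv> hom_space \<D>"
abbreviation A where "A \<equiv> arr_space \<D>"
abbreviation unit where "unit a \<equiv> basis_elt (Id \<D> a)"

lemma finite_Arr: "finite (Arr \<D>)" and finite_Obj: "finite (Obj \<D>)"
  using finite by (simp_all add: finite_cat_def)

lemma finite_hom_set: "finite (hom_set \<D> a b)"
  using finite_Arr by (simp add: hom_set_def)

lemma Arr_hom_set: "m \<in> Arr \<D> \<Longrightarrow> m \<in> hom_set \<D> (Dom \<D> m) (Cod \<D> m)"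
  by (simp add: hom_set_def)

lemma hom_space_span: "x \<in> H a b \<Longrightarrow> x \<in> cvec.span (basis_elt ` hom_set \<D> a b)"
  by (simp add: span_basis_elts hom_space_def)

lemma arr_space_span: "x \<in> A \<Longrightarrow> x \<in> cvec.span (basis_elt ` Arr \<D>)"
  by (simp add: span_basis_elts arr_space_def)

lemma hom_space_induct [consumes 1, case_names zero basis add scale]:
  assumes "x \<in> H a b" "P 0" "\<And>m. m \<in> hom_set \<D> a b \<Longrightarrow> P (basis_elt m)"
    "\<And>x y. P x \<Longrightarrow> P y \<Longrightarrow> P (x + y)" "\<And>c x. P x \<Longrightarrow> P (cscale c x)"
  shows "P x"
  using combination_induct[of x "hom_set \<D> a b" P] assms by (auto simp: hom_space_def)

lemma arr_space_induct [consumes 1, case_names zero basis add scale]: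
  assumes "x \<in> A" "P 0" "\<And>m. m \<in> Arr \<D> \<Longrightarrow> P (basis_elt m)"
    "\<And>x y. P x \<Longrightarrow> P y \<Longrightarrow> P (x + y)" "\<And>c x. P x \<Longrightarrow> P (cscale c x)"
  shows "P x"
  using combination_induct[of x "Arr \<D>" P] assms by (auto simp: arr_space_def)

lemma conv_hom_space:
  assumes "x \<in> H b c" "y \<in> H a b"
  shows "x \<star> y \<in> H a c"
  using assms(1)
proof (induction rule: hom_space_induct)
  case (basis g)
  show ?case
    using assms(2)
  proof (induction rule: hom_space_induct)
    case (basis f)
    then show ?case
      using \<open>g \<in> hom_set \<D> b c\<close> Comp_hom[of f a b g c] by (simp add: conv_basis_elt hom_space_closed)
  qed (auto simp: conv_add conv_cscale conv_zero hom_space_closed)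
qed (auto simp: conv_add conv_cscale conv_zero hom_space_closed)

lemma conv_arr_space:
  assumes "x \<in> A" "y \<in> A"
  shows "x \<star> y \<in> A"
  using assms(1)
proof (induction rule: arr_space_induct)
  case (basis g)
  show ?case
    using assms(2)
  proof (induction rule: arr_space_induct)
    case (basis f)
    show ?case
    proof (cases "Dom \<D> g = Cod \<D> f")
      case True
      then have "Comp \<D> g f \<in> hom_set \<D> (Dom \<D> f) (Cod \<D> g)"
        using Comp_hom Arr_hom_set[OF basis] Arr_hom_set[OF \<open>g \<in> Arr \<D>\<close>] by simp
      then show ?thesis
        using True hom_space_arr_space[of "basis_elt (Comp \<D> g f)"]
        by (auto simp: conv_basis_elt)
    qed (simp add: conv_basis_elt arr_space_closed)
  qed (auto simp: conv_add conv_cscale conv_zero arr_space_closed)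
qed (auto simp: conv_add conv_cscale conv_zero arr_space_closed)

lemma conv_assoc:
  assumes "x \<in> A" "y \<in> A" "z \<in> A"
  shows "x \<star> y \<star> z = x \<star> (y \<star> z)"
  using assms(1)
proof (induction rule: arr_space_induct)
  case (basis h)
  show ?case
    using assms(2)
  proof (induction rule: arr_space_induct)
    case (basis g)
    show ?case
      using assms(3)
    proof (induction rule: arr_space_induct)
      case (basis f)
      note hom = Arr_hom_set[OF \<open>h \<in> Arr \<D>\<close>] Arr_hom_set[OF \<open>g \<in> Arr \<D>\<close>] Arr_hom_set[OF \<open>f \<in> Arr \<D>\<close>]
      have "Cod \<D> (Comp \<D> g f) = Cod \<D> g" if "Dom \<D> g = Cod \<D> f"
        using that Comp_hom[OF hom(3), of g] hom(2) by (auto simp: hom_set_def)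
      moreover have "Dom \<D> (Comp \<D> h g) = Dom \<D> g" if "Dom \<D> h = Cod \<D> g"
        using that Comp_hom[OF hom(2), of h] hom(1) by (auto simp: hom_set_def)
      moreover have "Comp \<D> h (Comp \<D> g f) = Comp \<D> (Comp \<D> h g) f"
        if "Dom \<D> h = Cod \<D> g" "Dom \<D> g = Cod \<D> f"
        using that Comp_assoc[OF hom(3), of g "Cod \<D> g" h "Cod \<D> h"] hom by simp
      ultimately show ?case
        by (simp add: conv_basis_elt conv_zero)
    qed (auto simp: conv_add conv_cscale conv_zero)
  qed (auto simp: conv_add conv_cscale conv_zero)
qed (auto simp: conv_add conv_cscale conv_zero)

lemma unit_hom_space: "a \<in> Obj \<D> \<Longrightarrow> unit a \<in> H a a"
  using Id_hom by simp

lemma unit_left: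
  assumes "x \<in> H a b" "b \<in> Obj \<D>" shows "unit b \<star> x = x"
  using assms(1)
proof (induction rule: hom_space_induct)
  case (basis m)
  then show ?case
    using Comp_Id_left[OF basis] Id_hom[OF assms(2)] by (simp add: conv_basis_elt hom_set_def)
qed (auto simp: conv_add conv_cscale conv_zero)

lemma unit_right:
  assumes "x \<in> H a b" "a \<in> Obj \<D>" shows "x \<star> unit a = x"
  using assms(1)
proof (induction rule: hom_space_induct)
  case (basis m)
  then show ?case
    using Comp_Id_right[OF basis] Id_hom[OF assms(2)] by (simp add: conv_basis_elt hom_set_def)
qed (auto simp: conv_add conv_cscale conv_zero)

text \<open>The units of the two objects cut out the morphisms between them.\<close>

lemma unit_corner:
  assumes "x \<in> A" "a \<in> Obj \<D>" "b \<in> Obj \<D>"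
  shows "unit b \<star> x \<star> unit a \<in> H a b"
  using assms(1)
proof (induction rule: arr_space_induct)
  case (basis m)
  note m = Arr_hom_set[OF basis]
  show ?case
  proof (cases "Dom \<D> m = a \<and> Cod \<D> m = b")
    case True
    then show ?thesis
      using m unit_left[of "basis_elt m" a b] unit_right[of "basis_elt m" a b] assms by simp
  next
    case False
    have "unit b \<star> basis_elt m = (if Cod \<D> m = b then basis_elt m else 0)"
      using Id_hom[OF assms(3)] Comp_Id_left[OF m] by (auto simp: conv_basis_elt hom_set_def)
    then show ?thesis
      using False Id_hom[OF assms(2)] by (auto simp: conv_basis_elt hom_set_def conv_zero hom_space_closed)
  qed
qed (auto simp: conv_add conv_cscale conv_zero hom_space_closed)

lemma ring_combinations:
  fixes R (structure)
  assumes "cvec.subspace (carrier R)" "carrier R \<subseteq> A" "\<one> \<in> carrier R"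
    and ops: "\<And>x y. x \<otimes> y = x \<star> y" "\<And>x y. x \<oplus> y = x + y" "\<zero> = 0"
    and "\<And>x y. x \<in> carrier R \<Longrightarrow> y \<in> carrier R \<Longrightarrow> x \<star> y \<in> carrier R"
    and "\<And>x. x \<in> carrier R \<Longrightarrow> \<one> \<star> x = x" "\<And>x. x \<in> carrier R \<Longrightarrow> x \<star> \<one> = x"
  shows "ring R"
proof (rule ringI)
  have "\<exists>y \<in> carrier R. y + x = 0" if "x \<in> carrier R" for x
    using cvec.subspace_neg[OF assms(1) that] by (intro bexI[of _ "- x"]) auto
  then show "abelian_group R"
    by (intro abelian_groupI) (use assms(1) in \<open>auto simp: ops cvec.subspace_def add_ac\<close>)
  show "monoid R"
    by (rule monoidI) (use assms conv_assoc in \<open>auto simp: ops subset_iff\<close>)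
qed (auto simp: ops conv_add)

lemma ring_category_algebra: "ring (category_algebra \<D>)"
proof -
  let ?u = "\<Sum>a \<in> Obj \<D>. unit a"
  have "?u \<star> x = x \<and> x \<star> ?u = x" if "x \<in> A" for x
    using that
  proof (induction rule: arr_space_induct)
    case (basis m)
    note m = Arr_hom_set[OF basis]
    have "unit a \<star> basis_elt m = (if a = Cod \<D> m then basis_elt m else 0)" if "a \<in> Obj \<D>" for a
      using Id_hom[OF that] Comp_Id_left[OF m] by (auto simp: conv_basis_elt hom_set_def)
    moreover have "basis_elt m \<star> unit a = (if a = Dom \<D> m then basis_elt m else 0)" if "a \<in> Obj \<D>" for a
      using Id_hom[OF that] Comp_Id_right[OF m] by (auto simp: conv_basis_elt hom_set_def)
    ultimately show ?case
      using Dom_Obj[OF basis] Cod_Obj[OF basis] finite_Obj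
      by (simp add: conv_sum_left conv_sum_right)
  qed (auto simp: conv_add conv_cscale conv_zero)
  moreover have "?u \<in> A"
    by (intro arr_space_closed hom_space_arr_space[OF unit_hom_space])
  moreover have "\<one>\<^bsub>category_algebra \<D>\<^esub> = ?u"
    by (simp add: category_algebra_def)
  ultimately show ?thesis
    by (intro ring_combinations) (auto simp: subspace_arr_space conv_arr_space)
qed

lemma ring_group_algebra:
  assumes "a \<in> Obj \<D>"
  shows "ring (group_algebra \<D> a)"
  using assms
  by (intro ring_combinations)
    (auto simp: subspace_hom_space unit_left unit_right Id_hom intro: hom_space_arr_space conv_hom_space)

lemma scalar_category_algebra:
  assumes "x \<in> A"
  shows "scalar_elt (category_algebra \<D>) c \<star> x = cscale c x"
  using monoid.l_one[OF ring.is_monoid[OF ring_category_algebra], of x] assms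
  by (simp add: conv_cscale)

section \<open>Averaging over automorphism groups\<close>

definition aut_group :: "'o \<Rightarrow> 'm monoid"
  where "aut_group a = \<lparr>carrier = hom_set \<D> a a, monoid.mult = Comp \<D>, one = Id \<D> a\<rparr>"

text \<open>The EI property makes endomorphism monoids groups, over which one can average.\<close>

lemma group_aut_group:
  assumes "a \<in> Obj \<D>"
  shows "group (aut_group a)"
proof (rule groupI)
  fix x assume "x \<in> carrier (aut_group a)"
  then show "\<exists>y \<in> carrier (aut_group a). y \<otimes>\<^bsub>aut_group a\<^esub> x = \<one>\<^bsub>aut_group a\<^esub>"
    using EI assms by (auto simp: EI_cat_def is_iso_def aut_group_def)
qed (use assms in \<open>auto simp: aut_group_def intro: Comp_hom Id_hom Comp_assoc[symmetric] Comp_Id_left\<close>)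

text \<open>The two projections below make invariant subspaces split off: on the left only, for the
  left ideals of a group algebra, and on both sides, for bimodules.\<close>

lemma left_equivariant_projection:
  assumes b: "b \<in> Obj \<D>" and N: "cvec.subspace N" "N \<subseteq> H a b"
    and inv: "\<And>r x. r \<in> H b b \<Longrightarrow> x \<in> N \<Longrightarrow> r \<star> x \<in> N"
  obtains \<pi> where "clinear \<pi>" "\<And>x. \<pi> x \<in> N" "\<And>x. x \<in> N \<Longrightarrow> \<pi> x = x"
    "\<And>r x. r \<in> H b b \<Longrightarrow> x \<in> H a b \<Longrightarrow> \<pi> (r \<star> x) = r \<star> \<pi> x"
proof -
  have "\<exists>\<pi>. clinear \<pi> \<and> (\<forall>x. \<pi> x \<in> N) \<and> (\<forall>x \<in> N. \<pi> x = x) \<and>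
    (\<forall>g \<in> carrier (aut_group b). \<forall>x \<in> H a b. \<pi> (basis_elt g \<star> x) = basis_elt g \<star> \<pi> x)"
  proof (rule averaging[OF group_aut_group[OF b], where \<rho> = "\<lambda>g x. basis_elt g \<star> x"])
    show "basis_elt g \<star> (basis_elt h \<star> x) = basis_elt (g \<otimes>\<^bsub>aut_group b\<^esub> h) \<star> x"
      if "g \<in> carrier (aut_group b)" "h \<in> carrier (aut_group b)" "x \<in> H a b" for g h x
    proof -
      have gh: "basis_elt g \<in> H b b" "basis_elt h \<in> H b b"
        using that by (simp_all add: aut_group_def)
      have "basis_elt g \<star> basis_elt h = basis_elt (Comp \<D> g h)"
        using that by (simp add: conv_basis_elt aut_group_def hom_set_def)
      then show ?thesis
        using conv_assoc[OF gh[THEN hom_space_arr_space] hom_space_arr_space[OF that(3)]]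
        by (simp add: aut_group_def)
    qed
  qed (use N inv b in \<open>auto simp: aut_group_def finite_hom_set clinear_conv_right unit_left
      intro: conv_hom_space\<close>)
  then obtain \<pi> where \<pi>: "clinear \<pi>" "\<And>x. \<pi> x \<in> N" "\<And>x. x \<in> N \<Longrightarrow> \<pi> x = x"
    and equi: "\<And>g x. g \<in> hom_set \<D> b b \<Longrightarrow> x \<in> H a b \<Longrightarrow> \<pi> (basis_elt g \<star> x) = basis_elt g \<star> \<pi> x"
    by (auto simp: aut_group_def)
  have "\<pi> (r \<star> x) = r \<star> \<pi> x" if "r \<in> H b b" "x \<in> H a b" for r x
    using that(1)
    by (induction rule: hom_space_induct)
      (auto simp: equi[OF _ that(2)] clinearD[OF \<pi>(1)] conv_add conv_cscale conv_zero)
  with \<pi> that show ?thesis by blast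
qed

lemma two_sided_equivariant_projection:
  assumes ab: "a \<in> Obj \<D>" "b \<in> Obj \<D>" and N: "cvec.subspace N" "N \<subseteq> H a b"
    and inv: "\<And>r x. r \<in> H b b \<Longrightarrow> x \<in> N \<Longrightarrow> r \<star> x \<in> N" "\<And>s x. s \<in> H a a \<Longrightarrow> x \<in> N \<Longrightarrow> x \<star> s \<in> N"
  obtains \<pi> where "clinear \<pi>" "\<And>x. \<pi> x \<in> N" "\<And>x. x \<in> N \<Longrightarrow> \<pi> x = x"
    "\<And>r x. r \<in> H b b \<Longrightarrow> x \<in> H a b \<Longrightarrow> \<pi> (r \<star> x) = r \<star> \<pi> x"
    "\<And>s x. s \<in> H a a \<Longrightarrow> x \<in> H a b \<Longrightarrow> \<pi> (x \<star> s) = \<pi> x \<star> s"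
proof -
  interpret Ga: group "aut_group a" using ab(1) by (rule group_aut_group)
  interpret Gb: group "aut_group b" using ab(2) by (rule group_aut_group)
  \<comment> \<open>The inverse turns right multiplication into a left action.\<close>
  let ?G = "aut_group b \<times>\<times> aut_group a"
  let ?\<rho> = "\<lambda>(g, h) x. basis_elt g \<star> x \<star> basis_elt (inv\<^bsub>aut_group a\<^esub> h)"
  have inv_hom: "inv\<^bsub>aut_group a\<^esub> h \<in> hom_set \<D> a a" if "h \<in> hom_set \<D> a a" for h
    using Ga.inv_closed[of h] that by (simp add: aut_group_def)
  have basis_comp: "basis_elt g \<star> basis_elt h = basis_elt (Comp \<D> g h)"
    if "g \<in> hom_set \<D> c c" "h \<in> hom_set \<D> c c" for g h c
    using that by (simp add: conv_basis_elt hom_set_def)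
  have "\<exists>\<pi>. clinear \<pi> \<and> (\<forall>x. \<pi> x \<in> N) \<and> (\<forall>x \<in> N. \<pi> x = x) \<and>
    (\<forall>g \<in> carrier ?G. \<forall>x \<in> H a b. \<pi> (?\<rho> g x) = ?\<rho> g (\<pi> x))"
  proof (rule averaging)
    show "group ?G"
      by (rule DirProd_group) unfold_locales
    show "finite (carrier ?G)"
      by (simp add: DirProd_def aut_group_def finite_hom_set)
    show "clinear (?\<rho> p)" if "p \<in> carrier ?G" for p
      by (auto simp: clinear_iff conv_add conv_cscale split: prod.split)
    show "?\<rho> p x \<in> H a b" if "p \<in> carrier ?G" "x \<in> H a b" for p x
    proof -
      obtain g h where gh: "p = (g, h)" "g \<in> hom_set \<D> b b" "h \<in> hom_set \<D> a a"
        using \<open>p \<in> carrier ?G\<close> by (auto simp: DirProd_def aut_group_def)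
      then have "basis_elt g \<star> x \<in> H a b"
        using that(2) by (intro conv_hom_space) simp_all
      then show ?thesis
        using gh(1) inv_hom[OF gh(3)] by (auto intro: conv_hom_space)
    qed
    show "?\<rho> p x \<in> N" if "p \<in> carrier ?G" "x \<in> N" for p x
      using that inv inv_hom by (auto simp: DirProd_def) (auto simp: aut_group_def)
    show "?\<rho> \<one>\<^bsub>?G\<^esub> x = x" if "x \<in> H a b" for x
      using that ab Ga.inv_one by (simp add: aut_group_def unit_left unit_right)
    show "?\<rho> p (?\<rho> q x) = ?\<rho> (p \<otimes>\<^bsub>?G\<^esub> q) x"
      if pq: "p \<in> carrier ?G" "q \<in> carrier ?G" and x: "x \<in> H a b" for p q x
    proof -
      obtain g h g' h' where eq: "p = (g, h)" "q = (g', h')"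
        by (metis surj_pair)
      have mem: "g \<in> hom_set \<D> b b" "g' \<in> hom_set \<D> b b" "h \<in> hom_set \<D> a a" "h' \<in> hom_set \<D> a a"
        using pq eq by (auto simp: DirProd_def aut_group_def)
      have ih: "inv\<^bsub>aut_group a\<^esub> h \<in> hom_set \<D> a a" "inv\<^bsub>aut_group a\<^esub> h' \<in> hom_set \<D> a a"
        using mem inv_hom by auto
      let ?k = "basis_elt (inv\<^bsub>aut_group a\<^esub> h)" and ?k' = "basis_elt (inv\<^bsub>aut_group a\<^esub> h')"
      have arr: "basis_elt g \<in> A" "basis_elt g' \<in> A" "x \<in> A" "?k \<in> A" "?k' \<in> A"
        using mem ih x by (auto intro: hom_space_arr_space)
      have "inv\<^bsub>aut_group a\<^esub> (h \<otimes>\<^bsub>aut_group a\<^esub> h') =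
          inv\<^bsub>aut_group a\<^esub> h' \<otimes>\<^bsub>aut_group a\<^esub> inv\<^bsub>aut_group a\<^esub> h"
        using mem by (intro Ga.inv_mult_group) (simp_all add: aut_group_def)
      then have k: "basis_elt (inv\<^bsub>aut_group a\<^esub> (h \<otimes>\<^bsub>aut_group a\<^esub> h')) = ?k' \<star> ?k"
        using basis_comp[OF ih(2,1)] by (simp add: aut_group_def[of a])
      have g: "basis_elt (g \<otimes>\<^bsub>aut_group b\<^esub> g') = basis_elt g \<star> basis_elt g'"
        using basis_comp[OF mem(1,2)] by (simp add: aut_group_def)
      have "?\<rho> p (?\<rho> q x) = basis_elt g \<star> (basis_elt g' \<star> x \<star> ?k') \<star> ?k"
        by (simp add: eq)
      also have "\<dots> = basis_elt g \<star> basis_elt g' \<star> x \<star> (?k' \<star> ?k)"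
        using arr by (simp add: conv_assoc conv_arr_space)
      also have "\<dots> = ?\<rho> (p \<otimes>\<^bsub>?G\<^esub> q) x"
        by (simp add: eq g k)
      finally show ?thesis .
    qed
  qed (use N in auto)
  then obtain \<pi> where \<pi>: "clinear \<pi>" "\<And>x. \<pi> x \<in> N" "\<And>x. x \<in> N \<Longrightarrow> \<pi> x = x"
    and equi: "\<And>g h x. g \<in> hom_set \<D> b b \<Longrightarrow> h \<in> hom_set \<D> a a \<Longrightarrow> x \<in> H a b \<Longrightarrow>
      \<pi> (basis_elt g \<star> x \<star> basis_elt (inv\<^bsub>aut_group a\<^esub> h)) =
        basis_elt g \<star> \<pi> x \<star> basis_elt (inv\<^bsub>aut_group a\<^esub> h)"
    by (auto simp: DirProd_def) (auto simp: aut_group_def)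
  have \<pi>H: "\<pi> x \<in> H a b" for x
    using \<pi>(2) N(2) by auto
  have left_basis: "\<pi> (basis_elt g \<star> x) = basis_elt g \<star> \<pi> x" if g: "g \<in> hom_set \<D> b b" and x: "x \<in> H a b" for g x
  proof -
    have "inv\<^bsub>aut_group a\<^esub> (Id \<D> a) = Id \<D> a"
      using Ga.inv_one by (simp add: aut_group_def)
    moreover have "basis_elt g \<star> x \<in> H a b" "basis_elt g \<star> \<pi> x \<in> H a b"
      using g x \<pi>H by (auto intro: conv_hom_space)
    ultimately show ?thesis
      using equi[OF g Id_hom[OF ab(1)] x] ab(1) by (simp add: unit_right)
  qed
  have left: "\<pi> (r \<star> x) = r \<star> \<pi> x" if "r \<in> H b b" "x \<in> H a b" for r x
    using that(1)
    by (induction rule: hom_space_induct)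
      (auto simp: that(2) left_basis clinearD[OF \<pi>(1)] conv_add conv_cscale conv_zero)
  have right_basis: "\<pi> (x \<star> basis_elt h) = \<pi> x \<star> basis_elt h" if h: "h \<in> hom_set \<D> a a" and x: "x \<in> H a b" for h x
    using equi[OF Id_hom[OF ab(2)] inv_hom[OF h] x] h Ga.inv_inv[of h]
      unit_left[OF x ab(2)] unit_left[OF \<pi>H ab(2)]
    by (simp add: aut_group_def)
  have right: "\<pi> (x \<star> s) = \<pi> x \<star> s" if "s \<in> H a a" "x \<in> H a b" for s x
    using that(1)
    by (induction rule: hom_space_induct)
      (auto simp: that(2) right_basis clinearD[OF \<pi>(1)] conv_add conv_cscale conv_zero)
  show ?thesis
    using that[OF \<pi> left right] by blast
qed

end

section \<open>Primitive idempotents of group algebras\<close>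

locale primitive_in_category = finite_EI_category \<D> for \<D> :: "('o, 'm) cat" +
  fixes c :: 'o and f :: "'m \<Rightarrow>\<^sub>0 complex"
  assumes c: "c \<in> Obj \<D>" and primitive: "primitive_idempotent (group_algebra \<D> c) f"
begin

lemma f_hom_space: "f \<in> H c c" and f_idem: "f \<star> f = f" and f_nonzero: "f \<noteq> 0"
  using primitive by (auto simp: primitive_idempotent_def idempotent_def)

lemma f_arr_space: "f \<in> A"
  using f_hom_space by (rule hom_space_arr_space)

lemma idempotent_below_f:
  assumes g: "g \<in> H c c" "g \<star> g = g" "f \<star> g = g" "g \<star> f = g"
  shows "g = 0 \<or> g = f"
proof -
  have "idempotent (group_algebra \<D> c) g" "idempotent (group_algebra \<D> c) (f - g)"
    "Defs.orthogonal (group_algebra \<D> c) g (f - g)"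
    using g f_hom_space f_idem
    by (auto simp: idempotent_def orthogonal_def conv_diff hom_space_closed)
  moreover have "f = g + (f - g)"
    by simp
  ultimately have "g = 0 \<or> f - g = 0"
    using primitive unfolding primitive_idempotent_def group_algebra_simps by metis
  then show ?thesis by auto
qed

text \<open>Maschke's theorem and Schur's lemma in one step. Right multiplication by \<open>y = f x f\<close> has an
  eigenvector in the corner. Its eigenspace in the left ideal of \<open>f\<close> is the image of an equivariant
  projection, hence generated by an idempotent below \<open>f\<close>, which has to be \<open>f\<close>; so \<open>f\<close> is itself an
  eigenvector.\<close>

lemma corner_scalar:
  assumes x: "x \<in> H c c"
  shows "\<exists>z. f \<star> x \<star> f = cscale z f"
proof -
  define y where "y = f \<star> x \<star> f"
  have xA: "x \<in> A"
    using x by (rule hom_space_arr_space)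
  have y: "y \<in> H c c"
    unfolding y_def using x f_hom_space by (intro conv_hom_space)
  have "f \<star> y = f \<star> f \<star> x \<star> f" "y \<star> f = f \<star> x \<star> (f \<star> f)"
    using xA f_arr_space by (simp_all only: y_def conv_assoc conv_arr_space)
  with y have y: "y \<in> H c c" "f \<star> y = y" "y \<star> f = y"
    by (simp_all add: f_idem y_def[symmetric])
  let ?T = "\<lambda>z. z \<star> y"
  define W where "W = {w \<in> H c c. f \<star> w = w \<and> w \<star> f = w}"
  have W: "cvec.subspace W"
    unfolding W_def cvec.subspace_def
    by (auto simp: conv_add conv_cscale conv_zero hom_space_closed)
  have pow: "(?T ^^ n) f \<in> W" for n
  proof (induction n)
    case 0
    show ?case by (simp add: W_def f_hom_space f_idem)
  next
    case (Suc n)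
    then have w: "(?T ^^ n) f \<in> H c c" "f \<star> (?T ^^ n) f = (?T ^^ n) f"
      by (auto simp: W_def)
    then show ?case
      using y conv_assoc[of f "(?T ^^ n) f" y] conv_assoc[of "(?T ^^ n) f" y f] f_hom_space
      by (simp add: W_def conv_hom_space hom_space_arr_space)
  qed
  then have "(?T ^^ n) f \<in> cvec.span (basis_elt ` hom_set \<D> c c)" for n
    using hom_space_span by (auto simp: W_def)
  then obtain l w where w: "w \<noteq> 0" "w \<star> y = cscale l w" "w \<in> cvec.span (range (\<lambda>n. (?T ^^ n) f))"
    using eigenvector_exists[OF clinear_conv_left f_nonzero finite_imageI[OF finite_hom_set]]
    by metis
  have "w \<in> W"
    using cvec.span_minimal[OF _ W, of "range (\<lambda>n. (?T ^^ n) f)"] w(3) pow by auto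
  define N where "N = {z \<in> H c c. z \<star> f = z \<and> z \<star> y = cscale l z}"
  have N1: "cvec.subspace N"
    unfolding N_def cvec.subspace_def
    by (auto simp: conv_add conv_cscale conv_zero hom_space_closed cvec.scale_right_distrib
        mult.commute)
  have N2: "N \<subseteq> H c c"
    by (auto simp: N_def)
  have N3: "r \<star> z \<in> N" if "r \<in> H c c" "z \<in> N" for r z
  proof -
    have "z \<in> H c c" "z \<star> f = z" "z \<star> y = cscale l z"
      using that(2) by (auto simp: N_def)
    then show ?thesis
      using that(1) conv_assoc[of r z f] conv_assoc[of r z y] y(1) f_hom_space
      by (simp add: N_def conv_hom_space hom_space_arr_space conv_cscale)
  qed
  obtain p where p: "clinear p" "\<And>z. p z \<in> N" "\<And>z. z \<in> N \<Longrightarrow> p z = z"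
    "\<And>r z. r \<in> H c c \<Longrightarrow> z \<in> H c c \<Longrightarrow> p (r \<star> z) = r \<star> p z"
    by (rule left_equivariant_projection[OF c N1 N2 N3], assumption+, rule that)
  have g: "p f \<in> H c c" "p f \<star> f = p f"
    using p(2)[of f] by (auto simp: N_def)
  have "p f = 0 \<or> p f = f"
  proof (rule idempotent_below_f)
    show "p f \<star> p f = p f"
      using p(4)[OF g(1) f_hom_space] g(2) p(3)[OF p(2)] by simp
    show "f \<star> p f = p f"
      using p(4)[OF f_hom_space f_hom_space] by (simp add: f_idem)
  qed (use g in auto)
  moreover have "p f \<noteq> 0"
  proof
    assume 0: "p f = 0"
    have "w \<in> N"
      using \<open>w \<in> W\<close> w(2) by (simp add: W_def N_def)
    then have "w = p (w \<star> f)"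
      using p(3)[of w] by (simp add: N_def)
    also have "\<dots> = 0"
      using \<open>w \<in> W\<close> p(4)[OF _ f_hom_space, of w] 0 by (simp add: W_def conv_zero)
    finally show False
      using w(1) by simp
  qed
  ultimately have "f \<in> N"
    using p(2)[of f] by auto
  then have "y = cscale l f"
    using y(2) by (simp add: N_def)
  then show ?thesis
    by (auto simp: y_def)
qed

text \<open>The coordinate of \<open>f x f\<close> in the corner of \<open>f\<close>, which is spanned by \<open>f\<close>.\<close>

definition corner_coeff :: "('m \<Rightarrow>\<^sub>0 complex) \<Rightarrow> complex" ("\<kappa>")
  where "\<kappa> x = (THE z. f \<star> x \<star> f = cscale z f)"

lemma corner_coeff_unique: "f \<star> x \<star> f = cscale z f \<Longrightarrow> \<kappa> x = z"
  unfolding corner_coeff_def by (rule the_equality) (auto simp: f_nonzero)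

lemma corner_coeff: "x \<in> H c c \<Longrightarrow> f \<star> x \<star> f = cscale (\<kappa> x) f"
  using corner_scalar corner_coeff_unique by metis

lemma corner_coeff_add: "x \<in> H c c \<Longrightarrow> y \<in> H c c \<Longrightarrow> \<kappa> (x + y) = \<kappa> x + \<kappa> y"
  by (rule corner_coeff_unique) (simp add: conv_add corner_coeff cvec.scale_left_distrib)

lemma corner_coeff_cscale: "x \<in> H c c \<Longrightarrow> \<kappa> (cscale z x) = z * \<kappa> x"
  by (rule corner_coeff_unique) (simp add: conv_cscale corner_coeff)

lemma corner_coeff_f: "\<kappa> f = 1"
  by (rule corner_coeff_unique) (simp add: f_idem)

text \<open>Multiplying by \<open>f\<close> on both sides kills all morphisms that are not endomorphisms of \<open>c\<close>.\<close>

lemma corner_coeff_arr_space: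
  assumes "x \<in> A" shows "\<exists>z. f \<star> x \<star> f = cscale z f"
proof -
  let ?u = "unit c"
  have "f \<star> (?u \<star> x \<star> ?u) \<star> f = (f \<star> ?u) \<star> x \<star> (?u \<star> f)"
    using assms f_arr_space hom_space_arr_space[OF unit_hom_space[OF c]]
    by (simp add: conv_assoc conv_arr_space)
  then have "f \<star> x \<star> f = f \<star> (?u \<star> x \<star> ?u) \<star> f"
    using f_hom_space c by (simp add: unit_left unit_right)
  then show ?thesis
    using corner_scalar[OF unit_corner[OF assms c c]] by simp
qed

text \<open>The two-sided ideal generated by \<open>f\<close> is a direct summand of the group algebra, so it has
  a unit, \<open>\<Sum>k. p k \<star> q k\<close>. This makes \<open>p\<close> a generating family of the left ideal of \<open>f\<close> with
  coordinates \<open>v \<mapsto> \<kappa> (q k \<star> v)\<close>, and dually for the right ideal.\<close>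

lemma dual_generators:
  obtains n :: nat and p q where
    "\<And>k. k < n \<Longrightarrow> p k \<in> H c c" "\<And>k. k < n \<Longrightarrow> p k \<star> f = p k"
    "\<And>k. k < n \<Longrightarrow> q k \<in> H c c" "\<And>k. k < n \<Longrightarrow> f \<star> q k = q k"
    "\<And>v. v \<in> H c c \<Longrightarrow> v \<star> f = v \<Longrightarrow> (\<Sum>k<n. p k \<star> (q k \<star> v)) = v"
    "\<And>y. y \<in> H c c \<Longrightarrow> f \<star> y = y \<Longrightarrow> (\<Sum>k<n. (y \<star> p k) \<star> q k) = y"
proof -
  \<comment> \<open>The ideal consists of the sums of products \<open>p \<star> q\<close> over finite lists of pairs, with \<open>p\<close> in the
    left ideal of \<open>f\<close> and \<open>q\<close> in the right one.\<close>
  define good where "good ps \<longleftrightarrow>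
    (\<forall>(p, q) \<in> set ps. p \<in> H c c \<and> p \<star> f = p \<and> q \<in> H c c \<and> f \<star> q = q)"
    for ps :: "(('m \<Rightarrow>\<^sub>0 complex) \<times> ('m \<Rightarrow>\<^sub>0 complex)) list"
  define val where "val ps = (\<Sum>(p, q) \<leftarrow> ps. p \<star> q)"
    for ps :: "(('m \<Rightarrow>\<^sub>0 complex) \<times> ('m \<Rightarrow>\<^sub>0 complex)) list"
  define J where "J = {val ps | ps. good ps}"
  note closed = conv_hom_space hom_space_arr_space
  have val_H: "val ps \<in> H c c" if "good ps" for ps
    using that
    by (induction ps) (auto simp: good_def val_def intro: conv_hom_space hom_space_closed(1,3))
  have left: "r \<star> val ps = val (map (\<lambda>(p, q). (r \<star> p, q)) ps) \<and> good (map (\<lambda>(p, q). (r \<star> p, q)) ps)"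
    if "good ps" and r: "r \<in> H c c" for r ps
    using that(1)
  proof (induction ps)
    case (Cons pq ps)
    obtain p q where pq: "pq = (p, q)" "p \<in> H c c" "p \<star> f = p" "q \<in> H c c" "f \<star> q = q" "good ps"
      using Cons.prems by (cases pq) (auto simp: good_def)
    have "r \<star> p \<in> H c c" "r \<star> p \<star> f = r \<star> p" "r \<star> (p \<star> q) = r \<star> p \<star> q"
      using r pq f_arr_space by (simp_all add: conv_hom_space conv_assoc hom_space_arr_space)
    then show ?case
      using Cons.IH pq by (auto simp: good_def val_def conv_add)
  qed (simp add: good_def val_def conv_zero)
  have right: "val ps \<star> r = val (map (\<lambda>(p, q). (p, q \<star> r)) ps) \<and> good (map (\<lambda>(p, q). (p, q \<star> r)) ps)"
    if "good ps" and r: "r \<in> H c c" for r ps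
    using that(1)
  proof (induction ps)
    case (Cons pq ps)
    obtain p q where pq: "pq = (p, q)" "p \<in> H c c" "p \<star> f = p" "q \<in> H c c" "f \<star> q = q" "good ps"
      using Cons.prems by (cases pq) (auto simp: good_def)
    have "q \<star> r \<in> H c c" "f \<star> (q \<star> r) = q \<star> r" "p \<star> q \<star> r = p \<star> (q \<star> r)"
      using r pq f_arr_space conv_assoc[of f q r]
      by (simp_all add: conv_hom_space conv_assoc hom_space_arr_space)
    then show ?case
      using Cons.IH pq by (auto simp: good_def val_def conv_add)
  qed (simp add: good_def val_def conv_zero)
  have scale: "cscale z (val ps) \<in> J" if "good ps" for z ps
    using left[OF that, of "cscale z (unit c)"] val_H[OF that] unit_hom_space[OF c] c
    by (auto simp: J_def conv_cscale unit_left hom_space_closed)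
  have J1: "cvec.subspace J"
    unfolding cvec.subspace_def
  proof (intro conjI ballI allI)
    have "good []" "val [] = 0" by (simp_all add: good_def val_def)
    then show "0 \<in> J" unfolding J_def by (intro CollectI exI[of _ "[]"]) simp
    fix x y z assume "x \<in> J"
    then obtain ps where ps: "x = val ps" "good ps" by (auto simp: J_def)
    show "cscale z x \<in> J"
      using scale[OF ps(2)] ps(1) by simp
    assume "y \<in> J"
    then obtain qs where qs: "y = val qs" "good qs" by (auto simp: J_def)
    have "good (ps @ qs)" "x + y = val (ps @ qs)"
      using ps qs by (auto simp: good_def val_def)
    then show "x + y \<in> J" by (auto simp: J_def)
  qed
  have J2: "J \<subseteq> H c c"
    using val_H by (auto simp: J_def)
  have J3: "r \<star> x \<in> J" and J4: "x \<star> r \<in> J" if r: "r \<in> H c c" and x: "x \<in> J" for r x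
  proof -
    obtain ps where ps: "x = val ps" "good ps" using x by (auto simp: J_def)
    show "r \<star> x \<in> J" "x \<star> r \<in> J"
      using left[OF ps(2) r] right[OF ps(2) r] unfolding ps(1) J_def by blast+
  qed
  obtain \<pi> where \<pi>: "clinear \<pi>" "\<And>x. \<pi> x \<in> J" "\<And>x. x \<in> J \<Longrightarrow> \<pi> x = x"
    "\<And>r x. r \<in> H c c \<Longrightarrow> x \<in> H c c \<Longrightarrow> \<pi> (r \<star> x) = r \<star> \<pi> x"
    "\<And>s x. s \<in> H c c \<Longrightarrow> x \<in> H c c \<Longrightarrow> \<pi> (x \<star> s) = \<pi> x \<star> s"
    by (rule two_sided_equivariant_projection[OF c c J1 J2 J3 J4], assumption+, rule that)
  \<comment> \<open>The image of the unit under an equivariant projection onto an ideal is a unit of the ideal.\<close>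
  obtain ps where ps: "\<pi> (unit c) = val ps" "good ps"
    using \<pi>(2)[of "unit c"] unfolding J_def by blast
  have val_unit: "val ps \<star> x = x" "x \<star> val ps = x" if "x \<in> J" for x
  proof -
    have x: "x \<in> H c c" using that J2 by auto
    show "val ps \<star> x = x"
      using \<pi>(5)[OF x unit_hom_space[OF c]] \<pi>(3)[OF that] ps(1) x c by (simp add: unit_left)
    show "x \<star> val ps = x"
      using \<pi>(4)[OF x unit_hom_space[OF c]] \<pi>(3)[OF that] ps(1) x c by (simp add: unit_right)
  qed
  have "val [(v, f)] = v" "good [(v, f)]" if "v \<in> H c c" "v \<star> f = v" for v
    using that f_hom_space f_idem by (auto simp: good_def val_def)
  then have gen1: "v \<in> J" if "v \<in> H c c" "v \<star> f = v" for v
    using that unfolding J_def by (intro CollectI exI[of _ "[(v, f)]"]) simp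
  have "val [(f, v)] = v" "good [(f, v)]" if "v \<in> H c c" "f \<star> v = v" for v
    using that f_hom_space f_idem by (auto simp: good_def val_def)
  then have gen2: "v \<in> J" if "v \<in> H c c" "f \<star> v = v" for v
    using that unfolding J_def by (intro CollectI exI[of _ "[(f, v)]"]) simp
  define n p q where "n = length ps" and "p = (\<lambda>k. fst (ps ! k))" and "q = (\<lambda>k. snd (ps ! k))"
  have pq: "p k \<in> H c c" "p k \<star> f = p k" "q k \<in> H c c" "f \<star> q k = q k" if "k < n" for k
    using ps(2) nth_mem[of k ps] that by (auto simp: good_def n_def p_def q_def case_prod_beta)
  have pqA: "p k \<in> A" "q k \<in> A" if "k < n" for k
    using hom_space_arr_space[OF pq(1)[OF that]] hom_space_arr_space[OF pq(3)[OF that]] by simp_all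
  have val_sum: "val ps = (\<Sum>k<n. p k \<star> q k)"
    by (simp add: val_def n_def p_def q_def sum_list_sum_nth case_prod_beta atLeast0LessThan)
  show ?thesis
  proof (rule that[OF pq])
    show "(\<Sum>k<n. p k \<star> (q k \<star> v)) = v" if v: "v \<in> H c c" "v \<star> f = v" for v
    proof -
      have "(\<Sum>k<n. p k \<star> (q k \<star> v)) = val ps \<star> v"
        using pqA hom_space_arr_space[OF v(1)] by (simp add: val_sum conv_sum_left conv_assoc)
      then show ?thesis
        using val_unit(1)[OF gen1[OF v]] by simp
    qed
    show "(\<Sum>k<n. (v \<star> p k) \<star> q k) = v" if v: "v \<in> H c c" "f \<star> v = v" for v
    proof -
      have "(\<Sum>k<n. (v \<star> p k) \<star> q k) = v \<star> val ps"
        using pqA hom_space_arr_space[OF v(1)] by (simp add: val_sum conv_sum_right conv_assoc)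
      then show ?thesis
        using val_unit(2)[OF gen2[OF v]] by simp
    qed
  qed
qed

end

section \<open>Composition factors of projective modules\<close>

definition (in finite_EI_category) left_ideal :: "('m \<Rightarrow>\<^sub>0 complex) set \<Rightarrow> bool"
  where "left_ideal N \<longleftrightarrow> cvec.subspace N \<and> N \<subseteq> A \<and> (\<forall>r \<in> A. \<forall>x \<in> N. r \<star> x \<in> N)"

context finite_EI_category
begin

abbreviation CD where "CD \<equiv> category_algebra \<D>"
abbreviation P where "P \<equiv> projective_module \<D>"

lemma left_idealD:
  assumes "left_ideal N"
  shows "cvec.subspace N" "N \<subseteq> A" "\<And>r x. r \<in> A \<Longrightarrow> x \<in> N \<Longrightarrow> r \<star> x \<in> N"
    "0 \<in> N" "\<And>x y. x \<in> N \<Longrightarrow> y \<in> N \<Longrightarrow> x + y \<in> N"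
  using assms by (auto simp: left_ideal_def cvec.subspace_def)

text \<open>The unit of the category algebra turns closure under the algebra into closure under scalars.\<close>

lemma left_idealI:
  assumes "N \<subseteq> A" "0 \<in> N" "\<And>x y. x \<in> N \<Longrightarrow> y \<in> N \<Longrightarrow> x + y \<in> N"
    and act: "\<And>r x. r \<in> A \<Longrightarrow> x \<in> N \<Longrightarrow> r \<star> x \<in> N"
  shows "left_ideal N"
proof -
  have "cscale z x \<in> N" if "x \<in> N" for z x
  proof -
    have x: "x \<in> A" using that assms(1) by auto
    have "scalar_elt CD z \<in> A"
      using ring.ring_simprules(6)[OF ring_category_algebra] by (simp add: arr_space_closed)
    then show ?thesis
      using act[OF _ that] scalar_category_algebra[OF x] by metis
  qed
  then show ?thesis
    using assms by (auto simp: left_ideal_def cvec.subspace_def)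
qed

lemma projective_module_simps [simp]:
  "\<zero>\<^bsub>P g\<^esub> = 0" "x \<oplus>\<^bsub>P g\<^esub> y = x + y" "r \<odot>\<^bsub>P g\<^esub> x = r \<star> x"
  by (simp_all add: projective_module_def left_ideal_module_def)

lemma carrier_projective:
  assumes "g \<in> A" "g \<star> g = g"
  shows "carrier (P g) = {x \<in> A. x \<star> g = x}"
  using assms
  by (force simp: projective_module_def left_ideal_module_def conv_assoc conv_arr_space)

lemma left_ideal_projective:
  assumes "g \<in> A" "g \<star> g = g"
  shows "left_ideal (carrier (P g))"
  by (rule left_idealI)
    (use assms in \<open>auto simp: carrier_projective arr_space_closed conv_add conv_zero conv_assoc conv_arr_space\<close>)

lemma left_module_projective:
  assumes "g \<in> A" "g \<star> g = g"
  shows "left_module CD (P g)"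
proof -
  note ideal = left_ideal_projective[OF assms]
  have "\<exists>y \<in> carrier (P g). y + x = 0" if "x \<in> carrier (P g)" for x
    using cvec.subspace_neg[OF left_idealD(1)[OF ideal] that] by (intro bexI[of _ "- x"]) auto
  then have "abelian_group (P g)"
    by (intro abelian_groupI) (auto simp: left_idealD[OF ideal] add_ac)
  moreover have "\<one>\<^bsub>CD\<^esub> \<star> x = x" if "x \<in> A" for x
    using monoid.l_one[OF ring.is_monoid[OF ring_category_algebra], of x] that by simp
  ultimately show ?thesis
    using left_idealD(2,3)[OF ideal] conv_assoc
    by (intro left_module.intro left_module_axioms.intro ring_category_algebra)
      (auto simp: conv_add subset_iff)
qed

lemma submodule_projective_iff:
  assumes "g \<in> A" "g \<star> g = g"
  shows "submodule N CD (P g) \<longleftrightarrow> left_ideal N \<and> N \<subseteq> carrier (P g)"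
proof -
  interpret left_module CD "P g" using assms by (rule left_module_projective)
  show ?thesis
    using left_idealI[of N] left_idealD[of N] left_idealD(2)[OF left_ideal_projective[OF assms]]
    by (auto simp: submodule_iff)
qed

lemma left_ideal_span: "left_ideal N \<Longrightarrow> N \<subseteq> cvec.span (basis_elt ` Arr \<D>)"
  using left_idealD(2) arr_space_span by blast

lemma finite_basis_elts: "finite (basis_elt ` Arr \<D>)"
  using finite_Arr by simp

lemma left_ideal_orbit:
  assumes "left_ideal L" "left_ideal K" "x \<in> A"
  shows "left_ideal {y \<star> x + l | y l. y \<in> K \<and> l \<in> L}"
proof (rule left_idealI)
  let ?Q = "{y \<star> x + l | y l. y \<in> K \<and> l \<in> L}"
  show "?Q \<subseteq> A"
    using left_idealD(2)[OF assms(1)] left_idealD(2)[OF assms(2)] assms(3)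
    by (auto intro!: arr_space_closed(1) conv_arr_space)
  show "0 \<in> ?Q"
    using left_idealD(4)[OF assms(1)] left_idealD(4)[OF assms(2)]
    by (intro CollectI exI[of _ 0]) (simp add: conv_zero)
  show "u + v \<in> ?Q" if uv: "u \<in> ?Q" "v \<in> ?Q" for u v
  proof -
    obtain y l y' l' where "u = y \<star> x + l" "v = y' \<star> x + l'" "y \<in> K" "y' \<in> K" "l \<in> L" "l' \<in> L"
      using uv by blast
    then show ?thesis
      using left_idealD(5)[OF assms(1)] left_idealD(5)[OF assms(2)]
      by (intro CollectI exI[of _ "y + y'"] exI[of _ "l + l'"]) (simp add: conv_add)
  qed
  show "r \<star> u \<in> ?Q" if r: "r \<in> A" and u: "u \<in> ?Q" for r u
  proof -
    obtain y l where yl: "u = y \<star> x + l" "y \<in> K" "l \<in> L"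
      using u by blast
    have "r \<star> (y \<star> x) = r \<star> y \<star> x"
      using r yl(2) left_idealD(2)[OF assms(2)] assms(3) by (auto simp: conv_assoc)
    then show ?thesis
      using yl r left_idealD(3)[OF assms(1)] left_idealD(3)[OF assms(2)]
      by (intro CollectI exI[of _ "r \<star> y"] exI[of _ "r \<star> l"]) (simp add: conv_add)
  qed
qed

end

context primitive_in_category
begin

text \<open>For \<open>x\<close> in \<open>P f\<close>, \<open>f x = f x f\<close> is a scalar multiple of \<open>f\<close>. So a submodule that \<open>f\<close> does not
  annihilate contains the generator \<open>f\<close>.\<close>

lemma proper_submodule_annihilated:
  assumes N: "left_ideal N" "N \<subseteq> carrier (P f)" "N \<noteq> carrier (P f)" and x: "x \<in> N"
  shows "f \<star> x = 0"
proof (rule ccontr)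
  assume nz: "f \<star> x \<noteq> 0"
  have xA: "x \<in> A" "x \<star> f = x"
    using x N(2) by (auto simp: carrier_projective[OF f_arr_space f_idem])
  obtain z where z: "f \<star> x \<star> f = cscale z f"
    using corner_coeff_arr_space[OF xA(1)] by blast
  then have fx: "f \<star> x = cscale z f"
    using xA f_arr_space by (simp add: conv_assoc)
  then have "f = cscale (1 / z) (f \<star> x)"
    using nz by auto
  also have "\<dots> \<in> N"
    using left_idealD[OF N(1)] x f_arr_space by (simp add: cvec.subspace_scale)
  finally have "f \<in> N" .
  then have "carrier (P f) \<subseteq> N"
    using left_idealD(3)[OF N(1)] by (force simp: carrier_projective[OF f_arr_space f_idem])
  then show False
    using N(2,3) by auto
qed

text \<open>The largest submodule that \<open>f\<close> annihilates. As every proper submodule is annihilated by \<open>f\<close>, it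
  is the only maximal one, and hence the radical.\<close>

definition radical :: "('m \<Rightarrow>\<^sub>0 complex) set"
  where "radical = {x \<in> carrier (P f). \<forall>y \<in> A. f \<star> (y \<star> x) = 0}"

lemma radical_subset: "radical \<subseteq> carrier (P f)"
  by (auto simp: radical_def)

lemma left_ideal_radical: "left_ideal radical"
proof (rule left_idealI)
  note P = left_idealD[OF left_ideal_projective[OF f_arr_space f_idem]]
  show "radical \<subseteq> A" using P(2) by (auto simp: radical_def)
  show "0 \<in> radical" using P(4) by (simp add: radical_def conv_zero)
  show "x + y \<in> radical" if "x \<in> radical" "y \<in> radical" for x y
    using that P(5) by (simp add: radical_def conv_add)
  show "r \<star> x \<in> radical" if "r \<in> A" "x \<in> radical" for r x
  proof -
    have "y \<star> (r \<star> x) = y \<star> r \<star> x" if "y \<in> A" for y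
      using \<open>x \<in> radical\<close> \<open>r \<in> A\<close> that P(2) by (auto simp: radical_def conv_assoc)
    then show ?thesis
      using that P(3) by (simp add: radical_def conv_arr_space)
  qed
qed

lemma f_annihilates_radical: "x \<in> radical \<Longrightarrow> f \<star> x = 0"
  using f_arr_space f_idem left_idealD(2)[OF left_ideal_projective[OF f_arr_space f_idem]]
    conv_assoc[of f f x]
  by (auto simp: radical_def)

lemma f_in_projective: "f \<in> carrier (P f)"
  by (simp add: carrier_projective f_arr_space f_idem)

lemma f_notin_radical: "f \<notin> radical"
  using f_annihilates_radical[of f] f_idem f_nonzero by auto

lemma proper_submodule_radical:
  assumes "left_ideal N" "N \<subseteq> carrier (P f)" "N \<noteq> carrier (P f)"
  shows "N \<subseteq> radical"
  using assms proper_submodule_annihilated[OF assms] left_idealD(3)[OF assms(1)]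
  by (auto simp: radical_def)

lemma module_radical_projective: "module_radical CD (P f) = radical"
proof -
  note sub = submodule_projective_iff[OF f_arr_space f_idem]
  have proper: "radical \<noteq> carrier (P f)"
    using f_notin_radical f_in_projective by auto
  have "maximal_submodule N CD (P f) \<longleftrightarrow> N = radical" for N
  proof
    assume "maximal_submodule N CD (P f)"
    then have N: "left_ideal N" "N \<subseteq> carrier (P f)" "N \<noteq> carrier (P f)"
      and max: "\<And>L. left_ideal L \<Longrightarrow> L \<subseteq> carrier (P f) \<Longrightarrow> N \<subseteq> L \<Longrightarrow> L = N \<or> L = carrier (P f)"
      by (auto simp: maximal_submodule_def sub)
    show "N = radical"
      using max[OF left_ideal_radical radical_subset proper_submodule_radical[OF N]] proper by auto
  next
    assume "N = radical"
    then show "maximal_submodule N CD (P f)"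
      using left_ideal_radical radical_subset proper proper_submodule_radical
      by (auto simp: maximal_submodule_def sub)
  qed
  then show ?thesis
    using radical_subset by (auto simp: module_radical_def)
qed

abbreviation S where "S \<equiv> simple_category_module \<D> f"

lemma simple_category_module_eq: "S = quotient_module (P f) radical"
  by (simp add: simple_category_module_def module_radical_projective)

lemma submodule_of_radical: "submodule_of radical CD (P f)"
  using left_module_projective[OF f_arr_space f_idem] left_ideal_radical radical_subset
  by (simp add: submodule_of_def submodule_of_axioms_def submodule_projective_iff f_arr_space f_idem)

context
  fixes g L N
  assumes g: "g \<in> A" "g \<star> g = g"
    and N: "left_ideal N" "N \<subseteq> carrier (P g)" and L: "left_ideal L" "L \<subseteq> N"
    and simple: "simple_module CD (subquotient (P g) N L)"
begin

lemma submodule_of_subquotient: "submodule_of L CD ((P g)\<lparr>carrier := N\<rparr>)"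
  using left_module.left_module_sub[OF left_module_projective[OF g]]
    left_module.submodule_of_sub[OF left_module_projective[OF g]] submodule_projective_iff[OF g] N L
  by (auto simp: submodule_of_def submodule_of_axioms_def)

lemma subquotient_maximal:
  assumes "left_ideal Q" "L \<subseteq> Q" "Q \<subseteq> N"
  shows "Q = L \<or> Q = N"
proof -
  have "maximal_submodule L CD ((P g)\<lparr>carrier := N\<rparr>)"
    using submodule_of.simple_quotient_iff[OF submodule_of_subquotient] simple
    by (simp add: subquotient_def)
  moreover have "submodule Q CD ((P g)\<lparr>carrier := N\<rparr>)"
    using left_module.submodule_of_sub[OF left_module_projective[OF g], of N Q]
      submodule_projective_iff[OF g] N assms by auto
  ultimately show ?thesis
    using assms by (auto simp: maximal_submodule_def)
qed

text \<open>If \<open>f x\<close> is outside \<open>L\<close> for some \<open>x\<close> in \<open>N\<close>, then right multiplication by \<open>x\<close>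
  maps \<open>P f\<close> onto the simple module \<open>N / L\<close>, and the kernel is the only maximal submodule.
  Conversely \<open>f\<close> does not annihilate \<open>S\<close>.\<close>

lemma subquotient_isomorphic_iff:
  "module_isomorphic CD (subquotient (P g) N L) S \<longleftrightarrow> (\<exists>x \<in> N. f \<star> x \<notin> L)"
proof
  interpret M: submodule_of L CD "(P g)\<lparr>carrier := N\<rparr>" by (rule submodule_of_subquotient)
  interpret Pf: submodule_of radical CD "P f" by (rule submodule_of_radical)
  note Pf_ideal = left_ideal_projective[OF f_arr_space f_idem]
  note NA = left_idealD(2)[OF N(1)]
  show "\<exists>x \<in> N. f \<star> x \<notin> L" if iso: "module_isomorphic CD (subquotient (P g) N L) S"
  proof (rule ccontr)
    assume "\<not> (\<exists>x \<in> N. f \<star> x \<notin> L)"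
    then have fN: "f \<star> x \<in> L" if "x \<in> N" for x
      using that by blast
    have "f \<odot>\<^bsub>subquotient (P g) N L\<^esub> X = \<zero>\<^bsub>subquotient (P g) N L\<^esub>"
      if X: "X \<in> carrier (subquotient (P g) N L)" for X
    proof -
      obtain x where x: "x \<in> N" "X = L +>\<^bsub>(P g)\<lparr>carrier := N\<rparr>\<^esub> x"
        using X by (auto simp: subquotient_def M.carrier_quotient)
      then show ?thesis
        using M.act_quotient[of f x] M.coset_eq_L_iff[of "f \<star> x"] f_arr_space fN[OF x(1)] L(2)
        by (simp add: subquotient_def M.zero_quotient subset_iff)
    qed
    moreover have "left_module CD (subquotient (P g) N L)"
      using M.left_module_quotient by (simp add: subquotient_def)
    moreover have "left_module CD S"
      using Pf.left_module_quotient by (simp add: simple_category_module_eq)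
    moreover have "radical +>\<^bsub>P f\<^esub> f \<in> carrier S"
      using f_in_projective by (simp add: simple_category_module_eq Pf.carrier_quotient)
    ultimately have "f \<odot>\<^bsub>S\<^esub> (radical +>\<^bsub>P f\<^esub> f) = \<zero>\<^bsub>S\<^esub>"
      using module_isomorphic_annihilator[OF iso] f_arr_space by simp
    then have "radical +>\<^bsub>P f\<^esub> f = radical"
      using Pf.act_quotient[of f f] f_arr_space f_in_projective
      by (simp add: simple_category_module_eq Pf.zero_quotient f_idem)
    then show False
      using Pf.coset_eq_L_iff[OF f_in_projective] f_notin_radical by simp
  qed
  assume "\<exists>x \<in> N. f \<star> x \<notin> L"
  then obtain x where x: "x \<in> N" "f \<star> x \<notin> L" by blast
  have xA: "x \<in> A" using x(1) NA by auto
  have orbit: "{y \<star> x + l | y l. y \<in> K \<and> l \<in> L} \<subseteq> N" if "K \<subseteq> A" for K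
    using that x(1) L(2) left_idealD(3,5)[OF N(1)] by (auto simp: subset_iff)
  let ?K = "{y \<in> carrier (P f). y \<star> x \<in> L}"
  have "left_ideal ?K"
    using left_idealD[OF L(1)] left_idealD[OF Pf_ideal] xA
    by (intro left_idealI) (auto simp: conv_add conv_zero conv_assoc subset_iff)
  moreover have "?K \<noteq> carrier (P f)"
    using x(2) f_in_projective by auto
  ultimately have K: "?K \<subseteq> radical"
    by (intro proper_submodule_radical) auto
  have R: "y \<star> x \<in> L" if "y \<in> radical" for y
  proof -
    let ?Q = "{y \<star> x + l | y l. y \<in> radical \<and> l \<in> L}"
    have "L \<subseteq> ?Q"
    proof
      fix l assume "l \<in> L"
      then show "l \<in> ?Q"
        using left_idealD(4)[OF left_ideal_radical]
        by (intro CollectI exI[of _ 0] exI[of _ l]) (simp add: conv_zero)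
    qed
    then have "?Q = L \<or> ?Q = N"
      using subquotient_maximal left_ideal_orbit[OF L(1) left_ideal_radical xA]
        orbit[OF left_idealD(2)[OF left_ideal_radical]] by blast
    moreover have "?Q \<noteq> N"
    proof
      assume "?Q = N"
      then obtain y l where yl: "x = y \<star> x + l" "y \<in> radical" "l \<in> L"
        using x(1) by blast
      have "f \<star> x = f \<star> (y \<star> x) + f \<star> l"
        using arg_cong[OF yl(1), of "\<lambda>u. f \<star> u"] by (simp add: conv_add)
      also have "f \<star> (y \<star> x) = 0"
        using conv_assoc[OF f_arr_space _ xA, of y] yl(2) left_idealD(2)[OF left_ideal_radical]
          f_annihilates_radical[OF yl(2)] by (auto simp: conv_zero)
      finally show False
        using x(2) left_idealD(3)[OF L(1) f_arr_space yl(3)] by simp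
    qed
    ultimately have "?Q = L" by blast
    moreover have "y \<star> x \<in> ?Q"
      using that left_idealD(4)[OF L(1)] by (intro CollectI exI[of _ y] exI[of _ 0]) simp
    ultimately show ?thesis by simp
  qed
  let ?Q = "{y \<star> x + l | y l. y \<in> carrier (P f) \<and> l \<in> L}"
  have "N = ?Q"
  proof -
    have "L \<subseteq> ?Q"
    proof
      fix l assume "l \<in> L"
      then show "l \<in> ?Q"
        using left_idealD(4)[OF Pf_ideal]
        by (intro CollectI exI[of _ 0] exI[of _ l]) (simp add: conv_zero)
    qed
    moreover have "f \<star> x \<in> ?Q"
      using f_in_projective left_idealD(4)[OF L(1)]
      by (intro CollectI exI[of _ f] exI[of _ 0]) simp
    ultimately show ?thesis
      using subquotient_maximal[OF left_ideal_orbit[OF L(1) Pf_ideal xA]]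
        orbit[OF left_idealD(2)[OF Pf_ideal]] x(2) by blast
  qed
  have surj: "\<exists>y \<in> carrier (P f). \<exists>l \<in> L. u = l + y \<star> x" if u: "u \<in> N" for u
  proof -
    have "u \<in> ?Q" using u \<open>N = ?Q\<close> by simp
    then obtain y l where "u = y \<star> x + l" "y \<in> carrier (P f)" "l \<in> L" by blast
    then show ?thesis
      by (intro bexI[of _ y] bexI[of _ l]) (simp_all add: add.commute)
  qed
  show "module_isomorphic CD (subquotient (P g) N L) S"
    unfolding subquotient_def simple_category_module_eq
  proof (rule M.module_isomorphic_quotients[where h = "\<lambda>y. y \<star> x"])
    show "submodule_of radical CD (P f)" by (rule submodule_of_radical)
    show "y \<star> x \<in> L \<longleftrightarrow> y \<in> radical" if "y \<in> carrier (P f)" for y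
      using that K R by auto
  qed (use surj left_idealD(3)[OF N(1)] left_idealD(2)[OF Pf_ideal] x(1) xA in
      \<open>auto simp: conv_add conv_assoc subset_iff\<close>)
qed

text \<open>If \<open>f x\<close> is outside \<open>L\<close>, then \<open>N = A f x + L\<close> by maximality of \<open>L\<close>, and multiplying by \<open>f\<close> gives
  \<open>f N = f A f x + f L\<close>, where \<open>f A f x\<close> is the line through \<open>f x\<close>. Otherwise \<open>f N = f L\<close>, because \<open>f\<close>
  is idempotent.\<close>

lemma dim_subquotient:
  "cvec.dim ((\<lambda>x. f \<star> x) ` N) = cvec.dim ((\<lambda>x. f \<star> x) ` L) +
    (if \<exists>x \<in> N. f \<star> x \<notin> L then 1 else 0)"
proof (cases "\<exists>x \<in> N. f \<star> x \<notin> L")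
  case False
  have "f \<star> x \<in> (\<lambda>x. f \<star> x) ` L" if "x \<in> N" for x
  proof -
    have "f \<star> x = f \<star> (f \<star> x)"
      using that left_idealD(2)[OF N(1)] f_arr_space f_idem conv_assoc[of f f x] by auto
    then show ?thesis
      using False that by blast
  qed
  then have "(\<lambda>x. f \<star> x) ` N = (\<lambda>x. f \<star> x) ` L"
    using L(2) by auto
  then show ?thesis
    using False by simp
next
  case True
  then obtain x where x: "x \<in> N" "f \<star> x \<notin> L" by blast
  have xA: "x \<in> A" and fxA: "f \<star> x \<in> A"
    using x(1) left_idealD(2)[OF N(1)] f_arr_space by (auto intro: conv_arr_space)
  let ?fL = "(\<lambda>x. f \<star> x) ` L" and ?fN = "(\<lambda>x. f \<star> x) ` N"
  interpret lin: Vector_Spaces.linear cscale cscale "\<lambda>x. f \<star> x"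
    by (rule clinear_conv_right)
  have fL: "cvec.subspace ?fL" "?fL \<subseteq> L"
    using left_idealD[OF L(1)] f_arr_space lin.subspace_image by auto
  have fN: "cvec.subspace ?fN" "?fN \<subseteq> N"
    using left_idealD[OF N(1)] f_arr_space lin.subspace_image by auto
  let ?Q = "{y \<star> (f \<star> x) + l | y l. y \<in> A \<and> l \<in> L}"
  have A_ideal: "left_ideal A"
    by (rule left_idealI) (auto simp: arr_space_closed conv_arr_space)
  have Q1: "L \<subseteq> ?Q"
  proof
    fix l assume "l \<in> L"
    then show "l \<in> ?Q"
      by (intro CollectI exI[of _ 0] exI[of _ l]) (simp add: conv_zero arr_space_closed)
  qed
  have Q2: "?Q \<subseteq> N"
    using x(1) L(2) left_idealD(3,5)[OF N(1)] f_arr_space by auto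
  have "f \<star> (f \<star> x) \<in> ?Q"
    using f_arr_space left_idealD(4)[OF L(1)] by (intro CollectI exI[of _ f] exI[of _ 0]) simp
  moreover have "f \<star> (f \<star> x) = f \<star> x"
    using f_arr_space xA f_idem conv_assoc[of f f x] by simp
  ultimately have "f \<star> x \<in> ?Q" by simp
  then have "?Q \<noteq> L" using x(2) by blast
  then have Q: "?Q = N"
    using subquotient_maximal[OF left_ideal_orbit[OF L(1) A_ideal fxA] Q1 Q2] by blast
  have "?fN \<subseteq> cvec.span (insert (f \<star> x) ?fL)"
  proof
    fix u assume "u \<in> ?fN"
    then obtain y l where yl: "u = f \<star> (y \<star> (f \<star> x) + l)" "y \<in> A" "l \<in> L"
      using Q by blast
    obtain z where z: "f \<star> y \<star> f = cscale z f"
      using corner_coeff_arr_space[OF yl(2)] by blast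
    have "f \<star> (y \<star> (f \<star> x)) = f \<star> y \<star> f \<star> x"
      using yl(2) xA f_arr_space by (simp add: conv_assoc conv_arr_space)
    then have "u = cscale z (f \<star> x) + f \<star> l"
      using yl(1) by (simp add: z conv_add conv_cscale)
    then show "u \<in> cvec.span (insert (f \<star> x) ?fL)"
      using yl(3) by (auto intro!: cvec.span_add cvec.span_scale intro: cvec.span_base)
  qed
  then have "cvec.span (insert (f \<star> x) ?fL) = ?fN"
    using x(1) L(2) by (intro antisym cvec.span_minimal[OF _ fN(1)]) auto
  then have "cvec.dim ?fN = cvec.dim (insert (f \<star> x) ?fL)"
    by (metis cvec.dim_span)
  also have "\<dots> = Suc (cvec.dim ?fL)"
  proof (rule dim_insert_new[OF _ finite_basis_elts])
    show "?fL \<subseteq> cvec.span (basis_elt ` Arr \<D>)"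
      using fL(2) left_ideal_span[OF L(1)] by auto
    show "f \<star> x \<notin> cvec.span ?fL"
      using fL(2) x(2) cvec.span_minimal[OF subset_refl fL(1)] by blast
  qed
  finally show ?thesis
    using True by simp
qed

end

end

context finite_EI_category
begin

text \<open>A proper submodule of greatest dimension is maximal, and has a series by induction.\<close>

lemma composition_series_exists:
  assumes g: "g \<in> A" "g \<star> g = g"
  shows "\<exists>Ns. composition_series CD (P g) Ns"
proof -
  interpret left_module CD "P g" using g by (rule left_module_projective)
  have sub_of: "submodule_of L CD ((P g)\<lparr>carrier := N\<rparr>)"
    if "submodule N CD (P g)" "submodule L CD (P g)" "L \<subseteq> N" for L N
    using that left_module_sub[OF that(1)] submodule_of_sub[OF that(1)]
    by (simp add: submodule_of_def submodule_of_axioms_def)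
  have "\<exists>Ns. Ns \<noteq> [] \<and> hd Ns = {0} \<and> last Ns = N \<and> (\<forall>N \<in> set Ns. submodule N CD (P g)) \<and>
    (\<forall>k. Suc k < length Ns \<longrightarrow>
      Ns ! k \<subseteq> Ns ! Suc k \<and> simple_module CD (subquotient (P g) (Ns ! Suc k) (Ns ! k)))"
    if "submodule N CD (P g)" for N
    using that
  proof (induction "cvec.dim N" arbitrary: N rule: less_induct)
    case less
    have N: "left_ideal N" "N \<subseteq> carrier (P g)"
      using less.prems submodule_projective_iff[OF g] by auto
    show ?case
    proof (cases "N = {0}")
      case True
      then show ?thesis
        using less.prems by (intro exI[of _ "[{0}]"]) simp
    next
      case False
      let ?C = "\<lambda>L. submodule L CD (P g) \<and> L \<subset> N"
      have dim: "cvec.dim L < cvec.dim N" if "?C L" for L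
        using that dim_strict_mono[of L N, OF _ _ left_ideal_span[OF N(1)] finite_basis_elts]
          submodule_projective_iff[OF g] left_idealD(1) by blast
      have "?C {0}"
        using False left_idealD(4)[OF N(1)] N(2) left_idealD(4)[OF left_ideal_projective[OF g]]
        by (auto simp: submodule_iff conv_zero)
      then obtain L where L: "?C L" and max: "\<And>K. ?C K \<Longrightarrow> cvec.dim K \<le> cvec.dim L"
        using ex_has_greatest_nat[of ?C "{0}" cvec.dim "cvec.dim N"] dim less_imp_le_nat by metis
      have "maximal_submodule L CD ((P g)\<lparr>carrier := N\<rparr>)"
        unfolding maximal_submodule_def submodule_of_sub[OF less.prems]
      proof (intro conjI allI impI)
        show "L \<noteq> carrier ((P g)\<lparr>carrier := N\<rparr>)" using L by auto
        fix K assume K: "(submodule K CD (P g) \<and> K \<subseteq> N) \<and> L \<subseteq> K"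
        show "K = L \<or> K = carrier ((P g)\<lparr>carrier := N\<rparr>)"
        proof (rule ccontr)
          assume "\<not> (K = L \<or> K = carrier ((P g)\<lparr>carrier := N\<rparr>))"
          then have "?C K" "L \<subset> K" using K by auto
          moreover have "left_ideal K" "left_ideal L"
            using K L submodule_projective_iff[OF g] by auto
          ultimately show False
            using max[of K] dim_strict_mono[of L K, OF left_idealD(1) _ left_ideal_span finite_basis_elts]
            by auto
        qed
      qed (use L in auto)
      then have simple: "simple_module CD (subquotient (P g) N L)"
        using submodule_of.simple_quotient_iff[OF sub_of[OF less.prems, of L]] L
        by (auto simp: subquotient_def)
      obtain Ns where Ns: "Ns \<noteq> []" "hd Ns = {0}" "last Ns = L"
        "\<forall>N \<in> set Ns. submodule N CD (P g)"
        "\<forall>k. Suc k < length Ns \<longrightarrow>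
          Ns ! k \<subseteq> Ns ! Suc k \<and> simple_module CD (subquotient (P g) (Ns ! Suc k) (Ns ! k))"
        using less.hyps[OF dim[OF L]] L by blast
      have "(Ns @ [N]) ! k \<subseteq> (Ns @ [N]) ! Suc k \<and>
          simple_module CD (subquotient (P g) ((Ns @ [N]) ! Suc k) ((Ns @ [N]) ! k))"
        if k: "Suc k < length (Ns @ [N])" for k
      proof (cases "Suc k = length Ns")
        case True
        then have "Ns ! k = L"
          using Ns(1,3) by (metis diff_Suc_1 last_conv_nth)
        then show ?thesis
          using True L simple by (auto simp: nth_append)
      next
        case False
        then show ?thesis
          using k Ns(5) by (simp add: nth_append)
      qed
      then show ?thesis
        using Ns less.prems by (intro exI[of _ "Ns @ [N]"]) simp
    qed
  qed
  from this[of "carrier (P g)"] show ?thesis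
    using left_module_axioms left_ideal_projective[OF g] submodule_projective_iff[OF g]
    by (auto simp: composition_series_def)
qed

end

text \<open>Along a composition series, the dimension of \<open>f N\<close> grows by one exactly at the factors
  isomorphic to \<open>S\<close>.\<close>

theorem (in primitive_in_category) jordan_hoelder_multiplicity_projective:
  assumes g: "g \<in> A" "g \<star> g = g"
  shows "jordan_hoelder_multiplicity CD (P g) S (cvec.dim ((\<lambda>x. f \<star> x) ` carrier (P g)))"
  unfolding jordan_hoelder_multiplicity_def
proof (intro conjI allI impI composition_series_exists[OF g])
  fix Ns assume Ns: "composition_series CD (P g) Ns"
  let ?iso = "\<lambda>k. module_isomorphic CD (subquotient (P g) (Ns ! Suc k) (Ns ! k)) S"
  have ideal: "left_ideal (Ns ! k)" "Ns ! k \<subseteq> carrier (P g)" if "k < length Ns" for k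
    using Ns that submodule_projective_iff[OF g] by (auto simp: composition_series_def)
  have "card {k'. k' < k \<and> ?iso k'} = cvec.dim ((\<lambda>x. f \<star> x) ` (Ns ! k))" if "k < length Ns" for k
    using that
  proof (induction k)
    case 0
    have "Ns ! 0 = {0}"
      using Ns hd_conv_nth[of Ns] by (auto simp: composition_series_def)
    then show ?case
      using cvec.dim_le_card[of "{0}" "{}"] by (simp add: conv_zero)
  next
    case (Suc k)
    have step: "Ns ! k \<subseteq> Ns ! Suc k" "simple_module CD (subquotient (P g) (Ns ! Suc k) (Ns ! k))"
      using Ns Suc.prems by (auto simp: composition_series_def)
    have "{k'. k' < Suc k \<and> ?iso k'} = {k'. k' < k \<and> ?iso k'} \<union> (if ?iso k then {k} else {})"
      by (auto simp: less_Suc_eq)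
    then have "card {k'. k' < Suc k \<and> ?iso k'} = card {k'. k' < k \<and> ?iso k'} + (if ?iso k then 1 else 0)"
      by auto
    then show ?case
      using Suc dim_subquotient[OF g ideal[OF Suc.prems] ideal(1) step]
        subquotient_isomorphic_iff[OF g ideal[OF Suc.prems] ideal(1) step] by simp
  qed
  moreover have "Ns \<noteq> []" "last Ns = carrier (P g)"
    using Ns by (auto simp: composition_series_def)
  ultimately have "card {k. k < length Ns - 1 \<and> ?iso k} = cvec.dim ((\<lambda>x. f \<star> x) ` carrier (P g))"
    by (simp add: last_conv_nth)
  moreover have "{k. k < length Ns - 1 \<and> ?iso k} = {k. Suc k < length Ns \<and> ?iso k}"
    by auto
  ultimately show "card {k. Suc k < length Ns \<and> ?iso k} = cvec.dim ((\<lambda>x. f \<star> x) ` carrier (P g))"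
    by simp
qed

section \<open>Decomposing the bimodule of morphisms\<close>

lemma hom_bimodule_simps [simp]:
  "carrier (hom_bimodule \<D> a b) = hom_space \<D> a b"
  "\<zero>\<^bsub>hom_bimodule \<D> a b\<^esub> = 0"
  "x \<oplus>\<^bsub>hom_bimodule \<D> a b\<^esub> y = x + y"
  "r \<odot>\<^bsub>hom_bimodule \<D> a b\<^esub> x = conv \<D> r x"
  "bi_rsmult (hom_bimodule \<D> a b) x s = conv \<D> x s"
  by (simp_all add: hom_bimodule_def hom_space_def)

lemma finsum_eq_sum:
  fixes M :: "('v::comm_monoid_add, 't) ring_scheme"
  assumes "abelian_monoid M" and M: "\<And>x y. x \<oplus>\<^bsub>M\<^esub> y = x + y" "\<zero>\<^bsub>M\<^esub> = 0"
    and "finite X" "\<And>N. N \<in> X \<Longrightarrow> g N \<in> carrier M"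
  shows "(\<Oplus>\<^bsub>M\<^esub>N \<in> X. g N) = (\<Sum>N \<in> X. g N)"
proof -
  interpret abelian_monoid M by fact
  show ?thesis
    using assms(4,5) by (induction X) (auto simp: M)
qed

definition (in finite_EI_category) biideal :: "'o \<Rightarrow> 'o \<Rightarrow> ('m \<Rightarrow>\<^sub>0 complex) set \<Rightarrow> bool"
  where "biideal a b N \<longleftrightarrow> cvec.subspace N \<and> N \<subseteq> H a b \<and>
    (\<forall>r \<in> H b b. \<forall>x \<in> N. r \<star> x \<in> N) \<and> (\<forall>s \<in> H a a. \<forall>x \<in> N. x \<star> s \<in> N)"

definition (in finite_EI_category) irreducible :: "'o \<Rightarrow> 'o \<Rightarrow> ('m \<Rightarrow>\<^sub>0 complex) set \<Rightarrow> bool"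
  where "irreducible a b N \<longleftrightarrow> biideal a b N \<and> N \<noteq> {0} \<and>
    (\<forall>L. biideal a b L \<and> L \<subseteq> N \<longrightarrow> L = {0} \<or> L = N)"

text \<open>Uniqueness of the components is replaced by the vanishing of the components of zero, which is
  easier to check for linear maps and amounts to the same for subspaces.\<close>

definition direct_summands :: "('k \<Rightarrow>\<^sub>0 complex) set \<Rightarrow> ('k \<Rightarrow>\<^sub>0 complex) set set \<Rightarrow> bool"
  where "direct_summands M X \<longleftrightarrow> finite X \<and>
    (\<forall>x \<in> M. \<exists>g. (\<forall>N \<in> X. g N \<in> N) \<and> x = (\<Sum>N \<in> X. g N)) \<and>
    (\<forall>g. (\<forall>N \<in> X. g N \<in> N) \<and> (\<Sum>N \<in> X. g N) = 0 \<longrightarrow> (\<forall>N \<in> X. g N = 0))"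

lemma direct_summandsD:
  assumes "direct_summands M X"
  shows "finite X" "x \<in> M \<Longrightarrow> \<exists>g. (\<forall>N \<in> X. g N \<in> N) \<and> x = (\<Sum>N \<in> X. g N)"
    "\<forall>N \<in> X. g N \<in> N \<Longrightarrow> (\<Sum>N \<in> X. g N) = 0 \<Longrightarrow> \<forall>N \<in> X. g N = 0"
  using assms by (simp_all add: direct_summands_def)

context finite_EI_category
begin

abbreviation CG where "CG \<equiv> group_algebra \<D>"

lemma biidealD:
  assumes "biideal a b N"
  shows "cvec.subspace N" "N \<subseteq> H a b" "\<And>r x. r \<in> H b b \<Longrightarrow> x \<in> N \<Longrightarrow> r \<star> x \<in> N"
    "\<And>s x. s \<in> H a a \<Longrightarrow> x \<in> N \<Longrightarrow> x \<star> s \<in> N"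
    "0 \<in> N" "\<And>x y. x \<in> N \<Longrightarrow> y \<in> N \<Longrightarrow> x + y \<in> N" "\<And>z x. x \<in> N \<Longrightarrow> cscale z x \<in> N"
  using assms by (auto simp: biideal_def cvec.subspace_def)

lemma biideal_hom_space: "biideal a b (H a b)"
  by (auto simp: biideal_def subspace_hom_space intro: conv_hom_space)

lemma scalar_group_algebra_left:
  "b \<in> Obj \<D> \<Longrightarrow> x \<in> H a b \<Longrightarrow> scalar_elt (CG b) z \<star> x = cscale z x"
  by (simp add: conv_cscale unit_left)

context
  fixes a b
  assumes ab: "a \<in> Obj \<D>" "b \<in> Obj \<D>"
begin

abbreviation M where "M \<equiv> hom_bimodule \<D> a b"

lemma bimodule_biideal:
  assumes N: "biideal a b N"
  shows "bimodule (CG b) (CG a) (M\<lparr>carrier := N\<rparr>)"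
proof -
  have NH: "x \<in> H a b" if "x \<in> N" for x
    using biidealD(2)[OF N] that by blast
  have assoc: "r \<star> s \<star> x = r \<star> (s \<star> x)"
    if "r \<in> H b c \<and> s \<in> H d b \<and> x \<in> H d' d" for r s x b c d d'
    using that hom_space_arr_space[of r] hom_space_arr_space[of s] hom_space_arr_space[of x]
    by (intro conv_assoc) auto
  have "\<exists>y \<in> N. y + x = 0" if "x \<in> N" for x
    using cvec.subspace_neg[OF biidealD(1)[OF N] that] by (intro bexI[of _ "- x"]) auto
  then have "abelian_group (M\<lparr>carrier := N\<rparr>)"
    by (intro abelian_groupI) (auto simp: biidealD[OF N] add_ac)
  then have "left_module (CG b) (M\<lparr>carrier := N\<rparr>)"
    using ab biidealD(3)[OF N] assoc[of _ b b _ b _ a] unit_left[of _ a b] NH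
    by (intro left_module.intro left_module_axioms.intro ring_group_algebra)
      (auto simp: conv_add)
  then show ?thesis
    using ab biidealD(4)[OF N] assoc[of _ a b _ a _ a] assoc[of _ b b _ a _ a]
      unit_left[of _ a b] unit_right[of _ a b] NH
    by (intro bimodule.intro bimodule_axioms.intro ring_group_algebra)
      (auto simp: conv_add conv_cscale)
qed

lemma sub_bimodule_iff:
  assumes N: "biideal a b N"
  shows "sub_bimodule L (CG b) (CG a) (M\<lparr>carrier := N\<rparr>) \<longleftrightarrow> biideal a b L \<and> L \<subseteq> N"
proof -
  interpret bimodule "CG b" "CG a" "M\<lparr>carrier := N\<rparr>"
    by (rule bimodule_biideal[OF N])
  have "cscale z x \<in> L" if "L \<subseteq> N" "\<forall>r \<in> H b b. \<forall>x \<in> L. r \<star> x \<in> L" "x \<in> L" for z x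
  proof -
    have "scalar_elt (CG b) z \<in> H b b"
      using ab unit_hom_space by (simp add: hom_space_closed)
    moreover have "x \<in> H a b"
      using that biidealD(2)[OF N] by blast
    ultimately show ?thesis
      using that(2,3) scalar_group_algebra_left[OF ab(2), of x a z] by metis
  qed
  then show ?thesis
    using biidealD(2)[OF N]
    by (auto simp: sub_bimodule_def submodule_iff biideal_def cvec.subspace_def)
qed

lemma irreducible_bimodule_iff:
  assumes N: "biideal a b N"
  shows "irreducible_bimodule (CG b) (CG a) (M\<lparr>carrier := N\<rparr>) \<longleftrightarrow> irreducible a b N"
  using bimodule_biideal[OF N] sub_bimodule_iff[OF N] N
  by (auto simp: irreducible_bimodule_def irreducible_def)

lemma irreducible_decomposition_iff:
  "irreducible_decomposition (CG b) (CG a) M X \<longleftrightarrow>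
    (\<forall>N \<in> X. irreducible a b N) \<and> direct_summands (H a b) X"
proof -
  have M: "M\<lparr>carrier := H a b\<rparr> = M"
    by (simp add: hom_bimodule_def hom_space_def)
  have bi: "bimodule (CG b) (CG a) M"
    using bimodule_biideal[OF biideal_hom_space] by (simp add: M)
  have sub: "sub_bimodule N (CG b) (CG a) M \<longleftrightarrow> biideal a b N" for N
    using sub_bimodule_iff[OF biideal_hom_space, of N] biidealD(2)[of a b N] by (auto simp: M)
  have sub_irr: "sub_bimodule N (CG b) (CG a) M \<and>
      irreducible_bimodule (CG b) (CG a) (M\<lparr>carrier := N\<rparr>) \<longleftrightarrow> irreducible a b N" for N
    using sub[of N] irreducible_bimodule_iff[of N] by (auto simp: irreducible_def)
  interpret bimodule "CG b" "CG a" M by (rule bi)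
  have finsum: "(\<Oplus>\<^bsub>M\<^esub>N \<in> X. g N) = (\<Sum>N \<in> X. g N)"
    if "finite X" and irr: "\<forall>N \<in> X. irreducible a b N" and g: "\<forall>N \<in> X. g N \<in> N" for g
  proof (rule finsum_eq_sum)
    show "abelian_monoid M" by (rule M.abelian_monoid_axioms)
    show "g N \<in> carrier M" if "N \<in> X" for N
    proof -
      have "biideal a b N" using irr that by (simp add: irreducible_def)
      then show ?thesis using biidealD(2)[of a b N] g that by auto
    qed
  qed (use \<open>finite X\<close> in simp_all)
  have "(\<forall>x \<in> H a b. \<exists>!g. g \<in> (\<Pi>\<^sub>E N \<in> X. N) \<and> x = (\<Oplus>\<^bsub>M\<^esub>N \<in> X. g N)) \<longleftrightarrow>
      direct_summands (H a b) X" if fin: "finite X" and irr: "\<forall>N \<in> X. irreducible a b N"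
  proof -
    have bi: "biideal a b N" if "N \<in> X" for N
      using irr that by (simp add: irreducible_def)
    have "(\<forall>x \<in> H a b. \<exists>!g. g \<in> (\<Pi>\<^sub>E N \<in> X. N) \<and> x = (\<Oplus>\<^bsub>M\<^esub>N \<in> X. g N)) \<longleftrightarrow>
        (\<forall>x \<in> H a b. \<exists>!g. g \<in> (\<Pi>\<^sub>E N \<in> X. N) \<and> x = (\<Sum>N \<in> X. g N))"
      using finsum[OF fin irr] by (intro ball_cong refl arg_cong[where f = Ex1] ext) (auto simp: PiE_def Pi_def)
    also have "\<dots> \<longleftrightarrow> direct_summands (H a b) X"
    proof
      assume unique: "\<forall>x \<in> H a b. \<exists>!g. g \<in> (\<Pi>\<^sub>E N \<in> X. N) \<and> x = (\<Sum>N \<in> X. g N)"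
      show "direct_summands (H a b) X"
        unfolding direct_summands_def
      proof (intro conjI ballI allI impI fin)
        fix x assume "x \<in> H a b"
        then obtain g where "g \<in> (\<Pi>\<^sub>E N \<in> X. N)" "x = (\<Sum>N \<in> X. g N)"
          using unique by blast
        then show "\<exists>g. (\<forall>N \<in> X. g N \<in> N) \<and> x = (\<Sum>N \<in> X. g N)"
          by (intro exI[of _ g]) auto
      next
        fix g N assume g: "(\<forall>N \<in> X. g N \<in> N) \<and> (\<Sum>N \<in> X. g N) = 0" and N: "N \<in> X"
        have zero: "0 \<in> H a b" by (rule hom_space_closed)
        have r1: "restrict g X \<in> (\<Pi>\<^sub>E N \<in> X. N) \<and> 0 = (\<Sum>N \<in> X. restrict g X N)"
          using g by (auto intro: sum.cong)
        have r2: "(\<lambda>N \<in> X. 0) \<in> (\<Pi>\<^sub>E N \<in> X. N) \<and> 0 = (\<Sum>N \<in> X. (\<lambda>N \<in> X. 0) N)"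
          using biidealD(5)[OF bi] by auto
        have "restrict g X = (\<lambda>N \<in> X. 0)"
          using the1_equality[OF bspec[OF unique zero], OF r1] the1_equality[OF bspec[OF unique zero], OF r2]
          by simp
        then show "g N = 0"
          using N by (metis restrict_apply')
      qed
    next
      assume direct: "direct_summands (H a b) X"
      show "\<forall>x \<in> H a b. \<exists>!g. g \<in> (\<Pi>\<^sub>E N \<in> X. N) \<and> x = (\<Sum>N \<in> X. g N)"
      proof
        fix x assume "x \<in> H a b"
        then obtain g where g: "\<forall>N \<in> X. g N \<in> N" "x = (\<Sum>N \<in> X. g N)"
          using direct_summandsD(2)[OF direct] by blast
        show "\<exists>!g. g \<in> (\<Pi>\<^sub>E N \<in> X. N) \<and> x = (\<Sum>N \<in> X. g N)"
        proof (rule ex1I[of _ "restrict g X"])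
          show "restrict g X \<in> (\<Pi>\<^sub>E N \<in> X. N) \<and> x = (\<Sum>N \<in> X. restrict g X N)"
            using g by (auto intro: sum.cong)
          fix h assume h: "h \<in> (\<Pi>\<^sub>E N \<in> X. N) \<and> x = (\<Sum>N \<in> X. h N)"
          have "\<forall>N \<in> X. h N - g N \<in> N"
            using h g(1) cvec.subspace_diff[OF biidealD(1)[OF bi]] by (auto simp: PiE_def Pi_def)
          moreover have "(\<Sum>N \<in> X. h N - g N) = 0"
            using h g(2) by (simp add: sum_subtractf)
          ultimately have "\<forall>N \<in> X. h N - g N = 0"
            by (rule direct_summandsD(3)[OF direct])
          then show "h = restrict g X"
            using h by (intro extensionalityI[of h X]) (auto simp: PiE_def)
        qed
      qed
    qed
    finally show ?thesis .
  qed
  then show ?thesis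
    using bi direct_summandsD(1)[of "H a b" X]
    unfolding irreducible_decomposition_def sub_irr hom_bimodule_simps by blast
qed

text \<open>A nonzero sub-bimodule of least dimension is irreducible, and the kernel of an equivariant
  projection onto it is a complement of smaller dimension.\<close>

lemma decomposition_exists:
  assumes "biideal a b N"
  shows "\<exists>X. (\<forall>U \<in> X. irreducible a b U \<and> U \<subseteq> N) \<and> direct_summands N X"
  using assms
proof (induction "cvec.dim N" arbitrary: N rule: less_induct)
  case less
  note N = biidealD[OF less.prems]
  show ?case
  proof (cases "N = {0}")
    case True
    then show ?thesis
      by (intro exI[of _ "{}"]) (simp add: direct_summands_def)
  next
    case False
    let ?C = "\<lambda>U. biideal a b U \<and> U \<subseteq> N \<and> U \<noteq> {0}"
    have fin: "finite (basis_elt ` hom_set \<D> a b)"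
      using finite_hom_set by simp
    have span: "U \<subseteq> cvec.span (basis_elt ` hom_set \<D> a b)" if "biideal a b U" for U
      using biidealD(2)[OF that] hom_space_span by blast
    have "?C N" using False less.prems by simp
    then obtain U where U: "?C U" and least: "\<And>V. ?C V \<Longrightarrow> cvec.dim U \<le> cvec.dim V"
      using ex_has_least_nat[of ?C N cvec.dim] by metis
    note UD = biidealD[OF conjunct1[OF U]]
    have irr: "irreducible a b U"
      unfolding irreducible_def
    proof (intro conjI allI impI)
      fix L assume L: "biideal a b L \<and> L \<subseteq> U"
      show "L = {0} \<or> L = U"
      proof (rule ccontr)
        assume "\<not> (L = {0} \<or> L = U)"
        then have "?C L" "L \<subset> U"
          using L U by auto
        then show False
          using least[of L] dim_strict_mono[of L U, OF _ _ span fin] biidealD(1)[of a b L] U by auto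
      qed
    qed (use U in auto)
    obtain \<pi> where \<pi>: "clinear \<pi>" "\<And>x. \<pi> x \<in> U" "\<And>x. x \<in> U \<Longrightarrow> \<pi> x = x"
      "\<And>r x. r \<in> H b b \<Longrightarrow> x \<in> H a b \<Longrightarrow> \<pi> (r \<star> x) = r \<star> \<pi> x"
      "\<And>s x. s \<in> H a a \<Longrightarrow> x \<in> H a b \<Longrightarrow> \<pi> (x \<star> s) = \<pi> x \<star> s"
      by (rule two_sided_equivariant_projection[OF ab UD(1-4)], assumption+, rule that)
    let ?K = "{x \<in> N. \<pi> x = 0}"
    have NH: "x \<in> H a b" if "x \<in> N" for x
      using that N(2) by blast
    have K: "biideal a b ?K"
      unfolding biideal_def cvec.subspace_def
      using N(3-7) NH by (auto simp: clinearD[OF \<pi>(1)] \<pi>(4,5) conv_zero)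
    obtain u where u: "u \<in> U" "u \<noteq> 0"
      using U UD(5) by blast
    then have "u \<notin> ?K" "u \<in> N"
      using \<pi>(3)[of u] U by auto
    then have "cvec.dim ?K < cvec.dim N"
      using dim_strict_mono[OF biidealD(1)[OF K] _ span[OF less.prems] fin] by blast
    then obtain X where X: "\<forall>V \<in> X. irreducible a b V \<and> V \<subseteq> ?K" "direct_summands ?K X"
      using less.hyps[OF _ K] by blast
    have finX: "finite X"
      using X(2) by (simp add: direct_summands_def)
    have UX: "U \<notin> X"
      using X(1) u \<open>u \<notin> ?K\<close> by blast
    have "direct_summands N (insert U X)"
      unfolding direct_summands_def
    proof (intro conjI ballI allI impI)
      fix x assume x: "x \<in> N"
      have "x - \<pi> x \<in> N"
        using x \<pi>(2)[of x] U by (intro cvec.subspace_diff[OF N(1)]) auto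
      moreover have "\<pi> (x - \<pi> x) = 0"
        using \<pi>(3)[OF \<pi>(2)] by (simp add: clinearD(5)[OF \<pi>(1)])
      ultimately obtain g where g: "\<forall>V \<in> X. g V \<in> V" "x - \<pi> x = (\<Sum>V \<in> X. g V)"
        using direct_summandsD(2)[OF X(2), of "x - \<pi> x"] by blast
      have "(\<Sum>V \<in> X. (g(U := \<pi> x)) V) = (\<Sum>V \<in> X. g V)"
        using UX by (intro sum.cong) auto
      then have "x = (\<Sum>V \<in> insert U X. (g(U := \<pi> x)) V)"
        using finX UX g(2)[symmetric] by simp
      moreover have "\<forall>V \<in> insert U X. (g(U := \<pi> x)) V \<in> V"
        using g(1) \<pi>(2) by auto
      ultimately show "\<exists>g. (\<forall>V \<in> insert U X. g V \<in> V) \<and> x = (\<Sum>V \<in> insert U X. g V)"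
        by blast
    next
      fix g V assume g: "(\<forall>V \<in> insert U X. g V \<in> V) \<and> (\<Sum>V \<in> insert U X. g V) = 0" and V: "V \<in> insert U X"
      have sum: "g U + (\<Sum>V \<in> X. g V) = 0"
        using g finX UX by simp
      have "\<pi> (g V) = 0" if "V \<in> X" for V
        using g X(1) that by blast
      then have "\<pi> (g U + (\<Sum>V \<in> X. g V)) = g U"
        using g \<pi>(3) by (simp add: clinearD[OF \<pi>(1)])
      then have gU: "g U = 0"
        using sum by (simp add: clinearD[OF \<pi>(1)])
      then have "(\<Sum>V \<in> X. g V) = 0"
        using sum by simp
      then have "\<forall>V \<in> X. g V = 0"
        using direct_summandsD(3)[OF X(2), of g] g by simp
      then show "g V = 0"
        using V gU by auto
    qed (use finX in simp)
    moreover have "irreducible a b V \<and> V \<subseteq> N" if "V \<in> insert U X" for V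
      using that irr U X(1) by blast
    ultimately show ?thesis by blast
  qed
qed

end

end

locale primitive_pair = finite_EI_category \<D> +
  a: primitive_in_category \<D> a e + b: primitive_in_category \<D> b f
  for \<D> :: "('o, 'm) cat" and a e b f
begin

abbreviation corner ("\<gamma>") where "\<gamma> x \<equiv> f \<star> x \<star> e"

lemma clinear_corner: "clinear \<gamma>"
  by (simp add: clinear_iff conv_add conv_cscale)

lemma corner_in_biideal: "biideal a b N \<Longrightarrow> x \<in> N \<Longrightarrow> \<gamma> x \<in> N"
  using biidealD(3,4) a.f_hom_space b.f_hom_space by blast

lemma corner_idem:
  assumes x: "x \<in> H a b" shows "\<gamma> (\<gamma> x) = \<gamma> x"
proof -
  note A = hom_space_arr_space[OF x] a.f_arr_space b.f_arr_space
  have "\<gamma> (\<gamma> x) = (f \<star> f) \<star> x \<star> (e \<star> e)"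
    using A by (simp only: conv_assoc conv_arr_space)
  then show ?thesis by (simp add: a.f_idem b.f_idem)
qed

lemma corner_fixed:
  assumes t: "t \<in> H a b" "\<gamma> t = t"
  shows "f \<star> t = t" "t \<star> e = t"
proof -
  note A = hom_space_arr_space[OF t(1)] a.f_arr_space b.f_arr_space
  have "f \<star> \<gamma> t = (f \<star> f) \<star> t \<star> e"
    using A by (simp only: conv_assoc conv_arr_space)
  then show "f \<star> t = t"
    unfolding b.f_idem t(2) .
  have "\<gamma> t \<star> e = f \<star> t \<star> (e \<star> e)"
    using A by (simp only: conv_assoc conv_arr_space)
  then show "t \<star> e = t"
    unfolding a.f_idem t(2) .
qed

text \<open>An irreducible bimodule is generated by any nonzero \<open>t\<close> in its corner, and
  \<open>f (r t s) e\<close> is the scalar multiple \<open>(f r f) t (e s e)\<close> of \<open>t\<close>.\<close>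

lemma irreducible_corner:
  assumes N: "irreducible a b N" and t: "t \<in> N" "\<gamma> t = t" "t \<noteq> 0" and x: "x \<in> N"
  shows "\<gamma> x \<in> cvec.span {t}"
proof -
  have bi: "biideal a b N" using N by (simp add: irreducible_def)
  note ND = biidealD[OF bi]
  have tH: "t \<in> H a b" using t(1) ND(2) by blast
  note tA = hom_space_arr_space[OF tH]
  let ?G = "{r \<star> t \<star> s | r s. r \<in> H b b \<and> s \<in> H a a}"
  let ?W = "cvec.span ?G"
  have "?W \<subseteq> N"
    by (rule cvec.span_minimal[OF _ ND(1)]) (use t(1) ND(3,4) in blast)
  moreover have "r' \<star> w \<in> ?W" if w: "w \<in> ?W" and r': "r' \<in> H b b" for r' w
  proof -
    have "cvec.subspace {w. r' \<star> w \<in> ?W}"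
      using cvec.subspace_span[of ?G] by (auto simp: cvec.subspace_def conv_add conv_cscale conv_zero)
    moreover have "?G \<subseteq> {w. r' \<star> w \<in> ?W}"
    proof clarify
      fix r s assume rs: "r \<in> H b b" "s \<in> H a a"
      have "r' \<star> (r \<star> t \<star> s) = (r' \<star> r) \<star> t \<star> s"
        using tA hom_space_arr_space[OF rs(1)] hom_space_arr_space[OF rs(2)] hom_space_arr_space[OF r']
        by (simp add: conv_assoc conv_arr_space)
      moreover have "r' \<star> r \<in> H b b" using r' rs by (intro conv_hom_space)
      ultimately show "r' \<star> (r \<star> t \<star> s) \<in> ?W"
        using rs by (intro cvec.span_base) blast
    qed
    ultimately show ?thesis
      using cvec.span_minimal w by blast
  qed
  moreover have "w \<star> s' \<in> ?W" if w: "w \<in> ?W" and s': "s' \<in> H a a" for s' w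
  proof -
    have "cvec.subspace {w. w \<star> s' \<in> ?W}"
      using cvec.subspace_span[of ?G] by (auto simp: cvec.subspace_def conv_add conv_cscale conv_zero)
    moreover have "?G \<subseteq> {w. w \<star> s' \<in> ?W}"
    proof clarify
      fix r s assume rs: "r \<in> H b b" "s \<in> H a a"
      have "(r \<star> t \<star> s) \<star> s' = r \<star> t \<star> (s \<star> s')"
        using tA hom_space_arr_space[OF rs(1)] hom_space_arr_space[OF rs(2)] hom_space_arr_space[OF s']
        by (simp add: conv_assoc conv_arr_space)
      moreover have "s \<star> s' \<in> H a a" using s' rs by (intro conv_hom_space)
      ultimately show "(r \<star> t \<star> s) \<star> s' \<in> ?W"
        using rs by (intro cvec.span_base) blast
    qed
    ultimately show ?thesis
      using cvec.span_minimal w by blast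
  qed
  ultimately have "biideal a b ?W"
    using ND(2) cvec.subspace_span by (auto simp: biideal_def)
  moreover have "t \<in> ?W"
    using a.f_hom_space b.f_hom_space t(2) by (intro cvec.span_base) force
  ultimately have "?W = N"
    using N t(3) \<open>?W \<subseteq> N\<close> by (auto simp: irreducible_def)
  moreover have "cvec.subspace {w. \<gamma> w \<in> cvec.span {t}}"
    using cvec.subspace_span[of "{t}"] by (auto simp: cvec.subspace_def conv_add conv_cscale conv_zero)
  moreover have "?G \<subseteq> {w. \<gamma> w \<in> cvec.span {t}}"
  proof clarify
    fix r s assume rs: "r \<in> H b b" "s \<in> H a a"
    note A = hom_space_arr_space[OF rs(1)] hom_space_arr_space[OF rs(2)]
    have "\<gamma> (r \<star> (f \<star> t \<star> e) \<star> s) = (f \<star> r \<star> f) \<star> t \<star> (e \<star> s \<star> e)"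
      using A tA a.f_arr_space b.f_arr_space by (simp only: conv_assoc conv_arr_space)
    also have "\<dots> = cscale (b.corner_coeff r * a.corner_coeff s) t"
      using b.corner_coeff[OF rs(1)] a.corner_coeff[OF rs(2)] t(2) by (simp add: conv_cscale mult.commute)
    finally show "\<gamma> (r \<star> t \<star> s) \<in> cvec.span {t}"
      using t(2) by (simp add: cvec.span_base cvec.span_scale)
  qed
  ultimately show ?thesis
    using cvec.span_minimal[of ?G "{w. \<gamma> w \<in> cvec.span {t}}"] x by blast
qed

text \<open>Each irreducible summand has a corner of dimension zero or one, so choosing a nonzero corner
  element in every summand that has one gives a basis of the whole corner.\<close>

lemma card_corner_summands:
  assumes X: "direct_summands (H a b) X" "\<forall>N \<in> X. irreducible a b N"
  shows "card {N \<in> X. \<exists>x \<in> N. \<gamma> x \<noteq> 0} = cvec.dim (\<gamma> ` H a b)"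
proof -
  let ?Y = "{N \<in> X. \<exists>x \<in> N. \<gamma> x \<noteq> 0}"
  have fin: "finite X" using X(1) by (simp add: direct_summands_def)
  have bi: "biideal a b N" if "N \<in> X" for N
    using X(2) that by (simp add: irreducible_def)
  have XH: "x \<in> H a b" if "x \<in> N" "N \<in> X" for x N
    using biidealD(2)[OF bi[OF that(2)]] that(1) by blast
  have indep: "\<forall>N \<in> X. g N = 0" if "\<forall>N \<in> X. g N \<in> N" "(\<Sum>N \<in> X. g N) = 0" for g
    using direct_summandsD(3)[OF X(1) that] .
  have ex: "\<forall>N \<in> ?Y. \<exists>t. t \<in> N \<and> \<gamma> t = t \<and> t \<noteq> 0"
  proof
    fix N assume N: "N \<in> ?Y"
    obtain x where x: "x \<in> N" "\<gamma> x \<noteq> 0" "N \<in> X" using N by blast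
    then show "\<exists>t. t \<in> N \<and> \<gamma> t = t \<and> t \<noteq> 0"
      using corner_in_biideal[OF bi[OF x(3)] x(1)] corner_idem[OF XH[OF x(1,3)]]
      by (intro exI[of _ "\<gamma> x"]) simp
  qed
  obtain t where "\<forall>N \<in> ?Y. t N \<in> N \<and> \<gamma> (t N) = t N \<and> t N \<noteq> 0"
    using bchoice[OF ex] by (rule exE)
  then have t: "t N \<in> N \<and> \<gamma> (t N) = t N \<and> t N \<noteq> 0" if "N \<in> ?Y" for N
    using that by (rule bspec)
  have scalars: "\<forall>N \<in> ?Y. u N = 0" if "(\<Sum>N \<in> ?Y. cscale (u N) (t N)) = 0" for u
  proof
    fix N assume N: "N \<in> ?Y"
    let ?g = "\<lambda>N. if N \<in> ?Y then cscale (u N) (t N) else 0"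
    have "(\<Sum>N \<in> X. ?g N) = (\<Sum>N \<in> ?Y. cscale (u N) (t N))"
      using fin by (simp add: sum.inter_filter)
    moreover have "\<forall>N \<in> X. ?g N \<in> N"
      using t biidealD(5,7)[OF bi] by simp
    ultimately have "?g N = 0"
      using indep[of ?g] that N by (metis (no_types, lifting) mem_Collect_eq)
    then show "u N = 0"
      using N t[OF N] by simp
  qed
  have inj: "inj_on t ?Y"
  proof (rule inj_onI, rule ccontr)
    fix N N' assume NN: "N \<in> ?Y" "N' \<in> ?Y" "t N = t N'" "N \<noteq> N'"
    \<comment> \<open>A coincidence \<open>t N = t N'\<close> would be the relation \<open>t N - t N' = 0\<close>.\<close>
    let ?u = "\<lambda>U. if U = N then 1 else if U = N' then - 1 else 0 :: complex"
    have "(\<Sum>U \<in> ?Y. cscale (?u U) (t U)) = (\<Sum>U \<in> {N, N'}. cscale (?u U) (t U))"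
      using NN fin by (intro sum.mono_neutral_right) auto
    also have "\<dots> = 0"
      using NN(3,4) by simp
    finally have "?u N = 0"
      using scalars[of ?u] NN(1) by blast
    then show False by simp
  qed
  have "cvec.dim (\<gamma> ` H a b) = card (t ` ?Y)"
  proof (rule cvec.basis_card_eq_dim[symmetric])
    show "t ` ?Y \<subseteq> \<gamma> ` H a b"
    proof clarify
      fix N x assume "N \<in> X" "x \<in> N" "\<gamma> x \<noteq> 0"
      then have "N \<in> ?Y" by blast
      then show "t N \<in> \<gamma> ` H a b"
        using t[of N] XH[of "t N" N] \<open>N \<in> X\<close> by (intro image_eqI[of _ _ "t N"]) simp_all
    qed
    show "cvec.independent (t ` ?Y)"
    proof (rule cvec.independent_if_scalars_zero)
      show "finite (t ` ?Y)" using fin by simp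
      fix u x assume "(\<Sum>x \<in> t ` ?Y. cscale (u x) x) = 0" and x: "x \<in> t ` ?Y"
      then have "(\<Sum>N \<in> ?Y. cscale (u (t N)) (t N)) = 0"
        by (simp add: sum.reindex[OF inj])
      then show "u x = 0"
        using scalars[of "\<lambda>N. u (t N)"] x by blast
    qed
    show "\<gamma> ` H a b \<subseteq> cvec.span (t ` ?Y)"
    proof
      fix y assume "y \<in> \<gamma> ` H a b"
      then obtain x where x: "y = \<gamma> x" "x \<in> H a b" by blast
      then obtain g where g: "\<forall>N \<in> X. g N \<in> N" "x = (\<Sum>N \<in> X. g N)"
        using direct_summandsD(2)[OF X(1)] by blast
      have "\<gamma> (g N) \<in> cvec.span (t ` ?Y)" if N: "N \<in> X" for N
      proof (cases "N \<in> ?Y")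
        case True
        then have "\<gamma> (g N) \<in> cvec.span {t N}"
          using irreducible_corner[of N "t N" "g N"] t[OF True] X(2) g(1) N by blast
        also have "\<dots> \<subseteq> cvec.span (t ` ?Y)"
          using True by (intro cvec.span_mono) blast
        finally show ?thesis .
      next
        case False
        then have "\<gamma> (g N) = 0" using N g(1) by blast
        then show ?thesis by (simp add: cvec.span_zero)
      qed
      moreover have "y = (\<Sum>N \<in> X. \<gamma> (g N))"
        unfolding x(1) g(2) using clinearD(4)[OF clinear_corner, of g X] by simp
      ultimately show "y \<in> cvec.span (t ` ?Y)"
        by (simp add: cvec.span_sum)
    qed
  qed
  then show ?thesis
    by (simp add: card_image[OF inj])
qed

end

section \<open>The tensor product of a simple module and a dual simple module\<close>

context primitive_in_category
begin

abbreviation S\<^sub>0 where "S\<^sub>0 \<equiv> simple_group_module \<D> c f"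

lemma simple_group_module_simps [simp]:
  "x \<oplus>\<^bsub>S\<^sub>0\<^esub> y = x + y" "r \<odot>\<^bsub>S\<^sub>0\<^esub> x = r \<star> x"
  by (simp_all add: simple_group_module_def left_ideal_module_def)

lemma carrier_simple_group_module: "carrier S\<^sub>0 = {x \<in> H c c. x \<star> f = x}"
proof -
  have "x \<star> f \<in> H c c" "x \<star> f \<star> f = x \<star> f" if "x \<in> H c c" for x
    using that f_hom_space f_idem conv_assoc[OF hom_space_arr_space[OF that] f_arr_space f_arr_space]
    by (auto intro: conv_hom_space)
  then show ?thesis
    by (force simp: simple_group_module_def left_ideal_module_def)
qed

lemma subspace_simple_group_module: "cvec.subspace (carrier S\<^sub>0)"
  unfolding carrier_simple_group_module cvec.subspace_def
  by (auto simp: conv_add conv_cscale conv_zero hom_space_closed)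

lemma simple_group_module_arr_space: "x \<in> carrier S\<^sub>0 \<Longrightarrow> x \<in> A"
  using hom_space_arr_space[of x \<D> c c] by (simp add: carrier_simple_group_module)

lemma unit_simple_group_module: "x \<in> carrier S\<^sub>0 \<Longrightarrow> unit c \<star> x = x"
  using unit_left[OF _ c, of x c] by (simp add: carrier_simple_group_module)

lemma act_simple_group_module:
  assumes "r \<in> H c c" "x \<in> carrier S\<^sub>0"
  shows "r \<star> x \<in> carrier S\<^sub>0"
  using assms conv_assoc[OF hom_space_arr_space[OF assms(1)]
      simple_group_module_arr_space[OF assms(2)] f_arr_space]
  by (auto simp: carrier_simple_group_module intro: conv_hom_space)

lemma f_simple_group_module: "f \<in> carrier S\<^sub>0"
  by (simp add: carrier_simple_group_module f_hom_space f_idem)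

lemma pairing:
  assumes y: "y \<in> H c c" "f \<star> y = y" and v: "v \<in> carrier S\<^sub>0"
  shows "y \<star> v = cscale (corner_coeff (y \<star> v)) f"
proof -
  have v: "v \<in> H c c" "v \<star> f = v" using v by (auto simp: carrier_simple_group_module)
  note A = hom_space_arr_space[OF y(1)] hom_space_arr_space[OF v(1)] f_arr_space
  have "f \<star> (y \<star> v) \<star> f = (f \<star> y) \<star> (v \<star> f)"
    using A by (simp only: conv_assoc conv_arr_space)
  then show ?thesis
    using corner_coeff[OF conv_hom_space[OF y(1) v(1)]] y(2) v(2) by simp
qed

abbreviation dual where "dual \<equiv> dual_module (group_algebra \<D> c) S\<^sub>0"

lemma carrier_dual: "\<phi> \<in> carrier dual \<longleftrightarrow> \<phi> \<in> extensional (carrier S\<^sub>0) \<and>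
    (\<forall>u \<in> carrier S\<^sub>0. \<forall>v \<in> carrier S\<^sub>0. \<phi> (u + v) = \<phi> u + \<phi> v) \<and>
    (\<forall>z. \<forall>v \<in> carrier S\<^sub>0. \<phi> (cscale z v) = z * \<phi> v)"
proof -
  have "scalar_elt (group_algebra \<D> c) z \<star> v = cscale z v" if "v \<in> carrier S\<^sub>0" for z v
    using that by (simp add: conv_cscale unit_simple_group_module)
  then show ?thesis
    by (simp add: dual_module_def)
qed

lemma dual_simps:
  "\<phi> \<oplus>\<^bsub>dual\<^esub> \<psi> = (\<lambda>v \<in> carrier S\<^sub>0. \<phi> v + \<psi> v)"
  "rsmult dual \<phi> x = (\<lambda>v \<in> carrier S\<^sub>0. \<phi> (x \<star> v))"
  by (simp_all add: dual_module_def)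

lemma dual_scalar:
  assumes "\<phi> \<in> carrier dual"
  shows "rsmult dual \<phi> (scalar_elt (group_algebra \<D> c) z) = (\<lambda>v \<in> carrier S\<^sub>0. z * \<phi> v)"
  using assms
  by (auto simp: dual_simps carrier_dual conv_cscale unit_simple_group_module intro!: restrict_ext)

lemma dual_closed:
  assumes "\<phi> \<in> carrier dual"
  shows "\<psi> \<in> carrier dual \<Longrightarrow> (\<lambda>v \<in> carrier S\<^sub>0. \<phi> v + \<psi> v) \<in> carrier dual"
    and "(\<lambda>v \<in> carrier S\<^sub>0. z * \<phi> v) \<in> carrier dual"
    and "x \<in> H c c \<Longrightarrow> (\<lambda>v \<in> carrier S\<^sub>0. \<phi> (x \<star> v)) \<in> carrier dual"
  using assms cvec.subspace_add[OF subspace_simple_group_module]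
    cvec.subspace_scale[OF subspace_simple_group_module] act_simple_group_module
  by (auto simp: carrier_dual algebra_simps conv_add conv_cscale)

lemma dual_sum:
  assumes "\<phi> \<in> carrier dual" and "finite I" and "\<And>i. i \<in> I \<Longrightarrow> v i \<in> carrier S\<^sub>0"
  shows "\<phi> (\<Sum>i \<in> I. v i) = (\<Sum>i \<in> I. \<phi> (v i))"
  using assms(2,3)
proof (induction I)
  case empty
  have "\<phi> (cscale 0 0) = 0 * \<phi> 0"
    using assms(1) cvec.subspace_0[OF subspace_simple_group_module] unfolding carrier_dual by blast
  then show ?case by simp
next
  case (insert i I)
  then show ?case
    using assms(1) cvec.subspace_sum[OF subspace_simple_group_module, of I v]
    by (simp add: carrier_dual)
qed

text \<open>The pairing \<open>y v = \<kappa> (y v) f\<close> identifies the right ideal of \<open>f\<close> with the dual of the left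
  ideal: a functional \<open>\<phi>\<close> is represented by \<open>\<Sum>k. \<phi> (p k) q k\<close>, for dual generators \<open>p\<close> and \<open>q\<close>.\<close>

definition represents :: "('m \<Rightarrow>\<^sub>0 complex) \<Rightarrow> (('m \<Rightarrow>\<^sub>0 complex) \<Rightarrow> complex) \<Rightarrow> bool"
  where "represents y \<phi> \<longleftrightarrow> y \<in> H c c \<and> f \<star> y = y \<and> (\<forall>v \<in> carrier S\<^sub>0. y \<star> v = cscale (\<phi> v) f)"

lemma represents_exists:
  assumes \<phi>: "\<phi> \<in> carrier dual"
  shows "\<exists>y. represents y \<phi>"
proof -
  obtain n :: nat and p q where p: "\<And>k. k < n \<Longrightarrow> p k \<in> H c c" "\<And>k. k < n \<Longrightarrow> p k \<star> f = p k"
    and q: "\<And>k. k < n \<Longrightarrow> q k \<in> H c c" "\<And>k. k < n \<Longrightarrow> f \<star> q k = q k"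
    and pq: "\<And>v. v \<in> H c c \<Longrightarrow> v \<star> f = v \<Longrightarrow> (\<Sum>k<n. p k \<star> (q k \<star> v)) = v"
    by (rule dual_generators) (rule that)
  let ?y = "\<Sum>k<n. cscale (\<phi> (p k)) (q k)"
  have "?y \<in> H c c"
    using q(1) by (intro hom_space_closed(5) hom_space_closed(2)) simp
  moreover have "f \<star> ?y = ?y"
    using q(2) by (simp add: conv_sum_right conv_cscale)
  moreover have "?y \<star> v = cscale (\<phi> v) f" if v: "v \<in> carrier S\<^sub>0" for v
  proof -
    have pS: "p k \<in> carrier S\<^sub>0" if "k < n" for k
      using p that by (simp add: carrier_simple_group_module)
    have qv: "q k \<star> v = cscale (corner_coeff (q k \<star> v)) f" if "k < n" for k
      using pairing[OF q(1)[OF that] q(2)[OF that] v] .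
    have "p k \<star> (q k \<star> v) = cscale (corner_coeff (q k \<star> v)) (p k)" if "k < n" for k
      using arg_cong[OF qv[OF that], of "\<lambda>u. p k \<star> u"] p(2)[OF that] by (simp add: conv_cscale)
    then have "v = (\<Sum>k<n. cscale (corner_coeff (q k \<star> v)) (p k))"
      using pq[of v] v by (simp add: carrier_simple_group_module)
    then have "\<phi> v = \<phi> (\<Sum>k<n. cscale (corner_coeff (q k \<star> v)) (p k))"
      by simp
    also have "\<dots> = (\<Sum>k<n. corner_coeff (q k \<star> v) * \<phi> (p k))"
      using pS \<phi> cvec.subspace_scale[OF subspace_simple_group_module]
      by (subst dual_sum[OF \<phi>]) (auto simp: carrier_dual)
    finally have "cscale (\<phi> v) f = (\<Sum>k<n. cscale (\<phi> (p k)) (cscale (corner_coeff (q k \<star> v)) f))"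
      by (simp add: cvec.scale_sum_left mult.commute)
    also have "\<dots> = (\<Sum>k<n. cscale (\<phi> (p k)) (q k \<star> v))"
      using qv by (intro sum.cong refl) simp
    finally show ?thesis
      by (simp add: conv_sum_left conv_cscale)
  qed
  ultimately show ?thesis
    unfolding represents_def by blast
qed

lemma represents_unique:
  assumes "represents y \<phi>" "represents y' \<phi>"
  shows "y = y'"
proof -
  obtain n :: nat and p q where p: "\<And>k. k < n \<Longrightarrow> p k \<in> H c c" "\<And>k. k < n \<Longrightarrow> p k \<star> f = p k"
    and gen: "\<And>y. y \<in> H c c \<Longrightarrow> f \<star> y = y \<Longrightarrow> (\<Sum>k<n. (y \<star> p k) \<star> q k) = y"
    by (rule dual_generators) (rule that)
  have "p k \<in> carrier S\<^sub>0" if "k < n" for k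
    using p that by (simp add: carrier_simple_group_module)
  then have eq: "y \<star> p k = y' \<star> p k" if "k < n" for k
    using assms that by (simp add: represents_def)
  have "y = (\<Sum>k<n. (y \<star> p k) \<star> q k)"
    using gen[of y] assms(1) by (simp add: represents_def)
  also have "\<dots> = (\<Sum>k<n. (y' \<star> p k) \<star> q k)"
    using eq by (intro sum.cong refl) simp
  also have "\<dots> = y'"
    using gen[of y'] assms(2) by (simp add: represents_def)
  finally show ?thesis .
qed

definition rep :: "(('m \<Rightarrow>\<^sub>0 complex) \<Rightarrow> complex) \<Rightarrow> 'm \<Rightarrow>\<^sub>0 complex"
  where "rep \<phi> = (THE y. represents y \<phi>)"

lemma rep_eqI: "represents y \<phi> \<Longrightarrow> rep \<phi> = y"
  unfolding rep_def using represents_unique by (intro the_equality)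

lemma represents_rep: "\<phi> \<in> carrier dual \<Longrightarrow> represents (rep \<phi>) \<phi>"
  using represents_exists rep_eqI by metis

lemma rep_add:
  assumes "\<phi> \<in> carrier dual" "\<psi> \<in> carrier dual"
  shows "rep (\<lambda>v \<in> carrier S\<^sub>0. \<phi> v + \<psi> v) = rep \<phi> + rep \<psi>"
  using represents_rep[OF assms(1)] represents_rep[OF assms(2)]
  by (intro rep_eqI) (simp add: represents_def conv_add hom_space_closed cvec.scale_left_distrib)

lemma rep_scale:
  assumes "\<phi> \<in> carrier dual"
  shows "rep (\<lambda>v \<in> carrier S\<^sub>0. z * \<phi> v) = cscale z (rep \<phi>)"
  using represents_rep[OF assms]
  by (intro rep_eqI) (simp add: represents_def conv_cscale hom_space_closed)

lemma rep_act:
  assumes \<phi>: "\<phi> \<in> carrier dual" and x: "x \<in> H c c"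
  shows "rep (\<lambda>v \<in> carrier S\<^sub>0. \<phi> (x \<star> v)) = rep \<phi> \<star> x"
proof (rule rep_eqI)
  have y: "rep \<phi> \<in> H c c" "f \<star> rep \<phi> = rep \<phi>"
    "\<And>v. v \<in> carrier S\<^sub>0 \<Longrightarrow> rep \<phi> \<star> v = cscale (\<phi> v) f"
    using represents_rep[OF \<phi>] by (auto simp: represents_def)
  note A = hom_space_arr_space[OF y(1)] hom_space_arr_space[OF x] f_arr_space
  have "rep \<phi> \<star> x \<in> H c c"
    using y(1) x by (rule conv_hom_space)
  moreover have "f \<star> (rep \<phi> \<star> x) = rep \<phi> \<star> x"
    using conv_assoc[OF A(3,1,2)] y(2) by simp
  moreover have "rep \<phi> \<star> x \<star> v = cscale (\<phi> (x \<star> v)) f" if v: "v \<in> carrier S\<^sub>0" for v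
  proof -
    have "v \<in> A" using v by (rule simple_group_module_arr_space)
    then show ?thesis
      using conv_assoc[OF A(1,2)] y(3)[OF act_simple_group_module[OF x v]] by simp
  qed
  ultimately show "represents (rep \<phi> \<star> x) (\<lambda>v \<in> carrier S\<^sub>0. \<phi> (x \<star> v))"
    by (simp add: represents_def)
qed

lemma rep_closed:
  assumes "\<phi> \<in> carrier dual"
  shows "rep \<phi> \<in> H c c" "f \<star> rep \<phi> = rep \<phi>" "v \<in> carrier S\<^sub>0 \<Longrightarrow> rep \<phi> \<star> v = cscale (\<phi> v) f"
  using represents_rep[OF assms] by (auto simp: represents_def)

lemma functional_of:
  assumes y: "y \<in> H c c" "f \<star> y = y"
  shows "(\<lambda>v \<in> carrier S\<^sub>0. corner_coeff (y \<star> v)) \<in> carrier dual"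
proof -
  have "y \<star> v \<in> H c c" if "v \<in> carrier S\<^sub>0" for v
    using that y(1) by (auto simp: carrier_simple_group_module intro: conv_hom_space)
  then show ?thesis
    using cvec.subspace_add[OF subspace_simple_group_module]
      cvec.subspace_scale[OF subspace_simple_group_module]
    by (auto simp: carrier_dual conv_add conv_cscale corner_coeff_add corner_coeff_cscale)
qed

lemma rep_functional_of:
  assumes y: "y \<in> H c c" "f \<star> y = y"
  shows "rep (\<lambda>v \<in> carrier S\<^sub>0. corner_coeff (y \<star> v)) = y"
  using y pairing[OF y] by (intro rep_eqI) (simp add: represents_def)

end

context primitive_pair
begin

abbreviation V where "V \<equiv> carrier b.S\<^sub>0"
abbreviation U where "U \<equiv> carrier a.S\<^sub>0"
abbreviation W where "W \<equiv> carrier a.dual"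
abbreviation T where "T \<equiv> tensor_bimodule (CG b) (CG a) b.S\<^sub>0 a.dual"

text \<open>The tensor product is the free vector space on pairs modulo \<open>kernel\<close>; \<open>left_map\<close> and \<open>right_map\<close> are
  the maps on the free space that induce the two actions.\<close>

definition kernel where "kernel = cvec.span (tensor_relations (CG b) (CG a) b.S\<^sub>0 a.dual)"
definition coset where "coset x = (\<lambda>k. k + x) ` kernel"
definition left_map where "left_map r = lin_ext (\<lambda>(v, w). basis_elt (r \<star> v, w))"
definition right_map where "right_map s = lin_ext (\<lambda>(v, w). basis_elt (v, \<lambda>u \<in> U. w (s \<star> u)))"

lemma subspace_kernel: "cvec.subspace kernel"
  by (simp add: kernel_def)

lemma relations_in_kernel:
  assumes "v \<in> V" "w \<in> W"
  shows "v' \<in> V \<Longrightarrow> basis_elt (v + v', w) - basis_elt (v, w) - basis_elt (v', w) \<in> kernel"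
    and "w' \<in> W \<Longrightarrow> basis_elt (v, \<lambda>u \<in> U. w u + w' u) - basis_elt (v, w) - basis_elt (v, w') \<in> kernel"
    and "basis_elt (cscale z v, w) - cscale z (basis_elt (v, w)) \<in> kernel"
    and "basis_elt (v, \<lambda>u \<in> U. z * w u) - cscale z (basis_elt (v, w)) \<in> kernel"
proof -
  note rel = cvec.span_base[of _ "tensor_relations (CG b) (CG a) b.S\<^sub>0 a.dual", folded kernel_def]
  show "basis_elt (v + v', w) - basis_elt (v, w) - basis_elt (v', w) \<in> kernel" if "v' \<in> V"
    using that assms unfolding tensor_relations_def b.simple_group_module_simps
    by (intro rel[unfolded tensor_relations_def b.simple_group_module_simps]) blast
  show "basis_elt (v, \<lambda>u \<in> U. w u + w' u) - basis_elt (v, w) - basis_elt (v, w') \<in> kernel" if "w' \<in> W"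
    using that assms
    by (intro rel[unfolded tensor_relations_def a.dual_simps]) blast
  have "scalar_elt (CG b) z \<odot>\<^bsub>b.S\<^sub>0\<^esub> v = cscale z v"
    using assms(1) by (simp add: conv_cscale b.unit_simple_group_module)
  then have "basis_elt (cscale z v, w) - cscale z (basis_elt (v, w)) =
      basis_elt (scalar_elt (CG b) z \<odot>\<^bsub>b.S\<^sub>0\<^esub> v, w) - cscale z (basis_elt (v, w))"
    by simp
  also have "\<dots> \<in> kernel"
    using assms by (intro rel[unfolded tensor_relations_def]) blast
  finally show "basis_elt (cscale z v, w) - cscale z (basis_elt (v, w)) \<in> kernel" .
  have "basis_elt (v, \<lambda>u \<in> U. z * w u) - cscale z (basis_elt (v, w)) =
      basis_elt (v, rsmult a.dual w (scalar_elt (CG a) z)) - cscale z (basis_elt (v, w))"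
    by (simp only: a.dual_scalar[OF assms(2)])
  also have "\<dots> \<in> kernel"
    using assms by (intro rel[unfolded tensor_relations_def]) blast
  finally show "basis_elt (v, \<lambda>u \<in> U. z * w u) - cscale z (basis_elt (v, w)) \<in> kernel" .
qed

text \<open>The universal property: a bilinear map, taken modulo a subspace \<open>X\<close>, factors through the
  tensor product.\<close>

lemma kernel_mapped:
  assumes lin: "clinear F" and X: "cvec.subspace X"
    and rel: "\<And>v v' w. v \<in> V \<Longrightarrow> v' \<in> V \<Longrightarrow> w \<in> W \<Longrightarrow>
        F (basis_elt (v + v', w)) - F (basis_elt (v, w)) - F (basis_elt (v', w)) \<in> X"
      "\<And>v w w'. v \<in> V \<Longrightarrow> w \<in> W \<Longrightarrow> w' \<in> W \<Longrightarrow>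
        F (basis_elt (v, \<lambda>u \<in> U. w u + w' u)) - F (basis_elt (v, w)) - F (basis_elt (v, w')) \<in> X"
      "\<And>z v w. v \<in> V \<Longrightarrow> w \<in> W \<Longrightarrow>
        F (basis_elt (cscale z v, w)) - cscale z (F (basis_elt (v, w))) \<in> X"
      "\<And>z v w. v \<in> V \<Longrightarrow> w \<in> W \<Longrightarrow>
        F (basis_elt (v, \<lambda>u \<in> U. z * w u)) - cscale z (F (basis_elt (v, w))) \<in> X"
    and x: "x \<in> kernel"
  shows "F x \<in> X"
proof -
  have scalar: "scalar_elt (CG b) z \<odot>\<^bsub>b.S\<^sub>0\<^esub> v = cscale z v" if "v \<in> V" for z v
    using that by (simp add: conv_cscale b.unit_simple_group_module)
  have "F y \<in> X" if "y \<in> tensor_relations (CG b) (CG a) b.S\<^sub>0 a.dual" for y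
    using that unfolding tensor_relations_def
  proof (elim UnE CollectE exE conjE)
    fix v v' w assume "y = basis_elt (v \<oplus>\<^bsub>b.S\<^sub>0\<^esub> v', w) - basis_elt (v, w) - basis_elt (v', w)"
      "v \<in> V" "v' \<in> V" "w \<in> W"
    then show ?thesis using rel(1) by (simp add: clinearD[OF lin])
  next
    fix v w w' assume "y = basis_elt (v, w \<oplus>\<^bsub>a.dual\<^esub> w') - basis_elt (v, w) - basis_elt (v, w')"
      "v \<in> V" "w \<in> W" "w' \<in> W"
    then show ?thesis using rel(2) by (simp add: clinearD[OF lin] a.dual_simps)
  next
    fix z v w assume "y = basis_elt (scalar_elt (CG b) z \<odot>\<^bsub>b.S\<^sub>0\<^esub> v, w) - cscale z (basis_elt (v, w))"
      "v \<in> V" "w \<in> W"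
    then show ?thesis using rel(3) scalar[of v z] by (simp only: clinearD[OF lin])
  next
    fix z v w assume "y = basis_elt (v, rsmult a.dual w (scalar_elt (CG a) z)) - cscale z (basis_elt (v, w))"
      "v \<in> V" "w \<in> W"
    then show ?thesis using rel(4) by (simp only: clinearD[OF lin] a.dual_scalar)
  qed
  then have "tensor_relations (CG b) (CG a) b.S\<^sub>0 a.dual \<subseteq> {x. F x \<in> X}"
    by blast
  moreover have "cvec.subspace {x. F x \<in> X}"
    using X by (auto simp: cvec.subspace_def clinearD[OF lin])
  ultimately show ?thesis
    using cvec.span_minimal x unfolding kernel_def by blast
qed

lemma coset_eq_iff: "coset x = coset y \<longleftrightarrow> x - y \<in> kernel"
proof
  assume "coset x = coset y"
  moreover have "x \<in> coset x"
    using cvec.subspace_0[OF subspace_kernel] by (force simp: coset_def)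
  ultimately obtain k where "k \<in> kernel" "x = k + y"
    by (auto simp: coset_def)
  then show "x - y \<in> kernel" by simp
next
  assume k: "x - y \<in> kernel"
  show "coset x = coset y"
  proof (intro equalityI subsetI)
    fix u assume "u \<in> coset x"
    then obtain l where l: "l \<in> kernel" "u = l + x" by (auto simp: coset_def)
    then have "u = (l + (x - y)) + y" "l + (x - y) \<in> kernel"
      using k cvec.subspace_add[OF subspace_kernel] by auto
    then show "u \<in> coset y" unfolding coset_def by blast
  next
    fix u assume "u \<in> coset y"
    then obtain l where l: "l \<in> kernel" "u = l + y" by (auto simp: coset_def)
    then have "u = (l - (x - y)) + x" "l - (x - y) \<in> kernel"
      using k cvec.subspace_diff[OF subspace_kernel] by auto
    then show "u \<in> coset x" unfolding coset_def by blast
  qed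
qed

lemma coset_free: "kernel +>\<^bsub>free_vector_space B\<^esub> x = coset x"
  by (auto simp: mem_coset_iff coset_def free_vector_space_def)

lemma coset_union:
  assumes "clinear F" "\<And>k. k \<in> kernel \<Longrightarrow> F k \<in> kernel"
  shows "(\<Union>y \<in> coset x. coset (F y)) = coset (F x)"
proof -
  have "coset (F y) = coset (F x)" if y: "y \<in> coset x" for y
  proof -
    obtain k where "k \<in> kernel" "y = k + x" using y by (auto simp: coset_def)
    then show ?thesis
      using assms by (simp add: coset_eq_iff clinearD[OF assms(1)])
  qed
  moreover have "x \<in> coset x"
    using cvec.subspace_0[OF subspace_kernel] by (force simp: coset_def)
  ultimately show ?thesis by blast
qed

lemma kernel_left_map:
  assumes r: "r \<in> H b b" and k: "k \<in> kernel"
  shows "left_map r k \<in> kernel"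
  by (rule kernel_mapped[OF _ subspace_kernel _ _ _ _ k])
    (use b.act_simple_group_module[OF r] in
      \<open>simp_all add: left_map_def clinear_lin_ext conv_add conv_cscale relations_in_kernel\<close>)

lemma kernel_right_map:
  assumes s: "s \<in> H a a" and k: "k \<in> kernel"
  shows "right_map s k \<in> kernel"
proof (rule kernel_mapped[OF _ subspace_kernel _ _ _ _ k])
  note act = a.act_simple_group_module[OF s] and dual = a.dual_closed(3)[OF _ s]
  show "clinear (right_map s)" by (simp add: right_map_def clinear_lin_ext)
  show "right_map s (basis_elt (v, \<lambda>u \<in> U. w u + w' u)) - right_map s (basis_elt (v, w)) -
      right_map s (basis_elt (v, w')) \<in> kernel" if "v \<in> V" "w \<in> W" "w' \<in> W" for v w w'
  proof -
    have "(\<lambda>u \<in> U. (\<lambda>u \<in> U. w u + w' u) (s \<star> u)) =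
        (\<lambda>u \<in> U. (\<lambda>u \<in> U. w (s \<star> u)) u + (\<lambda>u \<in> U. w' (s \<star> u)) u)"
      using act by (intro restrict_ext) simp
    then show ?thesis
      using relations_in_kernel(2)[OF that(1) dual[OF that(2)] dual[OF that(3)]]
      by (simp add: right_map_def)
  qed
  show "right_map s (basis_elt (v, \<lambda>u \<in> U. z * w u)) - cscale z (right_map s (basis_elt (v, w))) \<in> kernel"
    if "v \<in> V" "w \<in> W" for z v w
  proof -
    have "(\<lambda>u \<in> U. (\<lambda>u \<in> U. z * w u) (s \<star> u)) = (\<lambda>u \<in> U. z * (\<lambda>u \<in> U. w (s \<star> u)) u)"
      using act by (intro restrict_ext) simp
    then show ?thesis
      using relations_in_kernel(4)[OF that(1) dual[OF that(2)], of z] by (simp add: right_map_def)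
  qed
qed (use a.dual_closed(3)[OF _ s] in \<open>simp_all add: right_map_def relations_in_kernel\<close>)

lemma tensor_carrier: "carrier T = coset ` combinations (V \<times> W)"
proof -
  have "carrier T = (\<Union>x \<in> carrier (free_vector_space (V \<times> W)). {kernel +>\<^bsub>free_vector_space (V \<times> W)\<^esub> x})"
    by (simp add: tensor_bimodule_def Let_def A_RCOSETS_def' kernel_def)
  also have "\<dots> = (\<Union>x \<in> combinations (V \<times> W). {coset x})"
    unfolding coset_free by (simp add: free_vector_space_def)
  also have "\<dots> = coset ` combinations (V \<times> W)"
    by (rule UNION_singleton_eq_range)
  finally show ?thesis .
qed

lemma tensor_add: "coset x \<oplus>\<^bsub>T\<^esub> coset y = coset (x + y)"
proof -
  have "coset x \<oplus>\<^bsub>T\<^esub> coset y = {u + v | u v. u \<in> coset x \<and> v \<in> coset y}"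
    by (auto simp: tensor_bimodule_def Let_def set_add_def set_mult_def free_vector_space_def)
  also have "\<dots> = coset (x + y)"
  proof (intro equalityI subsetI)
    fix z assume "z \<in> {u + v | u v. u \<in> coset x \<and> v \<in> coset y}"
    then obtain k l where "k \<in> kernel" "l \<in> kernel" "z = (k + l) + (x + y)"
      by (auto simp: coset_def algebra_simps)
    then show "z \<in> coset (x + y)"
      using cvec.subspace_add[OF subspace_kernel] by (auto simp: coset_def)
  next
    fix z assume "z \<in> coset (x + y)"
    then obtain k where "k \<in> kernel" "z = (k + x) + (0 + y)"
      by (auto simp: coset_def algebra_simps)
    moreover have "0 \<in> kernel" by (rule cvec.subspace_0[OF subspace_kernel])
    ultimately show "z \<in> {u + v | u v. u \<in> coset x \<and> v \<in> coset y}"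
      unfolding coset_def by blast
  qed
  finally show ?thesis .
qed

lemma tensor_left: "r \<in> H b b \<Longrightarrow> r \<odot>\<^bsub>T\<^esub> coset x = coset (left_map r x)"
  using coset_union[of "left_map r" x] kernel_left_map
  by (simp add: tensor_bimodule_def Let_def kernel_def[symmetric] coset_free left_map_def clinear_lin_ext)

lemma tensor_right: "s \<in> H a a \<Longrightarrow> bi_rsmult T (coset x) s = coset (right_map s x)"
  using coset_union[of "right_map s" x] kernel_right_map
  by (simp add: tensor_bimodule_def Let_def kernel_def[symmetric] coset_free right_map_def
      clinear_lin_ext a.dual_simps)

lemma left_map_combinations:
  assumes "r \<in> H b b" "x \<in> combinations (V \<times> W)"
  shows "left_map r x \<in> combinations (V \<times> W)"
  using assms(2)
proof (induction rule: combination_induct)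
  case (basis vw)
  then show ?case
    using b.act_simple_group_module[OF assms(1)]
    by (auto simp: left_map_def basis_elt_def[of "(_, _)"])
next
  case (add x y)
  then show ?case
    unfolding left_map_def clinearD[OF clinear_lin_ext] by (rule cvec.subspace_add[OF subspace_combinations])
next
  case (scale z x)
  then show ?case
    unfolding left_map_def clinearD[OF clinear_lin_ext] by (rule cvec.subspace_scale[OF subspace_combinations])
qed (simp add: left_map_def clinearD[OF clinear_lin_ext])

lemma right_map_combinations:
  assumes "s \<in> H a a" "x \<in> combinations (V \<times> W)"
  shows "right_map s x \<in> combinations (V \<times> W)"
  using assms(2)
proof (induction rule: combination_induct)
  case (basis vw)
  then show ?case
    using a.dual_closed(3)[OF _ assms(1)]
    by (auto simp: right_map_def basis_elt_def[of "(_, _)"])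
next
  case (add x y)
  then show ?case
    unfolding right_map_def clinearD[OF clinear_lin_ext] by (rule cvec.subspace_add[OF subspace_combinations])
next
  case (scale z x)
  then show ?case
    unfolding right_map_def clinearD[OF clinear_lin_ext] by (rule cvec.subspace_scale[OF subspace_combinations])
qed (simp add: right_map_def clinearD[OF clinear_lin_ext])

lemma kernel_sum_left:
  assumes "finite I" "w \<in> W" "\<And>i. i \<in> I \<Longrightarrow> v i \<in> V"
  shows "basis_elt (\<Sum>i \<in> I. cscale (z i) (v i), w) - (\<Sum>i \<in> I. cscale (z i) (basis_elt (v i, w))) \<in> kernel"
  using assms(1,3)
proof (induction I)
  case empty
  then show ?case
    using relations_in_kernel(3)[OF cvec.subspace_0[OF b.subspace_simple_group_module] assms(2), of 0]
    by simp
next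
  case (insert i I)
  let ?s = "\<Sum>i \<in> I. cscale (z i) (v i)" and ?t = "\<Sum>i \<in> I. cscale (z i) (basis_elt (v i, w))"
  note sub = b.subspace_simple_group_module
  have mem: "v i \<in> V" "cscale (z i) (v i) \<in> V"
    using insert.prems cvec.subspace_scale[OF sub] by auto
  have mem': "?s \<in> V"
    using insert.prems by (intro cvec.subspace_sum[OF sub] cvec.subspace_scale[OF sub]) auto
  have "(basis_elt (cscale (z i) (v i) + ?s, w) - basis_elt (cscale (z i) (v i), w) - basis_elt (?s, w)) +
      (basis_elt (cscale (z i) (v i), w) - cscale (z i) (basis_elt (v i, w))) +
      (basis_elt (?s, w) - ?t) \<in> kernel"
    using relations_in_kernel(1)[OF mem(2) assms(2) mem'] relations_in_kernel(3)[OF mem(1) assms(2), of "z i"]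
      insert.IH insert.prems
    by (intro cvec.subspace_add[OF subspace_kernel]) auto
  then show ?case
    using insert.hyps by (simp add: algebra_simps)
qed

lemma kernel_sum_right:
  assumes "finite I" "v \<in> V" "\<And>i. i \<in> I \<Longrightarrow> w i \<in> W"
  shows "basis_elt (v, \<lambda>u \<in> U. \<Sum>i \<in> I. z i * w i u) - (\<Sum>i \<in> I. cscale (z i) (basis_elt (v, w i))) \<in> kernel
    \<and> (\<lambda>u \<in> U. \<Sum>i \<in> I. z i * w i u) \<in> W"
  using assms(1,3)
proof (induction I)
  case empty
  have zero: "(\<lambda>u \<in> U. 0) \<in> W"
    by (auto simp: a.carrier_dual cvec.subspace_add[OF a.subspace_simple_group_module]
        cvec.subspace_scale[OF a.subspace_simple_group_module])
  have eq: "(\<lambda>u \<in> U. 0 * (\<lambda>u \<in> U. 0) u) = (\<lambda>u \<in> U. 0 :: complex)"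
    by simp
  have "basis_elt (v, \<lambda>u \<in> U. 0) \<in> kernel"
    using relations_in_kernel(4)[OF assms(2) zero, of 0]
    by (simp only: eq cvec.scale_zero_left diff_zero)
  then show ?case
    using zero by (simp only: sum.empty diff_zero simp_thms)
next
  case (insert i I)
  let ?s = "\<lambda>u \<in> U. \<Sum>i \<in> I. z i * w i u" and ?t = "\<Sum>i \<in> I. cscale (z i) (basis_elt (v, w i))"
  let ?r = "\<lambda>u \<in> U. z i * w i u"
  have "basis_elt (v, ?s) - ?t \<in> kernel \<and> ?s \<in> W"
    by (rule insert.IH) (simp add: insert.prems)
  then have s: "basis_elt (v, ?s) - ?t \<in> kernel" "?s \<in> W"
    by blast+
  have wi: "w i \<in> W" using insert.prems by simp
  have r: "?r \<in> W"
    by (rule a.dual_closed(2)[OF wi])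
  have eq: "(\<lambda>u \<in> U. \<Sum>i \<in> insert i I. z i * w i u) = (\<lambda>u \<in> U. ?r u + ?s u)"
    using insert.hyps by (intro restrict_ext) simp
  have "(basis_elt (v, \<lambda>u \<in> U. ?r u + ?s u) - basis_elt (v, ?r) - basis_elt (v, ?s)) +
      (basis_elt (v, ?r) - cscale (z i) (basis_elt (v, w i))) + (basis_elt (v, ?s) - ?t) \<in> kernel"
    using relations_in_kernel(2)[OF assms(2) r s(2)] relations_in_kernel(4)[OF assms(2) wi, of "z i"] s(1)
    by (intro cvec.subspace_add[OF subspace_kernel])
  then have "basis_elt (v, \<lambda>u \<in> U. ?r u + ?s u) -
      (\<Sum>i \<in> insert i I. cscale (z i) (basis_elt (v, w i))) \<in> kernel"
    using insert.hyps by (simp add: algebra_simps)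
  moreover have "(\<lambda>u \<in> U. ?r u + ?s u) \<in> W"
    by (rule a.dual_closed(1)[OF r s(2)])
  ultimately show ?case
    unfolding eq by blast
qed

section \<open>Irreducible sub-bimodules with a nonzero corner\<close>

text \<open>The map \<open>v \<otimes> w \<mapsto> v t y\<close>, with \<open>y\<close> representing \<open>w\<close>, on the free vector space on pairs.\<close>

definition tensor_map where "tensor_map t = lin_ext (\<lambda>(v, w). v \<star> t \<star> a.rep w)"

lemma clinear_tensor_map: "clinear (tensor_map t)"
  by (simp add: tensor_map_def clinear_lin_ext)

lemma tensor_map_kernel: "k \<in> kernel \<Longrightarrow> tensor_map t k = 0"
  using kernel_mapped[OF clinear_tensor_map cvec.subspace_single_0, of t k]
  by (simp add: tensor_map_def conv_add conv_cscale a.rep_add a.rep_scale)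

lemma tensor_map_left:
  assumes t: "t \<in> H a b" and r: "r \<in> H b b" and x: "x \<in> combinations (V \<times> W)"
  shows "tensor_map t (left_map r x) = r \<star> tensor_map t x"
  using x
proof (induction rule: combination_induct)
  case (basis vw)
  then obtain v w where vw: "vw = (v, w)" "v \<in> V" "w \<in> W" by auto
  then have v: "v \<in> H b b" by (simp add: b.carrier_simple_group_module)
  note A = hom_space_arr_space[OF r] hom_space_arr_space[OF t] hom_space_arr_space[OF v]
    hom_space_arr_space[OF a.rep_closed(1)[OF vw(3)]]
  show ?case
    using A vw(1) by (simp add: tensor_map_def left_map_def conv_assoc conv_arr_space)
qed (auto simp: left_map_def clinearD[OF clinear_lin_ext] clinearD[OF clinear_tensor_map]
    conv_add conv_cscale conv_zero)

lemma tensor_map_right: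
  assumes t: "t \<in> H a b" and s: "s \<in> H a a" and x: "x \<in> combinations (V \<times> W)"
  shows "tensor_map t (right_map s x) = tensor_map t x \<star> s"
  using x
proof (induction rule: combination_induct)
  case (basis vw)
  then obtain v w where vw: "vw = (v, w)" "v \<in> V" "w \<in> W" by auto
  then have v: "v \<in> H b b" by (simp add: b.carrier_simple_group_module)
  note A = hom_space_arr_space[OF s] hom_space_arr_space[OF t] hom_space_arr_space[OF v]
    hom_space_arr_space[OF a.rep_closed(1)[OF vw(3)]]
  show ?case
    using A vw(1) by (simp add: tensor_map_def right_map_def a.rep_act[OF vw(3) s] conv_assoc conv_arr_space)
qed (auto simp: right_map_def clinearD[OF clinear_lin_ext] clinearD[OF clinear_tensor_map]
    conv_add conv_cscale conv_zero)

text \<open>Let \<open>p\<close>, \<open>q\<close> be dual generators for \<open>f\<close>, and \<open>r\<close>, \<open>s\<close> for \<open>e\<close>. Modulo the kernel, every tensor is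
  a combination of \<open>p k \<otimes> \<epsilon> l\<close>, where \<open>\<epsilon> l\<close> is the functional \<open>u \<mapsto> \<kappa> (s l u)\<close>. The coefficients
  can be read off from the image of the tensor, as \<open>q k (v t y) r l = \<kappa> (q k v) \<kappa> (y r l) t\<close>; so a
  tensor with image zero is zero.\<close>

lemma tensor_map_injective:
  assumes t: "t \<in> H a b" "\<gamma> t = t" "t \<noteq> 0" and x: "x \<in> combinations (V \<times> W)"
    and zero: "tensor_map t x = 0"
  shows "x \<in> kernel"
proof -
  obtain n :: nat and p q where p: "\<And>k. k < n \<Longrightarrow> p k \<in> H b b" "\<And>k. k < n \<Longrightarrow> p k \<star> f = p k"
    and q: "\<And>k. k < n \<Longrightarrow> q k \<in> H b b" "\<And>k. k < n \<Longrightarrow> f \<star> q k = q k"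
    and pq: "\<And>v. v \<in> H b b \<Longrightarrow> v \<star> f = v \<Longrightarrow> (\<Sum>k<n. p k \<star> (q k \<star> v)) = v"
    by (rule b.dual_generators) (rule that)
  obtain m :: nat and r s where r: "\<And>l. l < m \<Longrightarrow> r l \<in> H a a" "\<And>l. l < m \<Longrightarrow> r l \<star> e = r l"
    and s: "\<And>l. l < m \<Longrightarrow> s l \<in> H a a" "\<And>l. l < m \<Longrightarrow> e \<star> s l = s l"
    and rs: "\<And>v. v \<in> H a a \<Longrightarrow> v \<star> e = v \<Longrightarrow> (\<Sum>l<m. r l \<star> (s l \<star> v)) = v"
    by (rule a.dual_generators) (rule that)
  define \<epsilon> where "\<epsilon> l = (\<lambda>u \<in> U. a.corner_coeff (s l \<star> u))" for l
  have pV: "p k \<in> V" if "k < n" for k using p that by (simp add: b.carrier_simple_group_module)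
  have rU: "r l \<in> U" if "l < m" for l using r that by (simp add: a.carrier_simple_group_module)
  have \<epsilon>W: "\<epsilon> l \<in> W" if "l < m" for l
    unfolding \<epsilon>_def using s that by (intro a.functional_of)
  note ft = corner_fixed[OF t(1,2)]
  have "\<exists>\<theta>. x - (\<Sum>k<n. \<Sum>l<m. cscale (\<theta> k l) (basis_elt (p k, \<epsilon> l))) \<in> kernel \<and>
      (\<forall>k<n. \<forall>l<m. q k \<star> tensor_map t x \<star> r l = cscale (\<theta> k l) t)"
    using x
  proof (induction rule: combination_induct)
    case zero
    show ?case
      using cvec.subspace_0[OF subspace_kernel]
      by (intro exI[of _ "\<lambda>_ _. 0"]) (simp add: clinearD[OF clinear_tensor_map] conv_zero)
  next
    case (basis vw)
    then obtain v w where vw: "vw = (v, w)" "v \<in> V" "w \<in> W" by auto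
    then have v: "v \<in> H b b" "v \<star> f = v" by (simp_all add: b.carrier_simple_group_module)
    let ?\<kappa> = "\<lambda>k. b.corner_coeff (q k \<star> v)"
    have qv: "q k \<star> v = cscale (?\<kappa> k) f" if "k < n" for k
      using b.pairing[OF q(1)[OF that] q(2)[OF that] vw(2)] .
    have "p k \<star> (q k \<star> v) = cscale (?\<kappa> k) (p k)" if "k < n" for k
      using arg_cong[OF qv[OF that], of "\<lambda>u. p k \<star> u"] p(2)[OF that] by (simp add: conv_cscale)
    then have v_exp: "v = (\<Sum>k<n. cscale (?\<kappa> k) (p k))"
      using pq[OF v] by simp
    have w_exp: "w = (\<lambda>u \<in> U. \<Sum>l<m. w (r l) * \<epsilon> l u)"
    proof (rule extensionalityI[of _ U])
      show "w \<in> extensional U" using vw(3) by (simp add: a.carrier_dual)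
      fix u assume u: "u \<in> U"
      have su: "s l \<star> u = cscale (a.corner_coeff (s l \<star> u)) e" if "l < m" for l
        using a.pairing[OF s(1)[OF that] s(2)[OF that] u] .
      have "r l \<star> (s l \<star> u) = cscale (a.corner_coeff (s l \<star> u)) (r l)" if "l < m" for l
        using arg_cong[OF su[OF that], of "\<lambda>y. r l \<star> y"] r(2)[OF that] by (simp add: conv_cscale)
      then have "u = (\<Sum>l<m. cscale (a.corner_coeff (s l \<star> u)) (r l))"
        using rs[of u] u by (simp add: a.carrier_simple_group_module)
      then have "w u = w (\<Sum>l<m. cscale (a.corner_coeff (s l \<star> u)) (r l))"
        by simp
      also have "\<dots> = (\<Sum>l<m. w (r l) * \<epsilon> l u)"
        using rU vw(3) u cvec.subspace_scale[OF a.subspace_simple_group_module]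
        by (subst a.dual_sum[OF vw(3)]) (auto simp: a.carrier_dual \<epsilon>_def mult.commute)
      finally show "w u = (\<lambda>u \<in> U. \<Sum>l<m. w (r l) * \<epsilon> l u) u"
        using u by simp
    qed simp
    have "basis_elt (v, w) - (\<Sum>k<n. cscale (?\<kappa> k) (basis_elt (p k, w))) \<in> kernel"
      using kernel_sum_left[of "{..<n}" w p ?\<kappa>] pV vw(3) v_exp by simp
    moreover have "(\<Sum>k<n. cscale (?\<kappa> k) (basis_elt (p k, w) -
        (\<Sum>l<m. cscale (w (r l)) (basis_elt (p k, \<epsilon> l))))) \<in> kernel"
    proof (intro cvec.subspace_sum[OF subspace_kernel] cvec.subspace_scale[OF subspace_kernel])
      fix k assume "k \<in> {..<n}"
      then show "basis_elt (p k, w) - (\<Sum>l<m. cscale (w (r l)) (basis_elt (p k, \<epsilon> l))) \<in> kernel"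
        using kernel_sum_right[of "{..<m}" "p k" \<epsilon> "\<lambda>l. w (r l)"] pV \<epsilon>W w_exp by simp
    qed
    ultimately have "(basis_elt (v, w) - (\<Sum>k<n. cscale (?\<kappa> k) (basis_elt (p k, w)))) +
        (\<Sum>k<n. cscale (?\<kappa> k) (basis_elt (p k, w) -
          (\<Sum>l<m. cscale (w (r l)) (basis_elt (p k, \<epsilon> l))))) \<in> kernel"
      by (rule cvec.subspace_add[OF subspace_kernel])
    then have "basis_elt vw - (\<Sum>k<n. \<Sum>l<m. cscale (?\<kappa> k * w (r l)) (basis_elt (p k, \<epsilon> l))) \<in> kernel"
      by (simp add: vw(1) cvec.scale_right_diff_distrib sum_subtractf cvec.scale_sum_right)
    moreover have "q k \<star> tensor_map t (basis_elt vw) \<star> r l = cscale (?\<kappa> k * w (r l)) t"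
      if kl: "k < n" "l < m" for k l
    proof -
      note A = hom_space_arr_space[OF q(1)[OF kl(1)]] hom_space_arr_space[OF r(1)[OF kl(2)]]
        hom_space_arr_space[OF v(1)] hom_space_arr_space[OF t(1)]
        hom_space_arr_space[OF a.rep_closed(1)[OF vw(3)]]
      have "q k \<star> (v \<star> t \<star> a.rep w) \<star> r l = (q k \<star> v) \<star> t \<star> (a.rep w \<star> r l)"
        using A by (simp only: conv_assoc conv_arr_space)
      also have "\<dots> = cscale (?\<kappa> k) f \<star> t \<star> cscale (w (r l)) e"
        by (intro arg_cong2[where f = "conv \<D>"] qv kl refl a.rep_closed(3) vw(3) rU)
      also have "\<dots> = cscale (?\<kappa> k * w (r l)) t"
        using ft by (simp add: conv_cscale mult.commute)
      finally show ?thesis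
        by (simp add: vw(1) tensor_map_def)
    qed
    ultimately show ?case
      by (intro exI[of _ "\<lambda>k l. ?\<kappa> k * w (r l)"]) blast
  next
    case (add x y)
    then obtain \<theta> \<theta>' where
      x: "x - (\<Sum>k<n. \<Sum>l<m. cscale (\<theta> k l) (basis_elt (p k, \<epsilon> l))) \<in> kernel"
        "\<forall>k<n. \<forall>l<m. q k \<star> tensor_map t x \<star> r l = cscale (\<theta> k l) t" and
      y: "y - (\<Sum>k<n. \<Sum>l<m. cscale (\<theta>' k l) (basis_elt (p k, \<epsilon> l))) \<in> kernel"
        "\<forall>k<n. \<forall>l<m. q k \<star> tensor_map t y \<star> r l = cscale (\<theta>' k l) t"
      by blast
    have "x + y - (\<Sum>k<n. \<Sum>l<m. cscale (\<theta> k l + \<theta>' k l) (basis_elt (p k, \<epsilon> l))) \<in> kernel"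
      using cvec.subspace_add[OF subspace_kernel x(1) y(1)]
      by (simp add: cvec.scale_left_distrib sum.distrib algebra_simps)
    then show ?case
      using x(2) y(2)
      by (intro exI[of _ "\<lambda>k l. \<theta> k l + \<theta>' k l"])
        (simp add: clinearD[OF clinear_tensor_map] conv_add cvec.scale_left_distrib)
  next
    case (scale z x)
    then obtain \<theta> where
      x: "x - (\<Sum>k<n. \<Sum>l<m. cscale (\<theta> k l) (basis_elt (p k, \<epsilon> l))) \<in> kernel"
        "\<forall>k<n. \<forall>l<m. q k \<star> tensor_map t x \<star> r l = cscale (\<theta> k l) t"
      by blast
    have "cscale z x - (\<Sum>k<n. \<Sum>l<m. cscale (z * \<theta> k l) (basis_elt (p k, \<epsilon> l))) \<in> kernel"
      using cvec.subspace_scale[OF subspace_kernel x(1), of z]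
      by (simp add: cvec.scale_right_diff_distrib cvec.scale_sum_right)
    then show ?case
      using x(2)
      by (intro exI[of _ "\<lambda>k l. z * \<theta> k l"])
        (simp add: clinearD[OF clinear_tensor_map] conv_cscale)
  qed
  then obtain \<theta> where \<theta>: "x - (\<Sum>k<n. \<Sum>l<m. cscale (\<theta> k l) (basis_elt (p k, \<epsilon> l))) \<in> kernel"
    "\<And>k l. k < n \<Longrightarrow> l < m \<Longrightarrow> q k \<star> tensor_map t x \<star> r l = cscale (\<theta> k l) t"
    by blast
  have "\<theta> k l = 0" if "k < n" "l < m" for k l
    using \<theta>(2)[OF that] zero t(3) by (simp add: conv_zero)
  then have "(\<Sum>k<n. \<Sum>l<m. cscale (\<theta> k l) (basis_elt (p k, \<epsilon> l))) = 0"
    by (intro sum.neutral ballI) simp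
  then show ?thesis
    using \<theta>(1) by simp
qed

abbreviation unit_functional where "unit_functional \<equiv> (\<lambda>u \<in> U. a.corner_coeff (e \<star> u))"

lemma unit_functional: "unit_functional \<in> W" "a.rep unit_functional = e"
  using a.functional_of a.rep_functional_of a.f_hom_space a.f_idem by simp_all

lemma generator: "basis_elt (f, unit_functional) \<in> combinations (V \<times> W)"
  using b.f_simple_group_module unit_functional(1) basis_elt_combination[of "(f, unit_functional)" "V \<times> W"]
  by simp

lemma tensor_map_image:
  assumes N: "irreducible a b N" and t: "t \<in> N" "\<gamma> t = t" "t \<noteq> 0"
  shows "tensor_map t ` combinations (V \<times> W) = N"
proof -
  have bi: "biideal a b N" using N by (simp add: irreducible_def)
  note ND = biidealD[OF bi]
  have tH: "t \<in> H a b" using t(1) ND(2) by blast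
  let ?I = "tensor_map t ` combinations (V \<times> W)"
  interpret lin: Vector_Spaces.linear cscale cscale "tensor_map t" by (rule clinear_tensor_map)
  have "?I \<subseteq> N"
  proof clarify
    fix x :: "('m \<Rightarrow>\<^sub>0 complex) \<times> (('m \<Rightarrow>\<^sub>0 complex) \<Rightarrow> complex) \<Rightarrow>\<^sub>0 complex"
    assume "Poly_Mapping.keys x \<subseteq> V \<times> W"
    then have "x \<in> combinations (V \<times> W)" by simp
    then show "tensor_map t x \<in> N"
    proof (induction rule: combination_induct)
      case (basis vw)
      then obtain v w where "vw = (v, w)" "v \<in> V" "w \<in> W" by auto
      then show ?case
        using ND(3,4) t(1) a.rep_closed(1)[of w] by (simp add: tensor_map_def b.carrier_simple_group_module)
    qed (auto simp: clinearD[OF clinear_tensor_map] ND)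
  qed
  moreover have "cvec.subspace ?I"
    by (rule lin.subspace_image[OF subspace_combinations])
  moreover have "r \<star> x \<in> ?I" if r: "r \<in> H b b" and x: "x \<in> ?I" for r x
  proof -
    obtain y where y: "y \<in> combinations (V \<times> W)" "x = tensor_map t y" using x by blast
    then show ?thesis
      using tensor_map_left[OF tH r y(1)] left_map_combinations[OF r y(1)]
      by (intro image_eqI[of _ _ "left_map r y"]) simp_all
  qed
  moreover have "x \<star> s \<in> ?I" if s: "s \<in> H a a" and x: "x \<in> ?I" for s x
  proof -
    obtain y where y: "y \<in> combinations (V \<times> W)" "x = tensor_map t y" using x by blast
    then show ?thesis
      using tensor_map_right[OF tH s y(1)] right_map_combinations[OF s y(1)]
      by (intro image_eqI[of _ _ "right_map s y"]) simp_all
  qed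
  ultimately have "biideal a b ?I"
    using ND(2) by (auto simp: biideal_def)
  then have "?I = {0} \<or> ?I = N"
    using N \<open>?I \<subseteq> N\<close> unfolding irreducible_def by blast
  moreover have "t \<in> ?I"
    using generator t(2) unit_functional(2)
    by (intro image_eqI[of _ _ "basis_elt (f, unit_functional)"]) (simp_all add: tensor_map_def)
  ultimately show ?thesis
    using t(3) by blast
qed

text \<open>The bilinear map \<open>(v, \<phi>) \<mapsto> \<phi> (e) v\<close> sends this generator to \<open>f\<close>.\<close>

lemma generator_not_in_kernel: "basis_elt (f, unit_functional) \<notin> kernel"
proof
  assume k: "basis_elt (f, unit_functional) \<in> kernel"
  let ?F = "lin_ext (\<lambda>(v, w). cscale (w e) v)"
  have "?F (basis_elt (f, unit_functional)) \<in> {0}"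
    by (rule kernel_mapped[OF clinear_lin_ext cvec.subspace_single_0 _ _ _ _ k])
      (simp_all add: a.f_simple_group_module cvec.scale_right_distrib cvec.scale_left_distrib mult.commute)
  then show False
    using a.f_simple_group_module a.f_idem a.corner_coeff_f b.f_nonzero by simp
qed

text \<open>For \<open>t\<close> in the corner of an irreducible bimodule \<open>N\<close>, the map \<open>v \<otimes> \<phi> \<mapsto> v t y\<close>,
  where \<open>y\<close> represents \<open>\<phi>\<close>, is an isomorphism onto \<open>N\<close>. Conversely the corner of the tensor
  product contains the nonzero element \<open>f \<otimes> e*\<close>, where \<open>e*\<close> is the functional represented by \<open>e\<close>.\<close>

lemma tensor_isomorphic_iff:
  assumes N: "irreducible a b N"
  shows "bimodule_isomorphic (CG b) (CG a) ((hom_bimodule \<D> a b)\<lparr>carrier := N\<rparr>) T \<longleftrightarrow>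
    (\<exists>x \<in> N. \<gamma> x \<noteq> 0)"
proof
  have bi: "biideal a b N" using N by (simp add: irreducible_def)
  note ND = biidealD[OF bi]
  {
    assume "\<exists>x \<in> N. \<gamma> x \<noteq> 0"
    then obtain x\<^sub>0 where x\<^sub>0: "x\<^sub>0 \<in> N" "\<gamma> x\<^sub>0 \<noteq> 0" by blast
    define t where "t = \<gamma> x\<^sub>0"
    have t: "t \<in> N" "\<gamma> t = t" "t \<noteq> 0"
      using corner_in_biideal[OF bi x\<^sub>0(1)] corner_idem[of x\<^sub>0] x\<^sub>0 ND(2) by (auto simp: t_def)
    have tH: "t \<in> H a b" using t(1) ND(2) by blast
    note image = tensor_map_image[OF N t]
    \<comment> \<open>Any two preimages of \<open>n\<close> differ by an element of the kernel, so the choice does not affect the coset.\<close>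
    define lift where "lift n = (SOME x. x \<in> combinations (V \<times> W) \<and> tensor_map t x = n)" for n
    have lift: "lift n \<in> combinations (V \<times> W)" "tensor_map t (lift n) = n" if "n \<in> N" for n
    proof -
      have "\<exists>x. x \<in> combinations (V \<times> W) \<and> tensor_map t x = n"
        using that image by blast
      then have "lift n \<in> combinations (V \<times> W) \<and> tensor_map t (lift n) = n"
        unfolding lift_def by (rule someI_ex)
      then show "lift n \<in> combinations (V \<times> W)" "tensor_map t (lift n) = n" by blast+
    qed
    have eq: "coset x = coset y \<longleftrightarrow> tensor_map t x = tensor_map t y"
      if "x \<in> combinations (V \<times> W)" "y \<in> combinations (V \<times> W)" for x y
    proof -
      have "x - y \<in> combinations (V \<times> W)"
        using that by (rule cvec.subspace_diff[OF subspace_combinations])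
      then have "x - y \<in> kernel \<longleftrightarrow> tensor_map t (x - y) = 0"
        using tensor_map_injective[OF tH t(2,3)] tensor_map_kernel by blast
      then show ?thesis
        by (simp add: coset_eq_iff clinearD[OF clinear_tensor_map])
    qed
    have image_T: "(\<lambda>n. coset (lift n)) ` N = carrier T"
    proof (intro equalityI subsetI)
      fix X assume "X \<in> carrier T"
      then obtain x where x: "x \<in> combinations (V \<times> W)" "X = coset x"
        unfolding tensor_carrier by blast
      have n: "tensor_map t x \<in> N" using image x(1) by blast
      then show "X \<in> (\<lambda>n. coset (lift n)) ` N"
        using eq[OF x(1) lift(1)[OF n]] lift(2)[OF n] x(2)
        by (intro image_eqI[of _ _ "tensor_map t x"]) simp_all
    qed (use lift(1) in \<open>auto simp: tensor_carrier simp del: mem_Collect_eq\<close>)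
    have inj: "inj_on (\<lambda>n. coset (lift n)) N"
      using eq[OF lift(1) lift(1)] lift(2) by (intro inj_onI) simp
    have add: "coset (lift (x + y)) = coset (lift x) \<oplus>\<^bsub>T\<^esub> coset (lift y)" if "x \<in> N" "y \<in> N" for x y
    proof -
      have "lift x + lift y \<in> combinations (V \<times> W)"
        using lift(1) that by (intro cvec.subspace_add[OF subspace_combinations])
      then show ?thesis
        using eq[OF lift(1)[OF ND(6)[OF that]]] lift(2) that ND(6)[OF that]
        by (simp add: tensor_add clinearD[OF clinear_tensor_map])
    qed
    have left: "coset (lift (r \<star> x)) = r \<odot>\<^bsub>T\<^esub> coset (lift x)" if r: "r \<in> H b b" and x: "x \<in> N" for r x
      using eq[OF lift(1)[OF ND(3)[OF r x]] left_map_combinations[OF r lift(1)[OF x]]]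
        lift(2)[OF ND(3)[OF r x]] lift(2)[OF x] tensor_map_left[OF tH r lift(1)[OF x]]
      by (simp add: tensor_left[OF r])
    have right: "coset (lift (x \<star> s)) = bi_rsmult T (coset (lift x)) s" if s: "s \<in> H a a" and x: "x \<in> N" for s x
      using eq[OF lift(1)[OF ND(4)[OF s x]] right_map_combinations[OF s lift(1)[OF x]]]
        lift(2)[OF ND(4)[OF s x]] lift(2)[OF x] tensor_map_right[OF tH s lift(1)[OF x]]
      by (simp add: tensor_right[OF s])
    show "bimodule_isomorphic (CG b) (CG a) ((hom_bimodule \<D> a b)\<lparr>carrier := N\<rparr>) T"
      unfolding bimodule_isomorphic_def
      using image_T inj add left right
      by (intro exI[of _ "\<lambda>n. coset (lift n)"]) (simp add: bij_betw_def)
  }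
  assume "bimodule_isomorphic (CG b) (CG a) ((hom_bimodule \<D> a b)\<lparr>carrier := N\<rparr>) T"
  then obtain h where h: "bij_betw h N (carrier T)"
    "\<And>x y. x \<in> N \<Longrightarrow> y \<in> N \<Longrightarrow> h (x + y) = h x \<oplus>\<^bsub>T\<^esub> h y"
    "\<And>r x. r \<in> H b b \<Longrightarrow> x \<in> N \<Longrightarrow> h (r \<star> x) = r \<odot>\<^bsub>T\<^esub> h x"
    "\<And>s x. s \<in> H a a \<Longrightarrow> x \<in> N \<Longrightarrow> h (x \<star> s) = bi_rsmult T (h x) s"
    by (auto simp: bimodule_isomorphic_def)
  let ?g = "basis_elt (f, unit_functional)"
  have "coset ?g \<in> h ` N"
    using h(1) generator by (auto simp: bij_betw_def tensor_carrier simp del: mem_Collect_eq)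
  then obtain x where x: "x \<in> N" "h x = coset ?g" by force
  have "(\<lambda>u \<in> U. unit_functional (e \<star> u)) = unit_functional"
  proof (rule restrict_ext)
    fix u assume u: "u \<in> U"
    then have "u \<in> A" by (rule a.simple_group_module_arr_space)
    then show "unit_functional (e \<star> u) = a.corner_coeff (e \<star> u)"
      using a.act_simple_group_module[OF a.f_hom_space u] conv_assoc[OF a.f_arr_space a.f_arr_space, of u]
      by (simp add: a.f_idem)
  qed
  then have "h (\<gamma> x) = coset ?g"
    using h(4)[OF a.f_hom_space ND(3)[OF b.f_hom_space x(1)]] h(3)[OF b.f_hom_space x(1)] x(2)
    by (simp add: tensor_left[OF b.f_hom_space] tensor_right[OF a.f_hom_space] left_map_def right_map_def b.f_idem)
  moreover have "h 0 \<noteq> coset ?g"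
  proof
    assume "h 0 = coset ?g"
    then have "coset ?g = coset (?g + ?g)"
      using h(2)[OF ND(5) ND(5)] by (simp add: tensor_add)
    then have "- ?g \<in> kernel" by (simp add: coset_eq_iff)
    then show False
      using generator_not_in_kernel cvec.subspace_neg[OF subspace_kernel] by force
  qed
  ultimately show "\<exists>x \<in> N. \<gamma> x \<noteq> 0"
    using x(1) by metis
qed

theorem constituent_multiplicity_hom_bimodule:
  "constituent_multiplicity (CG b) (CG a) (hom_bimodule \<D> a b) T (cvec.dim (\<gamma> ` H a b))"
  unfolding constituent_multiplicity_def
proof (intro conjI allI impI)
  note iff = irreducible_decomposition_iff[OF a.c b.c]
  show "\<exists>X. irreducible_decomposition (CG b) (CG a) (hom_bimodule \<D> a b) X"
    using decomposition_exists[OF a.c b.c biideal_hom_space] unfolding iff by blast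
  fix X assume "irreducible_decomposition (CG b) (CG a) (hom_bimodule \<D> a b) X"
  then have X: "\<forall>N \<in> X. irreducible a b N" "direct_summands (H a b) X"
    unfolding iff by auto
  have "{N \<in> X. bimodule_isomorphic (CG b) (CG a) ((hom_bimodule \<D> a b)\<lparr>carrier := N\<rparr>) T} =
      {N \<in> X. \<exists>x \<in> N. \<gamma> x \<noteq> 0}"
    using tensor_isomorphic_iff X(1) by blast
  then show "card {N \<in> X. bimodule_isomorphic (CG b) (CG a) ((hom_bimodule \<D> a b)\<lparr>carrier := N\<rparr>) T} =
      cvec.dim (\<gamma> ` H a b)"
    using card_corner_summands[OF X(2,1)] by simp
qed

text \<open>Both sides are \<open>f A e\<close>, since \<open>f\<close> and \<open>e\<close> only see the morphisms from \<open>a\<close> to \<open>b\<close>.\<close>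

lemma corner_projective: "(\<lambda>x. f \<star> x) ` carrier (P e) = \<gamma> ` H a b"
proof (intro equalityI subsetI)
  fix y assume "y \<in> (\<lambda>x. f \<star> x) ` carrier (P e)"
  then obtain x where x: "y = f \<star> x" "x \<in> A" "x \<star> e = x"
    by (auto simp: carrier_projective[OF a.f_arr_space a.f_idem])
  have A: "unit a \<in> A" "unit b \<in> A"
    using a.c b.c unit_hom_space hom_space_arr_space by metis+
  have "\<gamma> (unit b \<star> x \<star> unit a) = (f \<star> unit b) \<star> (x \<star> (unit a \<star> e))"
    using x(2) A a.f_arr_space b.f_arr_space by (simp only: conv_assoc conv_arr_space)
  also have "\<dots> = y"
    using x(1,3) unit_left[OF a.f_hom_space a.c] unit_right[OF b.f_hom_space b.c] by simp
  finally show "y \<in> \<gamma> ` H a b"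
    using unit_corner[OF x(2) a.c b.c] by blast
next
  fix y assume "y \<in> \<gamma> ` H a b"
  then obtain x where x: "y = \<gamma> x" "x \<in> H a b" by blast
  note A = hom_space_arr_space[OF x(2)]
  have "x \<star> e \<in> carrier (P e)"
    using A a.f_arr_space a.f_idem
    by (simp add: carrier_projective conv_arr_space conv_assoc)
  moreover have "y = f \<star> (x \<star> e)"
    using x(1) A a.f_arr_space b.f_arr_space by (simp add: conv_assoc)
  ultimately show "y \<in> (\<lambda>x. f \<star> x) ` carrier (P e)" by blast
qed

end

section \<open>The multiplicity formula\<close>

theorem proposition3p6:
  fixes \<D> :: "('o, 'm) cat"
    and E :: "'o \<Rightarrow> ('m \<Rightarrow>\<^sub>0 complex) set"
    and I :: "'o \<Rightarrow> 'i set"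
    and e :: "'i \<Rightarrow> ('m \<Rightarrow>\<^sub>0 complex)"
    and a b :: 'o and i j :: 'i
  assumes "category \<D>" and "finite_cat \<D>" and "skeletal \<D>" and "EI_cat \<D>"
    and "\<And>c. c \<in> Obj \<D> \<Longrightarrow> complete_primitive_orthogonal_idempotents (group_algebra \<D> c) (E c)"
    and "\<And>c. c \<in> Obj \<D> \<Longrightarrow> indexes_idempotents (group_algebra \<D> c) (E c) (I c) e"
    and "\<And>c d. c \<in> Obj \<D> \<Longrightarrow> d \<in> Obj \<D> \<Longrightarrow> c \<noteq> d \<Longrightarrow> I c \<inter> I d = {}"
    and "a \<in> Obj \<D>" and "b \<in> Obj \<D>" and "i \<in> I a" and "j \<in> I b"
  shows "\<exists>n. jordan_hoelder_multiplicity (category_algebra \<D>)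
        (projective_module \<D> (e i)) (simple_category_module \<D> (e j)) n
      \<and> constituent_multiplicity (group_algebra \<D> b) (group_algebra \<D> a)
        (hom_bimodule \<D> a b)
        (tensor_bimodule (group_algebra \<D> b) (group_algebra \<D> a)
          (simple_group_module \<D> b (e j))
          (dual_module (group_algebra \<D> a) (simple_group_module \<D> a (e i)))) n"
proof -
  have primitive: "primitive_idempotent (group_algebra \<D> c) (e k)" if "c \<in> Obj \<D>" "k \<in> I c" for c k
    using assms(5)[OF that(1)] assms(6)[OF that(1)] that(2)
    by (auto simp: complete_primitive_orthogonal_idempotents_def indexes_idempotents_def)
  interpret primitive_pair \<D> a "e i" b "e j"
    using assms(1,2,4,8,9) primitive[OF assms(8,10)] primitive[OF assms(9,11)]
    by (intro primitive_pair.intro primitive_in_category.intro finite_EI_category.intro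
        primitive_in_category_axioms.intro finite_EI_category_axioms.intro)
  show ?thesis
    using b.jordan_hoelder_multiplicity_projective[OF a.f_arr_space a.f_idem]
      constituent_multiplicity_hom_bimodule
    unfolding corner_projective by blast
qed

end
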